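(* For each computable ordinal $\alpha$ (i.e. $\alpha<\omega_1^{CK}$) there is an automatic structure whose Scott rank is at least $\alpha$.
   Context: Automatic structures: for a finite alphabet $\Sigma$ and padding symbol $\diamond\notin\Sigma$, the convolution of $(w_1,\dots,w_n)\in(\Sigma^\star)^n$ is the word of length $\max_i|w_i|$ over $(\Sigma\cup\{\diamond\})^n$ whose $k$-th letter is $(\sigma_1,\dots,\sigma_n)$, with $\sigma_i$ the $k$-th letter of $w_i$ if $k\le|w_i|$ and $\diamond$ otherwise; a relation is regular if its set of convolutions is accepted by a finite automaton; a structure in a finite relational vocabulary is automatic if (it is isomorphic to one whose) domain is a regular subset of $\Sigma^\star$ and all relations are regular. Scott rank: for tuples $\bar a,\bar b$ of equal length in a structure $\mathcal A$, $\bar a\equiv^0\bar b$ if they satisfy the same quantifier-free formulas; for $\alpha>0$, $\bar a\equiv^\alpha\bar b$ if for every $\beta<\alpha$, for every tuple $\bar c$ there is $\bar d$ with $\bar a\bar c\equiv^\beta\bar b\bar d$, and for every $\bar d$ there is $\bar c$ with $\bar a\bar c\equiv^\beta\bar b\bar d$. The Scott rank of $\bar a$ is the least $\beta$ such that for all $\bar b$, $\bar a\equiv^\beta\bar b$ implies $(\mathcal A,\bar a)\cong(\mathcal A,\bar b)$. The Scott rank of $\mathcal A$ is the least ordinal greater than the Scott ranks of all tuples of $\mathcal A$. *)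

theory Defs
  imports Main "HOL-Library.Countable"
begin

section \<open>Countable ordinals\<close>

text \<open>Ordinals below \<open>\<omega>\<^sub>1\<close>: isomorphism classes of well-orders on subsets of the natural numbers.
  (The relation \<^const>\<open>ordIso\<close> only relates well-orders.)\<close>

quotient_type countable_ordinal = "nat rel" / partial: "\<lambda>r s. (r, s) \<in> ordIso"
proof (rule part_equivpI)
  show "\<exists>r :: nat rel. (r, r) \<in> ordIso"
    by (rule exI[of _ "{}"], rule ordIso_reflexive, simp)
  show "symp (\<lambda>r s :: nat rel. (r, s) \<in> ordIso)"
    by (rule sympI) (rule ordIso_symmetric)
  show "transp (\<lambda>r s :: nat rel. (r, s) \<in> ordIso)"
    by (rule transpI) (rule ordIso_transitive)
qed

definition order_type :: "nat rel \<Rightarrow> countable_ordinal" where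
  "order_type = abs_countable_ordinal"

lemma ordIso_Well_order:
  "(r, s) \<in> ordIso \<Longrightarrow> Well_order r \<and> Well_order s"
  by (simp add: ordIso_def)

instantiation countable_ordinal :: "{zero, wellorder}"
begin

lift_definition zero_countable_ordinal :: countable_ordinal is "{} :: nat rel"
  by (rule ordIso_reflexive) simp

lift_definition less_eq_countable_ordinal :: "countable_ordinal \<Rightarrow> countable_ordinal \<Rightarrow> bool"
  is "\<lambda>r s. (r, s) \<in> ordLeq"
  by (meson ordIso_ordLeq_trans ordIso_symmetric ordLeq_ordIso_trans)

lift_definition less_countable_ordinal :: "countable_ordinal \<Rightarrow> countable_ordinal \<Rightarrow> bool"
  is "\<lambda>r s. (r, s) \<in> ordLess"
  by (meson ordIso_ordLess_trans ordIso_symmetric ordLess_ordIso_trans)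

instance
proof
  fix x y z :: countable_ordinal
  show "x < y \<longleftrightarrow> x \<le> y \<and> \<not> y \<le> x"
    by transfer (meson not_ordLeq_iff_ordLess ordIso_Well_order ordLess_imp_ordLeq)
  show "x \<le> x"
    by transfer (meson ordIso_Well_order ordLeq_reflexive)
  show "x \<le> y \<Longrightarrow> y \<le> z \<Longrightarrow> x \<le> z"
    by transfer (rule ordLeq_transitive)
  show "x \<le> y \<Longrightarrow> y \<le> x \<Longrightarrow> x = y"
    by transfer (simp add: ordIso_iff_ordLeq)
  show "x \<le> y \<or> y \<le> x"
    by transfer (meson ordIso_Well_order ordLeq_total)
next
  fix P :: "countable_ordinal \<Rightarrow> bool" and a
  assume step: "\<And>x. (\<And>y. y < x \<Longrightarrow> P y) \<Longrightarrow> P x"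
  have "wf (inv_image ordLess rep_countable_ordinal)"
    by (intro wf_inv_image wf_ordLess)
  then show "P a"
  proof (induction a rule: wf_induct_rule)
    case (less x)
    show ?case
      by (rule step, rule less.IH) (simp add: less_countable_ordinal.rep_eq)
  qed
qed

end

lemma countable_ordinal_zero_le: "0 \<le> (x :: countable_ordinal)"
  by transfer (auto simp: ordLeq_def embed_def dest: ordIso_Well_order)


section \<open>Computable ordinals\<close>

text \<open>Computability is defined by register machines. A program is a list of instructions, executed
  from position 0 and halting at any position outside the list. \<open>Inc i l\<close> increments register \<open>i\<close> and
  continues at \<open>l\<close>; \<open>Dec i l l'\<close> decrements register \<open>i\<close> and continues at \<open>l\<close> if the register is
  nonzero, and continues at \<open>l'\<close> otherwise.\<close>

datatype instr = Inc nat nat | Dec nat nat nat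

type_synonym config = "nat \<times> (nat \<Rightarrow> nat)"

fun exec :: "instr \<Rightarrow> (nat \<Rightarrow> nat) \<Rightarrow> config" where
  "exec (Inc i l) \<rho> = (l, \<rho>(i := Suc (\<rho> i)))"
| "exec (Dec i l l') \<rho> = (if \<rho> i = 0 then (l', \<rho>) else (l, \<rho>(i := \<rho> i - 1)))"

fun machine_step :: "instr list \<Rightarrow> config \<Rightarrow> config" where
  "machine_step P (pc, \<rho>) = (if pc < length P then exec (P ! pc) \<rho> else (pc, \<rho>))"

definition halts_with :: "instr list \<Rightarrow> (nat \<Rightarrow> nat) \<Rightarrow> nat \<Rightarrow> bool" where
  "halts_with P \<rho> out \<longleftrightarrow>
     (\<exists>k pc \<rho>'. (machine_step P ^^ k) (0, \<rho>) = (pc, \<rho>') \<and> length P \<le> pc \<and> \<rho>' 0 = out)"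

definition computable_rel :: "nat rel \<Rightarrow> bool" where
  "computable_rel R \<longleftrightarrow>
     (\<exists>P. \<forall>m n. halts_with P ((\<lambda>_. 0)(0 := m, 1 := n)) (if (m, n) \<in> R then 1 else 0))"

text \<open>Well-orders are reflexive on their field, so computability of \<open>r\<close> includes computability of
  its field. Finite ordinals are covered since the field may be any subset of the naturals.\<close>

definition computable_ordinal :: "countable_ordinal \<Rightarrow> bool" where
  "computable_ordinal \<alpha> \<longleftrightarrow> (\<exists>r. Well_order r \<and> computable_rel r \<and> order_type r = \<alpha>)"


section \<open>Relational structures\<close>

text \<open>\<open>vocab A ! i\<close> is the (positive) arity of the relation symbol \<open>i\<close>; the vocabulary is thus finite.\<close>

record 'a struct =
  univ :: "'a set"
  vocab :: "nat list"
  rel :: "nat \<Rightarrow> 'a list set"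

definition tuples :: "'a struct \<Rightarrow> 'a list set" where
  "tuples A = lists (univ A)"

definition is_structure :: "'a struct \<Rightarrow> bool" where
  "is_structure A \<longleftrightarrow> univ A \<noteq> {} \<and> (\<forall>n \<in> set (vocab A). 0 < n) \<and>
     (\<forall>i < length (vocab A). rel A i \<subseteq> {xs \<in> tuples A. length xs = vocab A ! i})"

definition is_iso :: "('a \<Rightarrow> 'b) \<Rightarrow> 'a struct \<Rightarrow> 'b struct \<Rightarrow> bool" where
  "is_iso f A B \<longleftrightarrow> vocab A = vocab B \<and> bij_betw f (univ A) (univ B) \<and>
     (\<forall>i < length (vocab A). \<forall>xs \<in> tuples A. length xs = vocab A ! i \<longrightarrow>
        (xs \<in> rel A i \<longleftrightarrow> map f xs \<in> rel B i))"

definition isomorphic :: "'a struct \<Rightarrow> 'b struct \<Rightarrow> bool" where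
  "isomorphic A B \<longleftrightarrow> (\<exists>f. is_iso f A B)"

text \<open>\<open>(A, xs) \<cong> (B, ys)\<close> for the expansions by constants.\<close>

definition isomorphic_with :: "'a struct \<Rightarrow> 'a list \<Rightarrow> 'b struct \<Rightarrow> 'b list \<Rightarrow> bool" where
  "isomorphic_with A xs B ys \<longleftrightarrow> (\<exists>f. is_iso f A B \<and> map f xs = ys)"


section \<open>Automatic structures\<close>

record 'l nfa =
  states :: "nat set"
  start :: nat
  delta :: "nat \<Rightarrow> 'l \<Rightarrow> nat set"
  final :: "nat set"

definition nfa_over :: "'l set \<Rightarrow> 'l nfa \<Rightarrow> bool" where
  "nfa_over \<Gamma> M \<longleftrightarrow> finite (states M) \<and> start M \<in> states M \<and> final M \<subseteq> states M \<and>
     (\<forall>q \<in> states M. \<forall>a \<in> \<Gamma>. delta M q a \<subseteq> states M)"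

fun reach :: "'l nfa \<Rightarrow> nat \<Rightarrow> 'l list \<Rightarrow> nat set" where
  "reach M q [] = {q}"
| "reach M q (a # w) = (\<Union>q' \<in> delta M q a. reach M q' w)"

definition language :: "'l set \<Rightarrow> 'l nfa \<Rightarrow> 'l list set" where
  "language \<Gamma> M = {w \<in> lists \<Gamma>. reach M (start M) w \<inter> final M \<noteq> {}}"

definition regular :: "'l set \<Rightarrow> 'l list set \<Rightarrow> bool" where
  "regular \<Gamma> L \<longleftrightarrow> (\<exists>M. nfa_over \<Gamma> M \<and> language \<Gamma> M = L)"

text \<open>The padding symbol is \<^const>\<open>None\<close>; proper letters are tagged with \<^const>\<open>Some\<close>.\<close>

definition convolution :: "'s list list \<Rightarrow> 's option list list" where
  "convolution ws =
     map (\<lambda>k. map (\<lambda>w. if k < length w then Some (w ! k) else None) ws)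
       [0..<Max (length ` set ws)]"

definition conv_alphabet :: "'s set \<Rightarrow> nat \<Rightarrow> 's option list set" where
  "conv_alphabet \<Sigma> n = {l. length l = n \<and> set l \<subseteq> insert None (Some ` \<Sigma>)}"

definition regular_rel :: "'s set \<Rightarrow> nat \<Rightarrow> 's list list set \<Rightarrow> bool" where
  "regular_rel \<Sigma> n R \<longleftrightarrow> regular (conv_alphabet \<Sigma> n) (convolution ` R)"

definition automatic_presentation :: "'s set \<Rightarrow> 's list struct \<Rightarrow> bool" where
  "automatic_presentation \<Sigma> B \<longleftrightarrow> finite \<Sigma> \<and> is_structure B \<and> regular \<Sigma> (univ B) \<and>
     (\<forall>i < length (vocab B). regular_rel \<Sigma> (vocab B ! i) (rel B i))"

text \<open>Every finite alphabet can be taken to be a finite set of naturals.\<close>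

definition automatic :: "'a struct \<Rightarrow> bool" where
  "automatic A \<longleftrightarrow> is_structure A \<and>
     (\<exists>\<Sigma> (B :: nat list struct). automatic_presentation \<Sigma> B \<and> isomorphic A B)"


section \<open>Scott rank\<close>

datatype qf_formula =
    Falsum
  | Equal nat nat
  | Atom nat "nat list"
  | Neg qf_formula
  | Conj qf_formula qf_formula
  | Disj qf_formula qf_formula

text \<open>\<open>wf_qf ar n \<phi>\<close>: \<open>\<phi>\<close> is a formula in the vocabulary \<open>ar\<close> and the variables \<open>0, \<dots>, n - 1\<close>.\<close>

fun wf_qf :: "nat list \<Rightarrow> nat \<Rightarrow> qf_formula \<Rightarrow> bool" where
  "wf_qf ar n Falsum \<longleftrightarrow> True"
| "wf_qf ar n (Equal i j) \<longleftrightarrow> i < n \<and> j < n"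
| "wf_qf ar n (Atom s is) \<longleftrightarrow> s < length ar \<and> length is = ar ! s \<and> (\<forall>i \<in> set is. i < n)"
| "wf_qf ar n (Neg \<phi>) \<longleftrightarrow> wf_qf ar n \<phi>"
| "wf_qf ar n (Conj \<phi> \<psi>) \<longleftrightarrow> wf_qf ar n \<phi> \<and> wf_qf ar n \<psi>"
| "wf_qf ar n (Disj \<phi> \<psi>) \<longleftrightarrow> wf_qf ar n \<phi> \<and> wf_qf ar n \<psi>"

fun sat :: "'a struct \<Rightarrow> 'a list \<Rightarrow> qf_formula \<Rightarrow> bool" where
  "sat A xs Falsum \<longleftrightarrow> False"
| "sat A xs (Equal i j) \<longleftrightarrow> xs ! i = xs ! j"
| "sat A xs (Atom s is) \<longleftrightarrow> map (\<lambda>i. xs ! i) is \<in> rel A s"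
| "sat A xs (Neg \<phi>) \<longleftrightarrow> \<not> sat A xs \<phi>"
| "sat A xs (Conj \<phi> \<psi>) \<longleftrightarrow> sat A xs \<phi> \<and> sat A xs \<psi>"
| "sat A xs (Disj \<phi> \<psi>) \<longleftrightarrow> sat A xs \<phi> \<or> sat A xs \<psi>"

definition same_qf :: "'a struct \<Rightarrow> 'a list \<Rightarrow> 'a list \<Rightarrow> bool" where
  "same_qf A xs ys \<longleftrightarrow>
     (\<forall>\<phi>. wf_qf (vocab A) (length xs) \<phi> \<longrightarrow> (sat A xs \<phi> \<longleftrightarrow> sat A ys \<phi>))"

text \<open>The relation \<open>xs \<equiv>\<^sup>\<alpha> ys\<close>, meaningful for \<open>xs\<close>, \<open>ys\<close> of equal length.\<close>

function scott_equiv :: "'a struct \<Rightarrow> countable_ordinal \<Rightarrow> 'a list \<Rightarrow> 'a list \<Rightarrow> bool" where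
  "scott_equiv A \<alpha> xs ys \<longleftrightarrow>
     (if \<alpha> = 0 then same_qf A xs ys
      else \<forall>\<beta> < \<alpha>.
        (\<forall>cs \<in> tuples A. \<exists>ds \<in> tuples A. length ds = length cs \<and>
            scott_equiv A \<beta> (xs @ cs) (ys @ ds)) \<and>
        (\<forall>ds \<in> tuples A. \<exists>cs \<in> tuples A. length cs = length ds \<and>
            scott_equiv A \<beta> (xs @ cs) (ys @ ds)))"
  by pat_completeness auto
termination
  by (relation "inv_image {(\<beta>, \<alpha>). \<beta> < \<alpha>} (\<lambda>(A, \<alpha>, xs, ys). \<alpha>)") (auto intro: wf_inv_image wf)

declare scott_equiv.simps [simp del]

text \<open>In a countable structure all Scott ranks are countable, so the least ordinals below exist
  among the countable ones; hence the restriction to countable types.\<close>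

definition tuple_scott_rank :: "'a::countable struct \<Rightarrow> 'a list \<Rightarrow> countable_ordinal" where
  "tuple_scott_rank A xs =
     (LEAST \<beta>. \<forall>ys \<in> tuples A. length ys = length xs \<longrightarrow> scott_equiv A \<beta> xs ys \<longrightarrow>
        isomorphic_with A xs A ys)"

definition scott_rank :: "'a::countable struct \<Rightarrow> countable_ordinal" where
  "scott_rank A = (LEAST \<beta>. \<forall>xs \<in> tuples A. tuple_scott_rank A xs < \<beta>)"

end

theory Submission
  imports Defs "HOL-Library.Countable_Set" "HOL-Library.Product_Lexorder"
begin

text \<open>
  Let \<open>r\<close> be a well-order of type \<open>\<alpha>\<close> decided by a register machine, and consider the tree of finite
  sequences of pairs \<open>(x, m)\<close> that descend lexicographically. If every child is repeated infinitely
  often, a node ending in \<open>(x, m)\<close> has children of exactly the ranks below \<open>\<omega> rk(x) + m\<close>, so nodes of rank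
  at least \<open>\<omega>\<beta>\<close> are \<open>\<equiv>\<^sup>\<beta>\<close>-equivalent while automorphisms preserve ranks. To make this automatic, all
  sequences of pairs are admitted, and each node carries the chain of configurations of a machine that
  checks its last descent: this machine runs forever if the descent is correct and halts otherwise. So
  the correct nodes are those with an infinite chain, and only the one-step relation of the machine has
  to be regular. The lengths of the finite chains must not reveal anything about \<open>r\<close>; therefore every node
  also gets, for every pair and every finite length, infinitely many children that are marked as
  incorrect and whose chain has this length. Configurations contain their history, so that chains do
  not merge, and configurations that are not attached to a node are irrelevant because they can be fixed
  by all partial isomorphisms.
\<close>

section \<open>Countable ordinals\<close>

text \<open>The order \<open>r\<close> cannot in general be a relation of the structure: automatic
  well-orders stay below \<omega>^\<omega>. A single machine step, however, changes only the ends of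
  a few words, which a finite automaton can check. Correct claims are those that never halt because
  all infinite chains are isomorphic, whereas an accepting run of finite length would expose this
  length and could separate nodes of equal rank.

  The second component \<open>m\<close> pays for the moves of the game. Adding an element deep in
  the tree means adding the path that leads to it, and each new node costs one unit of the threshold
  up to which ranks must agree. A move may consist of any finite number of elements, so no fixed
  price per move suffices; but a threshold \<open>(\<beta>, 0)\<close> may be lowered to
  \<open>(\<gamma>, n)\<close> for each \<gamma> < \<beta> and each \<open>n\<close>, as large as
  the move demands. The tuples that witness the Scott rank are single nodes with one level: those
  over \<open>x\<close> and \<open>y\<close> with \<open>rk x = \<beta>\<close> and
  \<open>rk y = \<gamma> < \<beta>\<close> are equivalent at stage \<gamma>, but no automorphism
  maps one to the other.\<close>

lemma order_type_less_iff:
  assumes "Well_order r" "Well_order s"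
  shows "order_type r < order_type s \<longleftrightarrow> (r, s) \<in> ordLess"
proof -
  have "abs_countable_ordinal r < abs_countable_ordinal s \<longleftrightarrow> (r, s) \<in> ordLess"
    using assms by (intro less_countable_ordinal.abs_eq) (auto intro: ordIso_reflexive)
  then show ?thesis by (simp add: order_type_def)
qed

lemma order_type_eq_iff:
  assumes "Well_order r" "Well_order s"
  shows "order_type r = order_type s \<longleftrightarrow> (r, s) \<in> ordIso"
  using Quotient3_rel[OF Quotient3_countable_ordinal, of r s] assms
  by (simp add: order_type_def ordIso_reflexive)

lemma order_type_surj: "\<exists>r. Well_order r \<and> order_type r = \<beta>"
proof -
  have "(rep_countable_ordinal \<beta>, rep_countable_ordinal \<beta>) \<in> ordIso"
    by (rule Quotient3_rep_reflp[OF Quotient3_countable_ordinal])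
  moreover have "abs_countable_ordinal (rep_countable_ordinal \<beta>) = \<beta>"
    by (rule Quotient3_abs_rep[OF Quotient3_countable_ordinal])
  ultimately show ?thesis
    using ordIso_Well_order by (auto simp: order_type_def)
qed

section \<open>Ordinals below a given one as initial segments\<close>

abbreviation segment_type :: "nat rel \<Rightarrow> nat \<Rightarrow> countable_ordinal" where
  "segment_type r a \<equiv> order_type (Restr r (underS r a))"

lemma less_order_type_iff:
  assumes "Well_order r"
  shows "\<beta> < order_type r \<longleftrightarrow> (\<exists>a \<in> Field r. \<beta> = segment_type r a)"
proof -
  obtain s where s: "Well_order s" "order_type s = \<beta>"
    using order_type_surj by blast
  have "\<beta> < order_type r \<longleftrightarrow> (s, r) \<in> ordLess"
    using order_type_less_iff[OF s(1) assms] s(2) by simp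
  also have "\<dots> \<longleftrightarrow> (\<exists>a \<in> Field r. (s, Restr r (underS r a)) \<in> ordIso)"
    by (rule ordLess_iff_ordIso_Restr[OF assms s(1)])
  also have "\<dots> \<longleftrightarrow> (\<exists>a \<in> Field r. \<beta> = segment_type r a)"
    using order_type_eq_iff[OF s(1) Well_order_Restr[OF assms]] s(2) by metis
  finally show ?thesis .
qed

lemma segment_type_less:
  assumes "Well_order r" "(a, b) \<in> r" "a \<noteq> b"
  shows "segment_type r a < segment_type r b"
proof -
  interpret wo_rel r by standard (rule assms(1))
  have sub: "Order_Relation.underS r a \<subset> Order_Relation.underS r b"
  proof
    show "Order_Relation.underS r a \<subseteq> Order_Relation.underS r b"
      using assms TRANS ANTISYM unfolding Order_Relation.underS_def trans_def antisym_def by blast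
    show "Order_Relation.underS r a \<noteq> Order_Relation.underS r b"
      using assms unfolding Order_Relation.underS_def by blast
  qed
  have "wo_rel.ofilter r (Order_Relation.underS r a)" "wo_rel.ofilter r (Order_Relation.underS r b)"
    by (auto intro: underS_ofilter)
  then have "(Restr r (Order_Relation.underS r a), Restr r (Order_Relation.underS r b)) \<in> ordLess"
    using ofilter_subset_ordLess[OF assms(1)] sub by blast
  then show ?thesis
    by (simp add: order_type_less_iff Well_order_Restr assms(1))
qed

lemma less_segment_type:
  assumes "Well_order r" "a \<in> Field r" "\<beta> < segment_type r a"
  shows "\<exists>b. (b, a) \<in> r \<and> b \<noteq> a \<and> \<beta> = segment_type r b"
proof -
  interpret wo_rel r by standard (rule assms(1))
  have "segment_type r a < order_type r"
    using less_order_type_iff[OF assms(1)] assms(2) by blast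
  then obtain b where b: "b \<in> Field r" "\<beta> = segment_type r b"
    using less_order_type_iff[OF assms(1)] assms(3) by (meson less_trans)
  have "b \<noteq> a" using b assms(3) by auto
  moreover have "(a, b) \<notin> r"
    using segment_type_less[OF assms(1), of a b] b assms(3) \<open>b \<noteq> a\<close> by auto
  ultimately show ?thesis
    using b assms(2) TOTALS by blast
qed

section \<open>Uncountability and strict bounds of countable sets\<close>

lemma countable_less_countable_ordinal: "countable {\<gamma>. \<gamma> < (\<beta> :: countable_ordinal)}"
proof -
  obtain r where r: "Well_order r" "order_type r = \<beta>"
    using order_type_surj by blast
  have "{\<gamma>. \<gamma> < \<beta>} = segment_type r ` Field r"
    using less_order_type_iff[OF r(1)] r(2) by auto
  then show ?thesis by simp
qed

text \<open>Burali-Forti: an injection into the naturals would turn the order of all countable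
  ordinals into a well-order on naturals, whose type would exceed each of its own members.\<close>

lemma uncountable_countable_ordinal: "\<not> countable (UNIV :: countable_ordinal set)"
proof
  assume "countable (UNIV :: countable_ordinal set)"
  then obtain e :: "countable_ordinal \<Rightarrow> nat" where e: "inj e"
    by (auto simp: countable_def)
  define r where "r = {(e x, e y) | x y. x \<le> y}"
  have Field_r: "Field r = range e"
    by (auto simp: r_def Field_def)
  have mem: "(e x, e y) \<in> r \<longleftrightarrow> x \<le> y" for x y
    using e by (auto simp: r_def inj_def)
  have wf: "wf (r - Id)"
  proof (rule wf_subset)
    show "wf (inv_image {(x, y). x < y} (inv e))"
      by (intro wf_inv_image wf)
    show "r - Id \<subseteq> inv_image {(x, y). x < y} (inv e)"
      using e by (auto simp: r_def inv_image_def le_less)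
  qed
  have r: "Well_order r"
    unfolding well_order_on_def linear_order_on_def partial_order_on_def preorder_on_def
      refl_on_def total_on_def Field_r
  proof (intro conjI)
    show "trans r"
    proof (rule transI)
      fix x y z assume "(x, y) \<in> r" "(y, z) \<in> r"
      then show "(x, z) \<in> r"
        using e unfolding r_def inj_def by simp (metis order_trans)
    qed
    show "antisym r"
    proof (rule antisymI)
      fix x y assume "(x, y) \<in> r" "(y, x) \<in> r"
      then show "x = y"
        using e unfolding r_def inj_def by simp (metis order_antisym)
    qed
    show "\<forall>x\<in>range e. \<forall>y\<in>range e. x \<noteq> y \<longrightarrow> (x, y) \<in> r \<or> (y, x) \<in> r"
      using linear by (auto simp: mem)
  qed (use wf in \<open>auto simp: r_def\<close>)
  \<comment> \<open>A strictly increasing map of ordinals never decreases: at a least counterexample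
    \<open>x\<close>, the smaller value \<open>?y\<close> would be another one.\<close>
  have ge: "x \<le> segment_type r (e x)" for x
  proof (induction x rule: less_induct)
    case (less x)
    show ?case
    proof (rule ccontr)
      assume "\<not> x \<le> segment_type r (e x)"
      then have lt: "segment_type r (e x) < x" by simp
      let ?y = "segment_type r (e x)"
      have "(e ?y, e x) \<in> r" "e ?y \<noteq> e x"
        using lt e by (auto simp: mem inj_eq)
      then have "segment_type r (e ?y) < ?y"
        using segment_type_less[OF r] by blast
      then show False
        using less.IH[OF lt] by simp
    qed
  qed
  have "segment_type r (e (order_type r)) < order_type r"
    using less_order_type_iff[OF r] Field_r by blast
  then show False
    using ge[of "order_type r"] by simp
qed

text \<open>Otherwise the ordinals would be a countable union of countable sets. This is what makes
  the least ordinals in later arguments exist.\<close>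

lemma countable_imp_strict_bound:
  assumes "countable (S :: countable_ordinal set)"
  shows "\<exists>\<gamma>. \<forall>\<beta> \<in> S. \<beta> < \<gamma>"
proof (rule ccontr)
  assume "\<nexists>\<gamma>. \<forall>\<beta> \<in> S. \<beta> < \<gamma>"
  then have "\<forall>\<gamma>. \<exists>\<beta> \<in> S. \<gamma> \<le> \<beta>" by (meson not_less)
  then have "UNIV = (\<Union>\<beta> \<in> S. insert \<beta> {\<gamma>. \<gamma> < \<beta>})"
    by (auto simp: le_less)
  moreover have "countable (\<Union>\<beta> \<in> S. insert \<beta> {\<gamma>. \<gamma> < \<beta>})"
    using assms countable_less_countable_ordinal by auto
  ultimately show False
    using uncountable_countable_ordinal by simp
qed

text \<open>\<open>rk x\<close> is the least strict bound of the earlier values. Transitivity makes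
  the ranks of the immediate predecessors a full initial segment; in this form the well-order enters
  the tree, where the children of a node must realize all smaller ranks.\<close>

lemma transitive_wf_rank_exists:
  fixes R :: "nat rel"
  assumes "wf R" "trans R"
  shows "\<exists>rk :: nat \<Rightarrow> countable_ordinal. \<forall>x. {rk y | y. (y, x) \<in> R} = {\<gamma>. \<gamma> < rk x}"
proof -
  define F where "F = (\<lambda>(g :: nat \<Rightarrow> countable_ordinal) x. LEAST \<gamma>. \<forall>y. (y, x) \<in> R \<longrightarrow> g y < \<gamma>)"
  define rk where "rk = wfrec R F"
  have rk: "rk x = (LEAST \<gamma>. \<forall>y. (y, x) \<in> R \<longrightarrow> rk y < \<gamma>)" for x
  proof -
    have "rk x = F (cut rk R x) x"
      unfolding rk_def by (rule wfrec[OF assms(1)])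
    also have "\<dots> = (LEAST \<gamma>. \<forall>y. (y, x) \<in> R \<longrightarrow> rk y < \<gamma>)"
      unfolding F_def by (rule arg_cong[of _ _ Least]) (auto simp: cut_apply fun_eq_iff)
    finally show ?thesis .
  qed
  have lt: "rk y < rk x" if "(y, x) \<in> R" for x y
  proof -
    have "\<exists>\<gamma>. \<forall>\<beta> \<in> rk ` {y. (y, x) \<in> R}. \<beta> < \<gamma>"
      by (rule countable_imp_strict_bound) auto
    then obtain \<gamma> where "\<forall>y. (y, x) \<in> R \<longrightarrow> rk y < \<gamma>" by auto
    then have "\<forall>y. (y, x) \<in> R \<longrightarrow> rk y < rk x"
      unfolding rk[of x] by (rule LeastI)
    with that show ?thesis by blast
  qed
  have surj: "\<exists>y. (y, x) \<in> R \<and> \<gamma> = rk y" if "\<gamma> < rk x" for x \<gamma>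
    using assms(1) that
  proof (induction x arbitrary: \<gamma> rule: wf_induct_rule)
    case (less x)
    have "\<not> (\<forall>y. (y, x) \<in> R \<longrightarrow> rk y < \<gamma>)"
      using less.prems not_less_Least unfolding rk[of x] by blast
    then obtain y where y: "(y, x) \<in> R" "\<gamma> \<le> rk y" by (auto simp: not_less)
    show ?case
    proof (cases "\<gamma> = rk y")
      case False
      then have "\<gamma> < rk y" using y(2) by simp
      then obtain z where "(z, y) \<in> R" "\<gamma> = rk z"
        using less.IH[OF y(1)] by blast
      then show ?thesis
        using transD[OF assms(2) _ y(1)] by blast
    qed (use y in blast)
  qed
  show ?thesis
    by (rule exI[of _ rk]) (auto intro: lt dest: surj)
qed

section \<open>Scott ranks\<close>

lemma scott_equiv_0: "scott_equiv A 0 xs ys \<longleftrightarrow> same_qf A xs ys"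
  by (subst scott_equiv.simps) simp

lemma scott_equiv_extend:
  assumes "scott_equiv A \<alpha> xs ys" "\<beta> < \<alpha>"
  shows "\<forall>cs \<in> tuples A. \<exists>ds \<in> tuples A. length ds = length cs \<and>
            scott_equiv A \<beta> (xs @ cs) (ys @ ds)"
    and "\<forall>ds \<in> tuples A. \<exists>cs \<in> tuples A. length cs = length ds \<and>
            scott_equiv A \<beta> (xs @ cs) (ys @ ds)"
proof -
  have nz: "\<alpha> \<noteq> 0" using assms(2) countable_ordinal_zero_le[of \<beta>] by auto
  show "\<forall>cs \<in> tuples A. \<exists>ds \<in> tuples A. length ds = length cs \<and>
            scott_equiv A \<beta> (xs @ cs) (ys @ ds)"
    and "\<forall>ds \<in> tuples A. \<exists>cs \<in> tuples A. length cs = length ds \<and>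
            scott_equiv A \<beta> (xs @ cs) (ys @ ds)"
    using assms(1)[unfolded scott_equiv.simps[of A \<alpha>] if_not_P[OF nz]] assms(2) by blast+
qed

text \<open>Extend by the empty tuple, whose only possible answer is the empty tuple.\<close>

lemma scott_equiv_mono:
  assumes "scott_equiv A \<alpha> xs ys" "\<beta> \<le> \<alpha>"
  shows "scott_equiv A \<beta> xs ys"
proof (cases "\<beta> = \<alpha>")
  case False
  then have lt: "\<beta> < \<alpha>" using assms(2) by simp
  have "[] \<in> tuples A" by (simp add: tuples_def)
  then show ?thesis
    using scott_equiv_extend(1)[OF assms(1) lt] by force
qed (use assms in simp)

text \<open>Countably many pairs of tuples become inequivalent at countably many stages.\<close>

lemma scott_equiv_stabilizes:
  fixes A :: "'a::countable struct"
  shows "\<exists>\<gamma>. \<forall>xs ys. scott_equiv A \<gamma> xs ys \<longrightarrow> (\<forall>\<beta>. scott_equiv A \<beta> xs ys)"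
proof -
  define s where "s = (\<lambda>(xs, ys). LEAST \<beta>. \<not> scott_equiv A \<beta> xs ys)"
  obtain \<gamma> where \<gamma>: "\<forall>\<beta> \<in> range s. \<beta> < \<gamma>"
    using countable_imp_strict_bound[of "range s"] by auto
  have "scott_equiv A \<beta> xs ys" if "scott_equiv A \<gamma> xs ys" for xs ys \<beta>
  proof (rule ccontr)
    assume "\<not> scott_equiv A \<beta> xs ys"
    then have "\<not> scott_equiv A (s (xs, ys)) xs ys"
      unfolding s_def by simp (rule LeastI)
    moreover have "s (xs, ys) \<le> \<gamma>" using \<gamma> by (simp add: less_imp_le)
    ultimately show False using scott_equiv_mono that by blast
  qed
  then show ?thesis by blast
qed

lemma same_qf_Equal:
  assumes "same_qf A xs ys" "i < length xs" "j < length xs"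
  shows "xs ! i = xs ! j \<longleftrightarrow> ys ! i = ys ! j"
proof -
  have "wf_qf (vocab A) (length xs) (Equal i j)" using assms by simp
  then have "sat A xs (Equal i j) \<longleftrightarrow> sat A ys (Equal i j)"
    using assms(1) unfolding same_qf_def by blast
  then show ?thesis by simp
qed

lemma same_qf_Atom:
  assumes "same_qf A xs ys" "s < length (vocab A)" "length is = vocab A ! s" "\<forall>i \<in> set is. i < length xs"
  shows "map (\<lambda>i. xs ! i) is \<in> rel A s \<longleftrightarrow> map (\<lambda>i. ys ! i) is \<in> rel A s"
proof -
  have "wf_qf (vocab A) (length xs) (Atom s is)" using assms by simp
  then have "sat A xs (Atom s is) \<longleftrightarrow> sat A ys (Atom s is)"
    using assms(1) unfolding same_qf_def by blast
  then show ?thesis by simp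
qed

text \<open>Cantor's argument for a family \<open>G\<close> of finite partial isomorphisms with
  one-point extensions in both directions. Countability of the type lets stage \<open>n\<close> put
  \<open>from_nat n\<close> on both sides.\<close>

lemma back_and_forth:
  fixes A :: "'a::countable struct"
  assumes base: "G xs ys"
    and G: "\<And>xs ys. G xs ys \<Longrightarrow> xs \<in> tuples A \<and> ys \<in> tuples A \<and> length xs = length ys \<and> same_qf A xs ys"
    and fwd: "\<And>xs ys c. G xs ys \<Longrightarrow> c \<in> univ A \<Longrightarrow> \<exists>d. G (xs @ [c]) (ys @ [d])"
    and bwd: "\<And>xs ys d. G xs ys \<Longrightarrow> d \<in> univ A \<Longrightarrow> \<exists>c. G (xs @ [c]) (ys @ [d])"
  shows "isomorphic_with A xs A ys"
proof -
  have "\<exists>q. G (fst q) (snd q) \<and> (\<exists>es fs. fst q = fst p @ es \<and> snd q = snd p @ fs) \<and>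
        (from_nat n \<in> univ A \<longrightarrow> from_nat n \<in> set (fst q) \<and> from_nat n \<in> set (snd q))"
    if p: "G (fst p) (snd p)" for p n
  proof (cases "from_nat n \<in> univ A")
    case True
    obtain d where d: "G (fst p @ [from_nat n]) (snd p @ [d])"
      using fwd[OF p True] by blast
    obtain c where "G ((fst p @ [from_nat n]) @ [c]) ((snd p @ [d]) @ [from_nat n])"
      using bwd[OF d True] by blast
    then show ?thesis
      by (intro exI[of _ "((fst p @ [from_nat n]) @ [c], (snd p @ [d]) @ [from_nat n])"]) auto
  next
    case False
    then show ?thesis using p by (intro exI[of _ p]) auto
  qed
  then obtain nx where nx: "\<And>p n. G (fst p) (snd p) \<Longrightarrow> G (fst (nx p n)) (snd (nx p n)) \<and>
      (\<exists>es fs. fst (nx p n) = fst p @ es \<and> snd (nx p n) = snd p @ fs) \<and>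
      (from_nat n \<in> univ A \<longrightarrow> from_nat n \<in> set (fst (nx p n)) \<and> from_nat n \<in> set (snd (nx p n)))"
    by metis
  define q where "q = rec_nat (xs, ys) (\<lambda>n p. nx p n)"
  have q0: "q 0 = (xs, ys)" and qS: "q (Suc n) = nx (q n) n" for n
    by (simp_all add: q_def)
  have Gq: "G (fst (q n)) (snd (q n))" for n
    by (induction n) (use base nx in \<open>auto simp: q0 qS\<close>)
  define X where "X n = fst (q n)" for n
  define Y where "Y n = snd (q n)" for n
  have ext: "\<exists>es fs. X (n + k) = X n @ es \<and> Y (n + k) = Y n @ fs" for n k
  proof (induction k)
    case (Suc k)
    then show ?case
      using nx[OF Gq, of "n + k" "n + k"] by (auto simp: X_def Y_def qS)
  qed simp
  have len: "length (X n) = length (Y n)" and tup: "X n \<in> tuples A" "Y n \<in> tuples A"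
    and qf: "same_qf A (X n) (Y n)" for n
    using G[OF Gq, of n] by (auto simp: X_def Y_def)
  have nth: "X m ! i = X n ! i \<and> Y m ! i = Y n ! i" if "i < length (X m)" "m \<le> n" for i m n
    using ext[of m "n - m"] that len by (auto simp: nth_append)
  have lenmono: "length (X m) \<le> length (X n)" if "m \<le> n" for m n
    using ext[of m "n - m"] that by auto
  have cov: "\<exists>n i. i < length (X n) \<and> X n ! i = a" "\<exists>n i. i < length (X n) \<and> Y n ! i = a"
    if "a \<in> univ A" for a
  proof -
    have "a \<in> set (X (Suc (to_nat a)))" "a \<in> set (Y (Suc (to_nat a)))"
      using nx[OF Gq, of "to_nat a" "to_nat a"] that by (auto simp: X_def Y_def qS)
    then show "\<exists>n i. i < length (X n) \<and> X n ! i = a" "\<exists>n i. i < length (X n) \<and> Y n ! i = a"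
      using len by (metis in_set_conv_nth)+
  qed
  \<comment> \<open>Two positions that hold the same element are compared in a common later stage,
    where \<open>same_qf\<close> carries the equality over to \<open>Y\<close>; so the value does
    not depend on the position.\<close>
  have "\<exists>f. \<forall>n. \<forall>i < length (X n). f (X n ! i) = Y n ! i"
  proof -
    have "\<exists>b. \<forall>n. \<forall>i < length (X n). X n ! i = a \<longrightarrow> b = Y n ! i" for a
    proof (cases "\<exists>n i. i < length (X n) \<and> X n ! i = a")
      case True
      then obtain n i where ni: "i < length (X n)" "X n ! i = a" by blast
      have "Y n ! i = Y m ! j" if "j < length (X m)" "X m ! j = a" for m j
      proof -
        let ?k = "max m n"
        have *: "i < length (X ?k)" "j < length (X ?k)"
          using ni that lenmono[of n ?k] lenmono[of m ?k] by auto
        have "X ?k ! i = X ?k ! j" using nth ni that by (metis max.cobounded1 max.cobounded2)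
        then have "Y ?k ! i = Y ?k ! j" using same_qf_Equal[OF qf *] by simp
        then show ?thesis using nth ni that by (metis max.cobounded1 max.cobounded2)
      qed
      then show ?thesis by blast
    qed blast
    then show ?thesis by metis
  qed
  then obtain f where f: "\<And>n i. i < length (X n) \<Longrightarrow> f (X n ! i) = Y n ! i" by blast
  have inU: "X n ! i \<in> univ A" "Y n ! i \<in> univ A" if "i < length (X n)" for n i
    using tup[of n] that len[of n] by (auto simp: tuples_def in_lists_conv_set)
  \<comment> \<open>A finite tuple lies within a single stage, which reduces injectivity and the
    preservation of relations to \<open>same_qf\<close> at that stage.\<close>
  have common: "\<exists>n is. xs' = map (\<lambda>i. X n ! i) is \<and> (\<forall>i \<in> set is. i < length (X n))"
    if "xs' \<in> tuples A" for xs'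
    using that
  proof (induction xs')
    case (Cons a xs')
    then obtain n "is" where 1: "xs' = map (\<lambda>i. X n ! i) is" "\<forall>i \<in> set is. i < length (X n)"
      by (auto simp: tuples_def)
    obtain m i where 2: "i < length (X m)" "X m ! i = a"
      using Cons.prems cov(1)[of a] by (auto simp: tuples_def)
    let ?k = "max m n"
    have "a # xs' = map (\<lambda>i. X ?k ! i) (i # is)"
      using 1 2 nth[of _ n ?k] nth[of i m ?k] by auto
    moreover have "\<forall>j \<in> set (i # is). j < length (X ?k)"
      using 1 2 lenmono[of n ?k] lenmono[of m ?k] by fastforce
    ultimately show ?case by (intro exI[of _ ?k] exI[of _ "i # is"] conjI)
  qed simp
  have "is_iso f A A"
    unfolding is_iso_def
  proof (intro conjI allI ballI impI)
    show "bij_betw f (univ A) (univ A)"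
      unfolding bij_betw_def
    proof
      show "inj_on f (univ A)"
      proof (rule inj_onI)
        fix a b assume ab: "a \<in> univ A" "b \<in> univ A" "f a = f b"
        have "[a, b] \<in> tuples A" using ab by (simp add: tuples_def)
        from common[OF this]
        obtain n "is" where n: "[a, b] = map (\<lambda>i. X n ! i) is" "\<forall>i \<in> set is. i < length (X n)"
          by (elim exE conjE)
        then obtain i j where ij: "is = [i, j]" by auto
        then show "a = b"
          using n ab(3) f same_qf_Equal[OF qf, of i n j] by auto
      qed
      show "f ` univ A = univ A"
      proof
        show "f ` univ A \<subseteq> univ A"
          using cov(1) f inU by (metis image_subsetI)
        show "univ A \<subseteq> f ` univ A"
          using cov(2) f inU by (metis image_iff subsetI)
      qed
    qed
  next
    fix s xs' assume s: "s < length (vocab A)" and xs': "xs' \<in> tuples A" "length xs' = vocab A ! s"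
    obtain n "is" where n: "xs' = map (\<lambda>i. X n ! i) is" "\<forall>i \<in> set is. i < length (X n)"
      using common[OF xs'(1)] by blast
    have "map f xs' = map (\<lambda>i. Y n ! i) is"
      using n f by auto
    then show "xs' \<in> rel A s \<longleftrightarrow> map f xs' \<in> rel A s"
      using same_qf_Atom[OF qf s, of "is" n] n(2) xs'(2) unfolding n(1) by (simp only: length_map)
  qed simp
  moreover have "map f xs = ys"
    using f[of _ 0] len[of 0] by (auto intro!: nth_equalityI simp: X_def Y_def q0)
  ultimately show ?thesis
    unfolding isomorphic_with_def by blast
qed

text \<open>Once the equivalences have stabilized at \<gamma>, equivalence at \<gamma> implies
  equivalence at some \<delta> > \<gamma>, and a move from \<delta> leads back to \<gamma>. So stage
  \<gamma> is a back-and-forth family, and \<open>tuple_scott_rank\<close> is an attained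
  minimum.\<close>

lemma scott_equiv_imp_isomorphic_exists:
  fixes A :: "'a::countable struct"
  shows "\<exists>\<gamma>. \<forall>xs \<in> tuples A. \<forall>ys \<in> tuples A. length ys = length xs \<longrightarrow> scott_equiv A \<gamma> xs ys \<longrightarrow>
    isomorphic_with A xs A ys"
proof -
  obtain \<gamma> where \<gamma>: "\<And>xs ys \<beta>. scott_equiv A \<gamma> xs ys \<Longrightarrow> scott_equiv A \<beta> xs ys"
    using scott_equiv_stabilizes[of A] by blast
  obtain \<delta> where \<delta>: "\<gamma> < \<delta>"
    using countable_imp_strict_bound[of "{\<gamma>}"] by auto
  have "isomorphic_with A xs A ys"
    if xy: "xs \<in> tuples A" "ys \<in> tuples A" "length ys = length xs" "scott_equiv A \<gamma> xs ys" for xs ys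
  proof (rule back_and_forth[where G = "\<lambda>xs ys. xs \<in> tuples A \<and> ys \<in> tuples A \<and> length xs = length ys \<and>
      scott_equiv A \<gamma> xs ys"])
    fix xs ys assume G: "xs \<in> tuples A \<and> ys \<in> tuples A \<and> length xs = length ys \<and> scott_equiv A \<gamma> xs ys"
    then show "xs \<in> tuples A \<and> ys \<in> tuples A \<and> length xs = length ys \<and> same_qf A xs ys"
      using \<gamma> scott_equiv_0 by blast
    have eq: "scott_equiv A \<delta> xs ys" using G \<gamma> by blast
    fix c assume "c \<in> univ A"
    then have c: "[c] \<in> tuples A" by (simp add: tuples_def)
    obtain ds where "ds \<in> tuples A" "length ds = 1" "scott_equiv A \<gamma> (xs @ [c]) (ys @ ds)"
      using scott_equiv_extend(1)[OF eq \<delta>] c by fastforce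
    then show "\<exists>d. xs @ [c] \<in> tuples A \<and> ys @ [d] \<in> tuples A \<and> length (xs @ [c]) = length (ys @ [d]) \<and>
        scott_equiv A \<gamma> (xs @ [c]) (ys @ [d])"
      using G c by (auto simp: tuples_def length_Suc_conv)
    obtain cs where "cs \<in> tuples A" "length cs = 1" "scott_equiv A \<gamma> (xs @ cs) (ys @ [c])"
      using scott_equiv_extend(2)[OF eq \<delta>] c by fastforce
    then show "\<exists>d. xs @ [d] \<in> tuples A \<and> ys @ [c] \<in> tuples A \<and> length (xs @ [d]) = length (ys @ [c]) \<and>
        scott_equiv A \<gamma> (xs @ [d]) (ys @ [c])"
      using G c by (auto simp: tuples_def length_Suc_conv)
  qed (use xy in auto)
  then show ?thesis by blast
qed

text \<open>If the Scott rank were some \<beta> < \<alpha>, the tuple supplied for this \<beta>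
  would have rank at least \<beta>, although all tuples have rank below the Scott rank.\<close>

lemma le_scott_rankI:
  fixes A :: "'a::countable struct"
  assumes "\<And>\<beta>. \<beta> < \<alpha> \<Longrightarrow> \<exists>xs \<in> tuples A. \<forall>\<gamma> < \<beta>. \<exists>ys \<in> tuples A. length ys = length xs \<and>
    scott_equiv A \<gamma> xs ys \<and> \<not> isomorphic_with A xs A ys"
  shows "\<alpha> \<le> scott_rank A"
proof (rule ccontr)
  assume "\<not> \<alpha> \<le> scott_rank A"
  then have "scott_rank A < \<alpha>" by simp
  then obtain xs where xs: "xs \<in> tuples A" and *: "\<And>\<gamma>. \<gamma> < scott_rank A \<Longrightarrow>
      \<exists>ys \<in> tuples A. length ys = length xs \<and> scott_equiv A \<gamma> xs ys \<and> \<not> isomorphic_with A xs A ys"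
    using assms by blast
  have "\<exists>\<beta>. \<forall>\<gamma> \<in> range (tuple_scott_rank A). \<gamma> < \<beta>"
    by (rule countable_imp_strict_bound) simp
  then have ex: "\<exists>\<beta>. \<forall>xs \<in> tuples A. tuple_scott_rank A xs < \<beta>" by auto
  have "\<forall>xs \<in> tuples A. tuple_scott_rank A xs < scott_rank A"
    unfolding scott_rank_def by (rule LeastI_ex[OF ex])
  then have "tuple_scott_rank A xs < scott_rank A" using xs by blast
  moreover have "\<forall>ys \<in> tuples A. length ys = length xs \<longrightarrow> scott_equiv A (tuple_scott_rank A xs) xs ys \<longrightarrow>
      isomorphic_with A xs A ys"
    unfolding tuple_scott_rank_def
    by (rule LeastI_ex) (use scott_equiv_imp_isomorphic_exists[of A] xs in blast)
  ultimately show False using * by blast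
qed

section \<open>Transport of Scott equivalence along isomorphisms\<close>

lemma is_iso_tuples:
  assumes "is_iso f A B" "xs \<in> tuples A"
  shows "map f xs \<in> tuples B"
  using assms by (auto simp: is_iso_def tuples_def bij_betw_def in_lists_conv_set)

lemma is_iso_tuples_surj:
  assumes "is_iso f A B" "ys \<in> tuples B"
  shows "\<exists>xs \<in> tuples A. ys = map f xs"
proof -
  have "ys \<in> lists (f ` univ A)"
    using assms by (simp add: is_iso_def tuples_def bij_betw_def)
  then show ?thesis
    by (auto simp: tuples_def lists_image)
qed

lemma sat_iso:
  assumes f: "is_iso f A B" and "xs \<in> tuples A" "wf_qf (vocab A) (length xs) \<phi>"
  shows "sat B (map f xs) \<phi> \<longleftrightarrow> sat A xs \<phi>"
  using assms(3)
proof (induction \<phi>)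
  case (Equal i j)
  then have "xs ! i \<in> univ A" "xs ! j \<in> univ A"
    using assms(2) by (auto simp: tuples_def in_lists_conv_set)
  then show ?case
    using Equal f by (auto simp: is_iso_def bij_betw_def inj_on_def)
next
  case (Atom s "is")
  let ?zs = "map (\<lambda>i. xs ! i) is"
  have "?zs \<in> tuples A" using Atom assms(2) by (auto simp: tuples_def in_lists_conv_set)
  moreover have "map (\<lambda>i. map f xs ! i) is = map f ?zs" using Atom by auto
  moreover have "sat B (map f xs) (Atom s is) \<longleftrightarrow> map f ?zs \<in> rel B s"
    using calculation(2) by (simp only: sat.simps)
  ultimately show ?case
    using Atom f unfolding is_iso_def by (metis length_map sat.simps(3) wf_qf.simps(3))
qed auto

lemma same_qf_iso:
  assumes "is_iso f A B" "xs \<in> tuples A" "ys \<in> tuples A" "length xs = length ys" "same_qf A xs ys"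
  shows "same_qf B (map f xs) (map f ys)"
proof -
  have "vocab A = vocab B" using assms(1) by (simp add: is_iso_def)
  then show ?thesis
    using assms sat_iso[OF assms(1,2)] sat_iso[OF assms(1,3)] by (simp add: same_qf_def)
qed

lemma scott_equiv_iso:
  assumes f: "is_iso f A B"
  shows "xs \<in> tuples A \<Longrightarrow> ys \<in> tuples A \<Longrightarrow> length xs = length ys \<Longrightarrow> scott_equiv A \<beta> xs ys \<Longrightarrow>
    scott_equiv B \<beta> (map f xs) (map f ys)"
proof (induction \<beta> arbitrary: xs ys rule: less_induct)
  case (less \<beta>)
  have app: "us @ vs \<in> tuples A" if "us \<in> tuples A" "vs \<in> tuples A" for us vs
    using that by (auto simp: tuples_def)
  show ?case
  proof (cases "\<beta> = 0")
    case True
    then show ?thesis using less.prems same_qf_iso[OF f] by (simp add: scott_equiv_0)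
  next
    case False
    show ?thesis
      unfolding scott_equiv.simps[of B \<beta>] if_not_P[OF False]
    proof (intro allI impI conjI ballI)
      fix \<gamma> cs assume \<gamma>: "\<gamma> < \<beta>" and "cs \<in> tuples B"
      then obtain cs' where cs': "cs' \<in> tuples A" "cs = map f cs'"
        using is_iso_tuples_surj[OF f] by blast
      obtain ds where ds: "ds \<in> tuples A" "length ds = length cs'" "scott_equiv A \<gamma> (xs @ cs') (ys @ ds)"
        using scott_equiv_extend(1)[OF less.prems(4) \<gamma>] cs' by blast
      show "\<exists>ds \<in> tuples B. length ds = length cs \<and> scott_equiv B \<gamma> (map f xs @ cs) (map f ys @ ds)"
        using less.IH[OF \<gamma> app app _ ds(3)] ds cs' less.prems is_iso_tuples[OF f ds(1)]
        by (intro bexI[of _ "map f ds"]) auto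
    next
      fix \<gamma> ds assume \<gamma>: "\<gamma> < \<beta>" and "ds \<in> tuples B"
      then obtain ds' where ds': "ds' \<in> tuples A" "ds = map f ds'"
        using is_iso_tuples_surj[OF f] by blast
      obtain cs where cs: "cs \<in> tuples A" "length cs = length ds'" "scott_equiv A \<gamma> (xs @ cs) (ys @ ds')"
        using scott_equiv_extend(2)[OF less.prems(4) \<gamma>] ds' by blast
      show "\<exists>cs \<in> tuples B. length cs = length ds \<and> scott_equiv B \<gamma> (map f xs @ cs) (map f ys @ ds)"
        using less.IH[OF \<gamma> app app _ cs(3)] cs ds' less.prems is_iso_tuples[OF f cs(1)]
        by (intro bexI[of _ "map f cs"]) auto
    qed
  qed
qed

lemma is_iso_comp:
  assumes f: "is_iso f A B" and g: "is_iso g B C"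
  shows "is_iso (g \<circ> f) A C"
  using f g is_iso_tuples[OF f] unfolding is_iso_def
  by (auto intro: bij_betw_trans)

lemma is_iso_inv:
  assumes f: "is_iso f A B"
  shows "is_iso (inv_into (univ A) f) B A"
  unfolding is_iso_def
proof (intro conjI allI ballI impI)
  let ?g = "inv_into (univ A) f"
  have bij: "bij_betw f (univ A) (univ B)" using f by (simp add: is_iso_def)
  then show "bij_betw ?g (univ B) (univ A)" by (rule bij_betw_inv_into)
  show "vocab B = vocab A" using f by (simp add: is_iso_def)
  fix i xs assume xs: "xs \<in> tuples B" "i < length (vocab B)" "length xs = vocab B ! i"
  then obtain xs' where xs': "xs' \<in> tuples A" "xs = map f xs'"
    using is_iso_tuples_surj[OF f] by blast
  have "map ?g xs = xs'"
    using xs' bij by (auto simp: tuples_def in_lists_conv_set bij_betw_def intro!: map_idI)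
  then show "xs \<in> rel B i \<longleftrightarrow> map ?g xs \<in> rel A i"
    using f xs xs' by (auto simp: is_iso_def)
qed

lemma isomorphic_with_iso:
  assumes f: "is_iso f A B" and xs: "xs \<in> tuples A" "ys \<in> tuples A"
    and iso: "isomorphic_with B (map f xs) B (map f ys)"
  shows "isomorphic_with A xs A ys"
proof -
  obtain g where g: "is_iso g B B" "map g (map f xs) = map f ys"
    using iso by (auto simp: isomorphic_with_def)
  let ?h = "inv_into (univ A) f"
  have "map ?h (map f ys) = ys"
    using f xs by (auto simp: tuples_def in_lists_conv_set is_iso_def bij_betw_def intro!: map_idI)
  then have "map (?h \<circ> (g \<circ> f)) xs = ys"
    using g(2) by (metis list.map_comp)
  moreover have "is_iso (?h \<circ> (g \<circ> f)) A A"
    by (intro is_iso_comp[OF _ is_iso_inv[OF f]] is_iso_comp[OF f g(1)])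
  ultimately show ?thesis
    unfolding isomorphic_with_def by blast
qed

section \<open>Regular relations on tuples of words\<close>

text \<open>One half of the Myhill-Nerode theorem: the finitely many codes of classes serve as
  states, and \<open>delta\<close> is single-valued on them because \<open>g\<close> is a right
  congruence on words over \<open>\<Gamma>\<close>.\<close>

lemma regular_congruence:
  fixes g :: "'l list \<Rightarrow> nat"
  assumes fin: "finite (g ` lists \<Gamma>)"
    and cong: "\<And>x y a. x \<in> lists \<Gamma> \<Longrightarrow> y \<in> lists \<Gamma> \<Longrightarrow> a \<in> \<Gamma> \<Longrightarrow> g x = g y \<Longrightarrow> g (x @ [a]) = g (y @ [a])"
  shows "regular \<Gamma> {w \<in> lists \<Gamma>. g w \<in> F}"
proof -
  define M where "M = \<lparr>states = g ` lists \<Gamma>, start = g [],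
    delta = (\<lambda>q a. {g (x @ [a]) | x. x \<in> lists \<Gamma> \<and> g x = q}), final = F \<inter> g ` lists \<Gamma>\<rparr>"
  have reach: "reach M (g x) w = {g (x @ w)}" if "x \<in> lists \<Gamma>" "w \<in> lists \<Gamma>" for x w
    using that
  proof (induction w arbitrary: x)
    case (Cons a w)
    have "delta M (g x) a = {g (x @ [a])}"
    proof -
      have "g (y @ [a]) = g (x @ [a])" if "y \<in> lists \<Gamma>" "g y = g x" for y
        using Cons.prems by (intro cong that) auto
      then have "{g (y @ [a]) | y. y \<in> lists \<Gamma> \<and> g y = g x} = {g (x @ [a])}"
        using Cons.prems(1) by blast
      then show ?thesis by (simp add: M_def)
    qed
    then show ?case
      using Cons.IH[of "x @ [a]"] Cons.prems by simp
  qed simp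
  have "nfa_over \<Gamma> M"
  proof -
    have "delta M q a \<subseteq> states M" if "a \<in> \<Gamma>" for q a
      using that by (auto simp: M_def intro!: imageI)
    then show ?thesis
      using fin by (auto simp: nfa_over_def M_def)
  qed
  moreover have "language \<Gamma> M = {w \<in> lists \<Gamma>. g w \<in> F}"
  proof -
    have "reach M (start M) w = {g w}" if "w \<in> lists \<Gamma>" for w
      using reach[of "[]" w] that by (simp add: M_def)
    moreover have "g w \<in> final M \<longleftrightarrow> g w \<in> F" if "w \<in> lists \<Gamma>" for w
      using that by (auto simp: M_def)
    ultimately have "reach M (start M) w \<inter> final M \<noteq> {} \<longleftrightarrow> g w \<in> F" if "w \<in> lists \<Gamma>" for w
      using that by simp
    then show ?thesis
      unfolding language_def by blast
  qed
  ultimately show ?thesis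
    unfolding regular_def by blast
qed

section \<open>Convolutions as sequences of columns\<close>

definition letter_at :: "'s list \<Rightarrow> nat \<Rightarrow> 's option" where
  "letter_at w n = (if n < length w then Some (w ! n) else None)"

lemma letter_at_simps [simp]:
  "letter_at [] n = None"
  "letter_at (a # w) 0 = Some a"
  "letter_at (a # w) (Suc n) = letter_at w n"
  by (auto simp: letter_at_def)

lemma letter_at_None_iff: "letter_at w n = None \<longleftrightarrow> length w \<le> n"
  by (auto simp: letter_at_def)

lemma list_eq_letter_at: "u = v \<longleftrightarrow> (\<forall>n. letter_at u n = letter_at v n)"
proof
  assume *: "\<forall>n. letter_at u n = letter_at v n"
  then have "length u \<le> n \<longleftrightarrow> length v \<le> n" for n
    by (metis letter_at_None_iff)
  then have "length u = length v" by (meson order_antisym order_refl)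
  moreover have "u ! n = v ! n" if "n < length u" for n
    using *[rule_format, of n] that calculation by (simp add: letter_at_def)
  ultimately show "u = v" by (rule nth_equalityI)
qed simp

abbreviation column :: "'s list list \<Rightarrow> nat \<Rightarrow> 's option list" where
  "column ws n \<equiv> map (\<lambda>w. letter_at w n) ws"

lemma convolution_altdef: "convolution ws = map (column ws) [0..<Max (length ` set ws)]"
  by (simp add: convolution_def letter_at_def)

lemma length_convolution: "length (convolution ws) = Max (length ` set ws)"
  by (simp add: convolution_def)

lemma nth_convolution: "n < length (convolution ws) \<Longrightarrow> convolution ws ! n = column ws n"
  by (simp add: convolution_altdef)

lemma length_le_convolution: "w \<in> set ws \<Longrightarrow> length w \<le> length (convolution ws)"
  by (simp add: length_convolution)

lemma length_convolution_le_iff: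
  assumes "ws \<noteq> []"
  shows "length (convolution ws) \<le> n \<longleftrightarrow> column ws n = replicate (length ws) None"
proof -
  have "length (convolution ws) \<le> n \<longleftrightarrow> (\<forall>w \<in> set ws. length w \<le> n)"
    using assms by (simp add: length_convolution)
  also have "\<dots> \<longleftrightarrow> column ws n = map (\<lambda>w. None) ws"
    by (simp only: map_eq_conv letter_at_None_iff)
  finally show ?thesis by (simp add: map_replicate_const)
qed

text \<open>The letters of each word, including the padding that marks its end, are visible in the
  columns. An empty convolution does not show the number of words, so this number has to agree
  separately.\<close>

lemma convolution_inject:
  assumes "convolution us = convolution ws" "length us = length ws"
  shows "us = ws"
proof (rule nth_equalityI)
  fix i assume i: "i < length us"
  have "letter_at (us ! i) n = letter_at (ws ! i) n" for n
  proof (cases "n < length (convolution us)")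
    case True
    then have "column us n = column ws n"
      using assms by (metis nth_convolution)
    then show ?thesis
      using i assms(2) by (metis length_map nth_map)
  next
    case False
    then have "length (us ! i) \<le> n" "length (ws ! i) \<le> n"
      using length_le_convolution[of "us ! i" us] length_le_convolution[of "ws ! i" ws] i assms
      by auto
    then show ?thesis by (simp add: letter_at_def)
  qed
  then show "us ! i = ws ! i" by (simp add: list_eq_letter_at)
qed (rule assms(2))

text \<open>A \<^emph>\<open>padded\<close> sequence of columns is one that arises as a convolution.\<close>

definition padded_step :: "'s option list \<Rightarrow> 's option list \<Rightarrow> bool" where
  "padded_step l l' \<longleftrightarrow> list_all2 (\<lambda>a b. a = None \<longrightarrow> b = None) l l'"

definition padded :: "nat \<Rightarrow> 's option list list \<Rightarrow> bool" where
  "padded k xs \<longleftrightarrow> (\<forall>l \<in> set xs. length l = k \<and> l \<noteq> replicate k None) \<and>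
     (\<forall>n. Suc n < length xs \<longrightarrow> padded_step (xs ! n) (xs ! Suc n))"

lemma padded_convolution:
  assumes "ws \<noteq> []"
  shows "padded (length ws) (convolution ws)"
  unfolding padded_def
proof (intro conjI ballI allI impI)
  fix l assume "l \<in> set (convolution ws)"
  then obtain n where n: "n < length (convolution ws)" "l = column ws n"
    by (metis in_set_conv_nth nth_convolution)
  then show "length l = length ws" by simp
  show "l \<noteq> replicate (length ws) None"
    using length_convolution_le_iff[OF assms, of n] n by auto
next
  fix n assume "Suc n < length (convolution ws)"
  then show "padded_step (convolution ws ! n) (convolution ws ! Suc n)"
    by (auto simp: nth_convolution padded_step_def list_all2_conv_all_nth letter_at_None_iff)
qed

text \<open>Each track is read up to its first padding symbol. Padding is permanent, so nothing is
  lost behind it, and since no column consists of padding only, the convolution does not end too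
  early.\<close>

lemma padded_imp_convolution:
  assumes "padded k xs" "0 < k" "\<forall>l \<in> set xs. set l \<subseteq> insert None (Some ` \<Sigma>)"
  shows "\<exists>ws. length ws = k \<and> convolution ws = xs \<and> set ws \<subseteq> lists \<Sigma>"
proof -
  define c where "c i = map (\<lambda>l. the (l ! i)) (takeWhile (\<lambda>l. l ! i \<noteq> None) xs)" for i
  have len: "length (xs ! n) = k" and nN: "xs ! n \<noteq> replicate k None" if "n < length xs" for n
    using assms(1) that by (auto simp: padded_def)
  have step: "xs ! n ! i = None \<longrightarrow> xs ! Suc n ! i = None" if "Suc n < length xs" "i < k" for n i
    using assms(1) that len[of n] by (auto simp: padded_def padded_step_def list_all2_conv_all_nth)
  have mono: "xs ! m ! i = None" if "xs ! n ! i = None" "n \<le> m" "m < length xs" "i < k" for n m i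
    using that(2,3)
  proof (induction m rule: dec_induct)
    case (step m)
    then show ?case using \<open>i < k\<close> \<open>\<And>i n. Suc n < length xs \<Longrightarrow> i < k \<Longrightarrow> xs ! n ! i = None \<longrightarrow> xs ! Suc n ! i = None\<close>
      by auto
  qed (use that in simp)
  have at: "letter_at (c i) n = xs ! n ! i" if "n < length xs" "i < k" for n i
  proof (cases "n < length (takeWhile (\<lambda>l. l ! i \<noteq> None) xs)")
    case True
    then have "takeWhile (\<lambda>l. l ! i \<noteq> None) xs ! n = xs ! n"
      by (rule takeWhile_nth)
    moreover have "takeWhile (\<lambda>l. l ! i \<noteq> None) xs ! n ! i \<noteq> None"
      using True nth_mem set_takeWhileD by fastforce
    ultimately show ?thesis using True by (auto simp: letter_at_def c_def)
  next
    case False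
    let ?m = "length (takeWhile (\<lambda>l. l ! i \<noteq> None) xs)"
    have "?m < length xs" using False that by simp
    then have "xs ! ?m ! i = None" using nth_length_takeWhile by blast
    then show ?thesis using mono[of ?m i n] False that by (simp add: letter_at_def c_def)
  qed
  have lenc: "length (c i) \<le> length xs" for i
    by (simp add: c_def length_takeWhile_le)
  define ws where "ws = map c [0..<k]"
  have k: "length ws = k" "ws \<noteq> []" using assms(2) by (auto simp: ws_def)
  have col: "column ws n = xs ! n" if "n < length xs" for n
    using that len[of n] at by (auto simp: ws_def intro: nth_equalityI)
  have "length (convolution ws) = length xs"
  proof (rule order_antisym)
    have "column ws (length xs) = replicate k None"
      using lenc by (auto simp: ws_def letter_at_None_iff intro: nth_equalityI)
    then show "length (convolution ws) \<le> length xs"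
      using length_convolution_le_iff[OF k(2)] k(1) by simp
    show "length xs \<le> length (convolution ws)"
    proof (rule ccontr)
      assume "\<not> ?thesis"
      then have lt: "length (convolution ws) < length xs" by simp
      show False
        using length_convolution_le_iff[OF k(2), of "length (convolution ws)"] k(1) col[OF lt] nN[OF lt]
        by simp
    qed
  qed
  then have "convolution ws = xs"
    by (intro nth_equalityI) (simp_all add: nth_convolution col)
  moreover have "c i \<in> lists \<Sigma>" if "i < k" for i
  proof -
    have "c i ! n \<in> \<Sigma>" if n: "n < length (c i)" for n
    proof -
      have n': "n < length xs" using n lenc[of i] by simp
      have "Some (c i ! n) = xs ! n ! i"
        using at[OF n' \<open>i < k\<close>] n by (simp add: letter_at_def)
      moreover have "xs ! n ! i \<in> insert None (Some ` \<Sigma>)"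
        using assms(3) n' len[OF n'] \<open>i < k\<close> by (meson nth_mem subsetD)
      ultimately show ?thesis by (metis image_iff insert_iff option.distinct(1) option.inject)
    qed
    then show ?thesis by (auto simp: in_lists_conv_set in_set_conv_nth)
  qed
  ultimately show ?thesis
    using k(1) by (intro exI[of _ ws]) (auto simp: ws_def in_lists_conv_set)
qed

text \<open>A relation on \<open>k\<close>-tuples of words is recognizable if it is decided, on convolutions, by a
  right congruence of finite index; \<open>f\<close> maps a word to (the code of) its class.\<close>

definition right_congruence :: "('l list \<Rightarrow> nat) \<Rightarrow> bool" where
  "right_congruence f \<longleftrightarrow> finite (range f) \<and> (\<forall>x y l. f x = f y \<longrightarrow> f (x @ [l]) = f (y @ [l]))"

lemma right_congruenceD: "right_congruence f \<Longrightarrow> f x = f y \<Longrightarrow> f (x @ [l]) = f (y @ [l])"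
  unfolding right_congruence_def by blast

definition recognizable :: "nat \<Rightarrow> (nat list list \<Rightarrow> bool) \<Rightarrow> bool" where
  "recognizable k S \<longleftrightarrow> (\<exists>f F. right_congruence f \<and>
     (\<forall>ws. length ws = k \<longrightarrow> (S ws \<longleftrightarrow> f (convolution ws) \<in> F)))"

section \<open>Closure properties of recognizable relations\<close>

lemma recognizable_not: "recognizable k S \<Longrightarrow> recognizable k (\<lambda>ws. \<not> S ws)"
  unfolding recognizable_def
proof (elim exE conjE)
  fix f F assume "right_congruence f" "\<forall>ws. length ws = k \<longrightarrow> S ws = (f (convolution ws) \<in> F)"
  then show "\<exists>f F. right_congruence f \<and> (\<forall>ws. length ws = k \<longrightarrow> (\<not> S ws) = (f (convolution ws) \<in> F))"
    by (intro exI[of _ f] exI[of _ "- F"]) simp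
qed

lemma recognizable_conj:
  assumes "recognizable k S" "recognizable k T"
  shows "recognizable k (\<lambda>ws. S ws \<and> T ws)"
proof -
  obtain f F where f: "right_congruence f" "\<And>ws. length ws = k \<Longrightarrow> S ws \<longleftrightarrow> f (convolution ws) \<in> F"
    using assms(1) by (auto simp: recognizable_def)
  obtain g G where g: "right_congruence g" "\<And>ws. length ws = k \<Longrightarrow> T ws \<longleftrightarrow> g (convolution ws) \<in> G"
    using assms(2) by (auto simp: recognizable_def)
  define h where "h x = to_nat (f x, g x)" for x
  have "range h \<subseteq> to_nat ` (range f \<times> range g)" by (auto simp: h_def)
  then have "finite (range h)"
    by (rule finite_subset) (use f(1) g(1) in \<open>simp add: right_congruence_def\<close>)
  then have "right_congruence h"
    unfolding right_congruence_def
  proof (intro conjI allI impI)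
    fix x y l assume "h x = h y"
    then have "f x = f y" "g x = g y" by (simp_all add: h_def)
    then show "h (x @ [l]) = h (y @ [l])"
      unfolding h_def using right_congruenceD[OF f(1), of x y l] right_congruenceD[OF g(1), of x y l]
      by simp
  qed
  moreover have "S ws \<and> T ws \<longleftrightarrow> h (convolution ws) \<in> to_nat ` (F \<times> G)" if "length ws = k" for ws
    using f(2)[OF that] g(2)[OF that] by (auto simp: h_def)
  ultimately show ?thesis unfolding recognizable_def by blast
qed

lemma recognizable_disj:
  assumes "recognizable k S" "recognizable k T"
  shows "recognizable k (\<lambda>ws. S ws \<or> T ws)"
proof -
  have "recognizable k (\<lambda>ws. \<not> S ws \<and> \<not> T ws)"
    by (intro recognizable_conj recognizable_not assms)
  from recognizable_not[OF this] show ?thesis by simp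
qed

lemma recognizable_const: "recognizable k (\<lambda>ws. c)"
  unfolding recognizable_def right_congruence_def
  by (intro exI[of _ "\<lambda>_. 0"] exI[of _ "if c then {0} else {}"]) auto

lemma recognizable_all_less:
  fixes n :: nat
  assumes "\<And>i. i < n \<Longrightarrow> recognizable k (S i)"
  shows "recognizable k (\<lambda>ws. \<forall>i < n. S i ws)"
  using assms
proof (induction n)
  case (Suc n)
  then have "recognizable k (\<lambda>ws. (\<forall>i < n. S i ws) \<and> S n ws)"
    by (intro recognizable_conj) auto
  moreover have "(\<forall>i < Suc n. S i ws) \<longleftrightarrow> (\<forall>i < n. S i ws) \<and> S n ws" for ws
    by (auto simp: less_Suc_eq)
  ultimately show ?case by simp
qed (simp add: recognizable_const)

lemma recognizable_ex_less:
  fixes n :: nat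
  assumes "\<And>i. i < n \<Longrightarrow> recognizable k (S i)"
  shows "recognizable k (\<lambda>ws. \<exists>i < n. S i ws)"
proof -
  have "recognizable k (\<lambda>ws. \<forall>i < n. \<not> S i ws)"
    by (intro recognizable_all_less recognizable_not assms)
  from recognizable_not[OF this] show ?thesis by simp
qed

lemma recognizable_cong:
  assumes "recognizable k S" "\<And>ws. length ws = k \<Longrightarrow> T ws \<longleftrightarrow> S ws"
  shows "recognizable k T"
proof -
  from assms(1)[unfolded recognizable_def] obtain f F where f: "right_congruence f"
    and S: "\<forall>ws. length ws = k \<longrightarrow> (S ws \<longleftrightarrow> f (convolution ws) \<in> F)"
    by (elim exE conjE)
  have "\<forall>ws. length ws = k \<longrightarrow> (T ws \<longleftrightarrow> f (convolution ws) \<in> F)"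
    using S assms(2) by blast
  with f show ?thesis unfolding recognizable_def by (intro exI conjI)
qed

lemma recognizable_imp:
  assumes "b \<Longrightarrow> recognizable k S"
  shows "recognizable k (\<lambda>ws. b \<longrightarrow> S ws)"
  using assms by (cases b) (auto simp: recognizable_const)

text \<open>Synchronous reading of two words with padding, as a recursion on the words, so that the
  behaviour of a concrete automaton can be proved by induction.\<close>

fun fold2 :: "('q \<Rightarrow> 's option \<Rightarrow> 's option \<Rightarrow> 'q) \<Rightarrow> 'q \<Rightarrow> 's list \<Rightarrow> 's list \<Rightarrow> 'q" where
  "fold2 \<delta> q [] [] = q"
| "fold2 \<delta> q (a # u) [] = fold2 \<delta> (\<delta> q (Some a) None) u []"
| "fold2 \<delta> q [] (b # v) = fold2 \<delta> (\<delta> q None (Some b)) [] v"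
| "fold2 \<delta> q (a # u) (b # v) = fold2 \<delta> (\<delta> q (Some a) (Some b)) u v"

text \<open>The convolution of many words may be longer than the two words that are read; the
  surplus columns show padding twice and leave the state unchanged.\<close>

lemma foldl_fold2:
  assumes "\<And>q. \<delta> q None None = q"
  shows "length u \<le> n \<Longrightarrow> length v \<le> n \<Longrightarrow>
    foldl (\<lambda>q m. \<delta> q (letter_at u m) (letter_at v m)) q [0..<n] = fold2 \<delta> q u v"
proof (induction n arbitrary: q u v)
  case (Suc n)
  have *: "[0..<Suc n] = 0 # map Suc [0..<n]"
    by (subst upt_conv_Cons) (simp_all only: map_Suc_upt zero_less_Suc)
  have none: "foldl (\<lambda>q m. \<delta> q (letter_at [] m) (letter_at [] m)) q [0..<n] = q" for q
    using Suc.IH[of "[]" "[]" q] by simp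
  show ?case
    unfolding * using Suc.prems Suc.IH[of "tl u" "tl v"] none
    by (cases u; cases v) (simp_all add: foldl_map assms)
qed simp

lemma recognizable_fold2:
  fixes \<delta> :: "nat \<Rightarrow> nat option \<Rightarrow> nat option \<Rightarrow> nat"
  assumes "i < k" "j < k" "\<And>q. \<delta> q None None = q"
    and bnd: "\<And>q a b. q \<le> N \<Longrightarrow> \<delta> q a b \<le> N" "q0 \<le> N"
  shows "recognizable k (\<lambda>ws. fold2 \<delta> q0 (ws ! i) (ws ! j) \<in> F)"
proof -
  define f where "f = foldl (\<lambda>q l. \<delta> q (l ! i) (l ! j)) q0"
  have "f x \<le> N" for x
    by (induction x rule: rev_induct) (auto simp: f_def bnd)
  then have "finite (range f)"
    by (intro finite_subset[of "range f" "{..N}"]) auto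
  then have "right_congruence f" by (simp add: right_congruence_def f_def)
  moreover have "f (convolution ws) = fold2 \<delta> q0 (ws ! i) (ws ! j)" if "length ws = k" for ws
  proof -
    have "f (convolution ws) =
        foldl (\<lambda>q m. \<delta> q (letter_at (ws ! i) m) (letter_at (ws ! j) m)) q0 [0..<length (convolution ws)]"
      using that assms(1,2) by (simp add: f_def convolution_altdef foldl_map)
    also have "\<dots> = fold2 \<delta> q0 (ws ! i) (ws ! j)"
      by (rule foldl_fold2) (use that assms in \<open>auto intro: length_le_convolution\<close>)
    finally show ?thesis .
  qed
  ultimately show ?thesis
    unfolding recognizable_def by (intro exI[of _ f] exI[of _ F]) simp
qed

text \<open>Letter \<open>0\<close> separates numbers that are written in unary with the letter \<open>1\<close>.\<close>

definition unary_blocks :: "nat list \<Rightarrow> nat list" where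
  "unary_blocks ns = concat (map (\<lambda>n. 0 # replicate n 1) ns)"

text \<open>One relation for three purposes: \<open>d = 0\<close> is equality of words,
  \<open>d = 4\<close> appends a level of the tree, and further values of \<open>d\<close> locate a
  block counted from the end.\<close>

definition blocks_prefix :: "nat \<Rightarrow> nat list \<Rightarrow> nat list \<Rightarrow> bool" where
  "blocks_prefix d u v \<longleftrightarrow> (\<exists>ns. length ns = d \<and> v = u @ unary_blocks ns)"

lemma unary_blocks_simps [simp]:
  "unary_blocks [] = []"
  "unary_blocks (n # ns) = 0 # replicate n 1 @ unary_blocks ns"
  "unary_blocks (ms @ ns) = unary_blocks ms @ unary_blocks ns"
  by (simp_all add: unary_blocks_def)

text \<open>State \<open>0\<close> rejects, state \<open>1\<close> compares the two words, and state \<open>c + 2\<close> has seen \<open>c\<close> further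
  separators.\<close>

definition blocks_delta :: "nat \<Rightarrow> nat \<Rightarrow> nat option \<Rightarrow> nat option \<Rightarrow> nat" where
  "blocks_delta d q a b =
     (if a = None \<and> b = None then q
      else if q = 0 then 0
      else if a \<noteq> None then (if q = 1 \<and> a = b then 1 else 0)
      else if b = Some 0 then (if q = 1 then (if d = 0 then 0 else 3) else if q < d + 2 then Suc q else 0)
      else if b = Some 1 \<and> q \<noteq> 1 then q else 0)"

lemma blocks_delta_simps [simp]:
  "blocks_delta d 0 a b = 0"
  "blocks_delta d (Suc 0) (Some x) b = (if b = Some x then 1 else 0)"
  "blocks_delta d (Suc 0) None (Some y) = (if y = 0 \<and> d \<noteq> 0 then 3 else 0)"
  "blocks_delta d (Suc (Suc c)) (Some x) b = 0"
  "blocks_delta d (Suc (Suc c)) None (Some y) =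
    (if y = 0 then if c < d then Suc (Suc (Suc c)) else 0 else if y = 1 then Suc (Suc c) else 0)"
  by (simp_all add: blocks_delta_def)

lemma fold2_blocks_0 [simp]: "fold2 (blocks_delta d) 0 u v = 0"
  by (induction "blocks_delta d" "0 :: nat" u v rule: fold2.induct) simp_all

text \<open>Invariant of the second phase: after \<open>c\<close> separators the block begun last is
  still open, so the rest of the word first completes it with letters 1 and then supplies the
  missing blocks.\<close>

lemma fold2_blocks_tail:
  assumes "c \<le> d"
  shows "fold2 (blocks_delta d) (c + 2) [] v = d + 2 \<longleftrightarrow>
    (\<exists>n ns. c + length ns = d \<and> v = replicate n 1 @ unary_blocks ns)"
  using assms
proof (induction v arbitrary: c)
  case Nil
  have "c = d \<longleftrightarrow> (\<exists>n ns. c + length ns = d \<and> [] = replicate n (1::nat) @ unary_blocks ns)"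
    using Nil by (auto simp: unary_blocks_def)
  then show ?case by simp
next
  case (Cons b v)
  consider "b = 1" | "b = 0" | "b \<noteq> 0" "b \<noteq> 1" by blast
  then show ?case
  proof cases
    case 1
    have "(\<exists>n ns. c + length ns = d \<and> v = replicate n 1 @ unary_blocks ns) \<longleftrightarrow>
        (\<exists>n ns. c + length ns = d \<and> 1 # v = replicate n 1 @ unary_blocks ns)"
    proof
      assume "\<exists>n ns. c + length ns = d \<and> v = replicate n 1 @ unary_blocks ns"
      then obtain n ns where "c + length ns = d" "v = replicate n 1 @ unary_blocks ns" by blast
      then show "\<exists>n ns. c + length ns = d \<and> 1 # v = replicate n 1 @ unary_blocks ns"
        by (intro exI[of _ "Suc n"] exI[of _ ns]) simp
    next
      assume "\<exists>n ns. c + length ns = d \<and> 1 # v = replicate n 1 @ unary_blocks ns"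
      then obtain n ns where *: "c + length ns = d" "1 # v = replicate n 1 @ unary_blocks ns" by blast
      then obtain n' where "n = Suc n'" by (cases n; cases ns) auto
      with * show "\<exists>n ns. c + length ns = d \<and> v = replicate n 1 @ unary_blocks ns"
        by (intro exI[of _ n'] exI[of _ ns]) simp
    qed
    then show ?thesis using 1 Cons.IH[OF Cons.prems] by simp
  next
    case 2
    have eq: "(\<exists>n ns. c + length ns = d \<and> 0 # v = replicate n 1 @ unary_blocks ns) \<longleftrightarrow>
        (\<exists>n ns. Suc c + length ns = d \<and> v = replicate n 1 @ unary_blocks ns)"
    proof
      assume "\<exists>n ns. c + length ns = d \<and> 0 # v = replicate n 1 @ unary_blocks ns"
      then obtain n ns where *: "c + length ns = d" "0 # v = replicate n 1 @ unary_blocks ns" by blast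
      then have "n = 0" by (cases n) auto
      with * obtain m ms where "ns = m # ms" by (cases ns) auto
      with * \<open>n = 0\<close> show "\<exists>n ns. Suc c + length ns = d \<and> v = replicate n 1 @ unary_blocks ns"
        by (intro exI[of _ m] exI[of _ ms]) simp
    next
      assume "\<exists>n ns. Suc c + length ns = d \<and> v = replicate n 1 @ unary_blocks ns"
      then obtain n ns where "Suc c + length ns = d" "v = replicate n 1 @ unary_blocks ns" by blast
      then show "\<exists>n ns. c + length ns = d \<and> 0 # v = replicate n 1 @ unary_blocks ns"
        by (intro exI[of _ 0] exI[of _ "n # ns"]) simp
    qed
    show ?thesis
    proof (cases "c < d")
      case True
      then show ?thesis
        using 2 eq Cons.IH[of "Suc c"] by simp
    next
      case False
      then show ?thesis
        using 2 eq by simp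
    qed
  next
    case 3
    have "\<not> (\<exists>n ns. c + length ns = d \<and> b # v = replicate n 1 @ unary_blocks ns)"
    proof
      assume "\<exists>n ns. c + length ns = d \<and> b # v = replicate n 1 @ unary_blocks ns"
      then obtain n ns where "b # v = replicate n 1 @ unary_blocks ns" by blast
      then show False using 3 by (cases n; cases ns) auto
    qed
    then show ?thesis using 3 by simp
  qed
qed

text \<open>For \<open>d = 0\<close> the automaton must never leave the comparing state 1; otherwise
  the last of the \<open>d\<close> separators leads to state \<open>d + 2\<close>.\<close>

lemma fold2_blocks_prefix:
  "fold2 (blocks_delta d) 1 u v = (if d = 0 then 1 else d + 2) \<longleftrightarrow> blocks_prefix d u v"
proof (induction u arbitrary: v)
  case Nil
  show ?case
  proof (cases v)
    case Nil
    then show ?thesis by (auto simp: blocks_prefix_def unary_blocks_def)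
  next
    case (Cons b v')
    show ?thesis
    proof (cases "b = 0 \<and> d \<noteq> 0")
      case True
      have "fold2 (blocks_delta d) 1 [] v = fold2 (blocks_delta d) (1 + 2) [] v'"
        using True Cons by (simp add: numeral_eq_Suc)
      then have "fold2 (blocks_delta d) 1 [] v = d + 2 \<longleftrightarrow>
          (\<exists>n ns. 1 + length ns = d \<and> v' = replicate n 1 @ unary_blocks ns)"
        using fold2_blocks_tail[of 1 d v'] True by simp
      also have "\<dots> \<longleftrightarrow> blocks_prefix d [] v"
      proof
        assume "\<exists>n ns. 1 + length ns = d \<and> v' = replicate n 1 @ unary_blocks ns"
        then obtain n ns where "1 + length ns = d" "v' = replicate n 1 @ unary_blocks ns" by blast
        then show "blocks_prefix d [] v"
          unfolding blocks_prefix_def using Cons True by (intro exI[of _ "n # ns"]) simp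
      next
        assume "blocks_prefix d [] v"
        then obtain ns where ns: "length ns = d" "v = unary_blocks ns" by (auto simp: blocks_prefix_def)
        then obtain m ms where "ns = m # ms" using True by (cases ns) auto
        then show "\<exists>n ns. 1 + length ns = d \<and> v' = replicate n 1 @ unary_blocks ns"
          using ns Cons by (intro exI[of _ m] exI[of _ ms]) simp
      qed
      finally show ?thesis using True by simp
    next
      case False
      have "\<not> blocks_prefix d [] v"
      proof
        assume "blocks_prefix d [] v"
        then obtain ns where ns: "length ns = d" "v = unary_blocks ns" by (auto simp: blocks_prefix_def)
        then show False using False Cons by (cases ns) auto
      qed
      moreover have "fold2 (blocks_delta d) 1 [] v = 0"
        using False Cons by auto
      ultimately show ?thesis by simp
    qed
  qed
next
  case (Cons a u)
  show ?case
  proof (cases v)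
    case Nil
    then show ?thesis
      by (auto simp: blocks_prefix_def)
  next
    case (Cons b v')
    then show ?thesis
      using Cons.IH[of v'] by (auto simp: blocks_prefix_def)
  qed
qed

lemma recognizable_blocks_prefix:
  assumes "i < k" "j < k"
  shows "recognizable k (\<lambda>ws. blocks_prefix d (ws ! i) (ws ! j))"
proof -
  have "recognizable k (\<lambda>ws. fold2 (blocks_delta d) 1 (ws ! i) (ws ! j) \<in> {if d = 0 then 1 else d + 2})"
    by (rule recognizable_fold2[where N = "d + 3"]) (use assms in \<open>auto simp: blocks_delta_def\<close>)
  then show ?thesis by (simp only: singleton_iff fold2_blocks_prefix)
qed

lemma recognizable_eq:
  assumes "i < k" "j < k"
  shows "recognizable k (\<lambda>ws. ws ! i = ws ! j)"
proof -
  have "blocks_prefix 0 u v \<longleftrightarrow> u = v" for u v by (auto simp: blocks_prefix_def)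
  then show ?thesis using recognizable_blocks_prefix[OF assms, of 0] by simp
qed

text \<open>State 0 compares the words, state 1 has just read the additional letter
  \<open>x\<close>, state 2 rejects.\<close>

definition snoc_delta :: "nat \<Rightarrow> nat \<Rightarrow> nat option \<Rightarrow> nat option \<Rightarrow> nat" where
  "snoc_delta x q a b =
     (if a = None \<and> b = None then q
      else if q = 0 \<and> a = b then 0
      else if q = 0 \<and> a = None \<and> b = Some x then 1 else 2)"

lemma snoc_delta_simps [simp]:
  "snoc_delta x 0 (Some a) b = (if b = Some a then 0 else 2)"
  "snoc_delta x 0 None (Some y) = (if y = x then 1 else 2)"
  "snoc_delta x (Suc c) None (Some y) = 2"
  "snoc_delta x (Suc c) (Some a) b = 2"
  "snoc_delta x 2 None (Some y) = 2"
  "snoc_delta x 2 (Some a) b = 2"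
  by (auto simp: snoc_delta_def)

lemma fold2_snoc_2 [simp]: "fold2 (snoc_delta x) 2 u v = 2"
  by (induction "snoc_delta x" "2 :: nat" u v rule: fold2.induct) simp_all

lemma fold2_snoc: "fold2 (snoc_delta x) 0 u v = 1 \<longleftrightarrow> v = u @ [x]"
proof (induction u arbitrary: v)
  case Nil
  show ?case
    by (cases v; cases "tl v") auto
next
  case (Cons a u)
  then show ?case
    by (cases v) auto
qed

lemma recognizable_snoc:
  assumes "i < k" "j < k"
  shows "recognizable k (\<lambda>ws. ws ! j = ws ! i @ [x])"
proof -
  have "recognizable k (\<lambda>ws. fold2 (snoc_delta x) 0 (ws ! i) (ws ! j) \<in> {1})"
    by (rule recognizable_fold2[where N = 2]) (use assms in \<open>auto simp: snoc_delta_def\<close>)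
  then show ?thesis by (simp only: singleton_iff fold2_snoc)
qed

text \<open>Properties of one word are treated as relations of the word with itself. State 1 means
  that the letter read last is \<open>x\<close>.\<close>

definition last_delta :: "nat \<Rightarrow> nat \<Rightarrow> nat option \<Rightarrow> nat option \<Rightarrow> nat" where
  "last_delta x q a b = (if a = None then q else if a = Some x then 1 else 0)"

lemma last_delta_Some [simp]: "last_delta x q (Some a) b = (if a = x then 1 else 0)"
  by (simp add: last_delta_def)

lemma fold2_last: "fold2 (last_delta x) q u u = 1 \<longleftrightarrow> (if u = [] then q = 1 else last u = x)"
  by (induction u arbitrary: q) simp_all

lemma recognizable_last:
  assumes "i < k"
  shows "recognizable k (\<lambda>ws. ws ! i \<noteq> [] \<and> last (ws ! i) = x)"
proof -
  have "recognizable k (\<lambda>ws. fold2 (last_delta x) 0 (ws ! i) (ws ! i) \<in> {1})"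
    by (rule recognizable_fold2[where N = 1]) (use assms in \<open>auto simp: last_delta_def\<close>)
  moreover have "fold2 (last_delta x) 0 u u \<in> {1} \<longleftrightarrow> u \<noteq> [] \<and> last u = x" for u
    using fold2_last[of x 0 u] by auto
  ultimately show ?thesis by simp
qed

definition empty_delta :: "nat \<Rightarrow> nat option \<Rightarrow> nat option \<Rightarrow> nat" where
  "empty_delta q a b = (if a = None then q else 1)"

lemma empty_delta_Some [simp]: "empty_delta q (Some a) b = Suc 0"
  by (simp add: empty_delta_def)

lemma fold2_empty_1: "fold2 empty_delta (Suc 0) u u = Suc 0"
  by (induction u) simp_all

lemma recognizable_Nil:
  assumes "i < k"
  shows "recognizable k (\<lambda>ws. ws ! i = [])"
proof -
  have "recognizable k (\<lambda>ws. fold2 empty_delta 0 (ws ! i) (ws ! i) \<in> {0})"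
    by (rule recognizable_fold2[where N = 1]) (use assms in \<open>auto simp: empty_delta_def\<close>)
  moreover have "fold2 empty_delta 0 u u \<in> {0} \<longleftrightarrow> u = []" for u
    by (cases u) (simp_all add: fold2_empty_1)
  ultimately show ?thesis by simp
qed

section \<open>Automatic presentations by tuples of words\<close>

lemma padded_snoc:
  "padded k (xs @ [l]) \<longleftrightarrow>
    padded k xs \<and> length l = k \<and> l \<noteq> replicate k None \<and> (xs \<noteq> [] \<longrightarrow> padded_step (last xs) l)"
proof -
  have "(\<forall>n. Suc n < length (xs @ [l]) \<longrightarrow> padded_step ((xs @ [l]) ! n) ((xs @ [l]) ! Suc n)) \<longleftrightarrow>
      (\<forall>n. Suc n < length xs \<longrightarrow> padded_step (xs ! n) (xs ! Suc n)) \<and>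
      (xs \<noteq> [] \<longrightarrow> padded_step (last xs) l)" (is "?L \<longleftrightarrow> ?R")
  proof
    assume L: ?L
    have "padded_step (last xs) l" if "xs \<noteq> []"
      using L[rule_format, of "length xs - 1"] that by (simp add: nth_append last_conv_nth)
    moreover have "padded_step (xs ! n) (xs ! Suc n)" if "Suc n < length xs" for n
      using L[rule_format, of n] that by (simp add: nth_append)
    ultimately show ?R by blast
  next
    assume R: ?R
    show ?L
    proof (intro allI impI)
      fix n assume n: "Suc n < length (xs @ [l])"
      show "padded_step ((xs @ [l]) ! n) ((xs @ [l]) ! Suc n)"
      proof (cases "Suc n < length xs")
        case False
        then have "Suc n = length xs" using n by simp
        then have n': "n = length xs - 1" "xs \<noteq> []" by auto
        then have "last xs = xs ! n" by (simp add: last_conv_nth)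
        then show ?thesis using R n' \<open>Suc n = length xs\<close> by (simp add: nth_append)
      qed (use R in \<open>simp add: nth_append\<close>)
    qed
  qed
  then show ?thesis unfolding padded_def by auto
qed

text \<open>Being padded is a condition on neighbouring columns, so besides the class under
  \<open>f\<close> only the last column has to be remembered. The map \<phi> translates letters,
  which may be codes, into columns.\<close>

lemma regular_padded:
  fixes \<phi> :: "'l \<Rightarrow> nat option list"
  assumes fin: "finite \<Gamma>" and f: "right_congruence f"
  shows "regular \<Gamma> {w \<in> lists \<Gamma>. padded k (map \<phi> w) \<and> f (map \<phi> w) \<in> F}"
proof -
  \<comment> \<open>\<open>None\<close> records a violation, \<open>Some None\<close> the empty
    word, and \<open>Some (Some l)\<close> a correct nonempty word with last column
    \<open>l\<close>.\<close>
  define s where "s w = (if padded k (map \<phi> w) then Some (if w = [] then None else Some (\<phi> (last w))) else None)"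
    for w
  define g where "g w = to_nat (s w, f (map \<phi> w))" for w
  define F' where "F' = {to_nat (Some o', q) | (o' :: nat option list option) q. q \<in> F}"
  have s: "s w \<in> insert None (Some ` insert None (Some ` \<phi> ` \<Gamma>))" if "w \<in> lists \<Gamma>" for w
    using that by (cases w rule: rev_cases) (auto simp: s_def)
  have "g ` lists \<Gamma> \<subseteq> to_nat ` (insert None (Some ` insert None (Some ` \<phi> ` \<Gamma>)) \<times> range f)"
    using s unfolding g_def by blast
  then have 1: "finite (g ` lists \<Gamma>)"
    using fin f by (elim finite_subset) (auto simp: right_congruence_def)
  have sapp: "s (w @ [a]) = (case s w of None \<Rightarrow> None | Some o' \<Rightarrow>
      if length (\<phi> a) = k \<and> \<phi> a \<noteq> replicate k None \<and> (case o' of None \<Rightarrow> True | Some l \<Rightarrow> padded_step l (\<phi> a))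
      then Some (Some (\<phi> a)) else None)" for w a
    by (auto simp: s_def padded_snoc last_map)
  have 2: "g (x @ [a]) = g (y @ [a])" if "g x = g y" for x y a
    using that right_congruenceD[OF f, of "map \<phi> x" "map \<phi> y" "\<phi> a"] by (simp add: g_def sapp)
  have "regular \<Gamma> {w \<in> lists \<Gamma>. g w \<in> F'}"
    by (rule regular_congruence[OF 1 2])
  moreover have "g w \<in> F' \<longleftrightarrow> padded k (map \<phi> w) \<and> f (map \<phi> w) \<in> F" for w
    by (auto simp: g_def F'_def s_def)
  ultimately show ?thesis by simp
qed

section \<open>Tuples of words coded as single words\<close>

definition word_tuples :: "nat \<Rightarrow> nat \<Rightarrow> nat list list set" where
  "word_tuples k B = {ws. length ws = k \<and> set ws \<subseteq> lists {..<B}}"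

definition encode_tuple :: "nat list list \<Rightarrow> nat list" where
  "encode_tuple ws = map to_nat (convolution ws)"

definition tuple_columns :: "nat \<Rightarrow> nat \<Rightarrow> nat option list set" where
  "tuple_columns k B = {l. length l = k \<and> set l \<subseteq> insert None (Some ` {..<B}) \<and> l \<noteq> replicate k None}"

definition tuple_alphabet :: "nat \<Rightarrow> nat \<Rightarrow> nat set" where
  "tuple_alphabet k B = to_nat ` tuple_columns k B"

lemma finite_tuple_alphabet: "finite (tuple_alphabet k B)"
proof -
  have "tuple_columns k B \<subseteq> {l. set l \<subseteq> insert None (Some ` {..<B}) \<and> length l = k}"
    by (auto simp: tuple_columns_def)
  then have "finite (tuple_columns k B)"
    by (rule finite_subset) (rule finite_lists_length_eq, simp)
  then show ?thesis by (simp add: tuple_alphabet_def)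
qed

lemma convolution_in_lists:
  assumes "ws \<in> word_tuples k B" "0 < k"
  shows "convolution ws \<in> lists (tuple_columns k B)"
proof -
  have "l \<in> tuple_columns k B" if l: "l \<in> set (convolution ws)" for l
  proof -
    have *: "length l = k \<and> l \<noteq> replicate k None"
      using padded_convolution[of ws] assms l by (auto simp: padded_def word_tuples_def)
    obtain n where "l = column ws n" using l by (auto simp: convolution_altdef)
    then have "set l \<subseteq> insert None (Some ` {..<B})"
      using assms by (fastforce simp: word_tuples_def letter_at_def in_lists_conv_set)
    with * show ?thesis by (simp add: tuple_columns_def)
  qed
  then show ?thesis by blast
qed

lemma encode_tuple_in_lists:
  assumes "ws \<in> word_tuples k B" "0 < k"
  shows "encode_tuple ws \<in> lists (tuple_alphabet k B)"
  using convolution_in_lists[OF assms] by (auto simp: encode_tuple_def tuple_alphabet_def)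

lemma encode_tuple_inject:
  assumes "us \<in> word_tuples k B" "ws \<in> word_tuples k B" "encode_tuple us = encode_tuple ws"
  shows "us = ws"
proof (rule convolution_inject)
  show "convolution us = convolution ws"
    using assms(3) by (simp add: encode_tuple_def inj_map_eq_map)
qed (use assms in \<open>simp add: word_tuples_def\<close>)

lemma regular_encode_tuples:
  assumes "0 < k"
  shows "regular (tuple_alphabet k B) (encode_tuple ` word_tuples k B)"
proof -
  let ?\<Gamma> = "tuple_alphabet k B"
  have "right_congruence (\<lambda>x :: nat option list list. 0)" by (simp add: right_congruence_def)
  from regular_padded[OF finite_tuple_alphabet this, of k B k from_nat "{0}"]
  have "regular ?\<Gamma> {w \<in> lists ?\<Gamma>. padded k (map from_nat w :: nat option list list)}" by simp
  moreover have "{w \<in> lists ?\<Gamma>. padded k (map from_nat w :: nat option list list)} = encode_tuple ` word_tuples k B"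
  proof (intro equalityI subsetI)
    fix w assume w: "w \<in> {w \<in> lists ?\<Gamma>. padded k (map from_nat w :: nat option list list)}"
    have "from_nat a \<in> tuple_columns k B \<and> to_nat (from_nat a :: nat option list) = a" if "a \<in> set w" for a
      using w that by (auto simp: tuple_alphabet_def)
    then have *: "\<forall>l \<in> set (map from_nat w). set l \<subseteq> insert None (Some ` {..<B})"
      and to: "map to_nat (map from_nat w :: nat option list list) = w"
      by (fastforce simp: tuple_columns_def, auto intro: map_idI)
    obtain ws where ws: "length ws = k" "convolution ws = map from_nat w" "set ws \<subseteq> lists {..<B}"
      using padded_imp_convolution[OF _ assms *] w by auto
    then show "w \<in> encode_tuple ` word_tuples k B"
      using to by (auto simp: encode_tuple_def word_tuples_def intro!: image_eqI[of _ _ ws])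
  next
    fix w assume "w \<in> encode_tuple ` word_tuples k B"
    then obtain ws where ws: "ws \<in> word_tuples k B" "w = encode_tuple ws" by blast
    have "map from_nat w = convolution ws" by (simp add: ws(2) encode_tuple_def map_idI)
    moreover have "padded k (convolution ws)"
      using padded_convolution[of ws] ws(1) assms by (auto simp: word_tuples_def)
    ultimately show "w \<in> {w \<in> lists ?\<Gamma>. padded k (map from_nat w :: nat option list list)}"
      using encode_tuple_in_lists[OF ws(1) assms] ws(2) by simp
  qed
  ultimately show ?thesis by simp
qed

text \<open>A padding symbol next to a code stands for a whole column of padding. With this
  convention the convolution of two codes unfolds to the convolution of all the underlying
  words.\<close>

definition decode_letter :: "nat \<Rightarrow> nat option \<Rightarrow> nat option list" where
  "decode_letter k a = (case a of None \<Rightarrow> replicate k None | Some c \<Rightarrow> from_nat c)"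

lemma decode_letter_Some:
  assumes "c \<in> tuple_alphabet k B"
  shows "decode_letter k (Some c) \<in> tuple_columns k B" "to_nat (decode_letter k (Some c)) = c"
proof -
  obtain l where "l \<in> tuple_columns k B" "c = to_nat l"
    using assms unfolding tuple_alphabet_def by blast
  then show "decode_letter k (Some c) \<in> tuple_columns k B" "to_nat (decode_letter k (Some c)) = c"
    by (simp_all add: decode_letter_def)
qed

lemma decode_letter_None: "decode_letter k None = replicate k None"
  by (simp add: decode_letter_def)

text \<open>The alphabet has no code for the column of padding symbols only, so this column is left
  as the decoding of the padding symbol alone.\<close>

lemma decode_letter_inj:
  "inj_on (decode_letter k) (insert None (Some ` tuple_alphabet k B))"
proof (rule inj_onI)
  have *: "decode_letter k (Some c) \<noteq> decode_letter k None \<and>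
      to_nat (decode_letter k (Some c)) = c" if "c \<in> tuple_alphabet k B" for c
    using decode_letter_Some[OF that] by (auto simp: decode_letter_None tuple_columns_def)
  fix a b assume ab: "a \<in> insert None (Some ` tuple_alphabet k B)" "b \<in> insert None (Some ` tuple_alphabet k B)"
    and eq: "decode_letter k a = decode_letter k b"
  show "a = b"
  proof (cases a)
    case None
    then show ?thesis using * ab(2) eq by force
  next
    case (Some c)
    then have c: "c \<in> tuple_alphabet k B" using ab(1) by auto
    show ?thesis
    proof (cases b)
      case None
      then show ?thesis using *[OF c] Some eq by simp
    next
      case (Some d)
      then have "d \<in> tuple_alphabet k B" using ab(2) by auto
      then have "c = d"
        using decode_letter_Some(2)[OF c] decode_letter_Some(2)[of d k B] Some \<open>a = Some c\<close> eq by metis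
      then show ?thesis using Some \<open>a = Some c\<close> by simp
    qed
  qed
qed

lemma decode_letter_column:
  assumes "ws \<in> word_tuples k B" "0 < k"
  shows "decode_letter k (letter_at (encode_tuple ws) n) = column ws n"
proof (cases "n < length (convolution ws)")
  case True
  then show ?thesis
    by (simp add: letter_at_def encode_tuple_def decode_letter_def nth_convolution)
next
  case False
  then have "column ws n = replicate k None"
    using assms length_convolution_le_iff[of ws n] by (auto simp: word_tuples_def)
  then show ?thesis using False by (simp add: letter_at_def encode_tuple_def decode_letter_def)
qed

definition decode_pair :: "nat \<Rightarrow> nat option list \<Rightarrow> nat option list" where
  "decode_pair k l = decode_letter k (l ! 0) @ decode_letter k (l ! 1)"

lemma decode_letter_length:
  "a \<in> insert None (Some ` tuple_alphabet k B) \<Longrightarrow> length (decode_letter k a) = k"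
proof (cases a)
  case None
  then show ?thesis by (simp add: decode_letter_None)
next
  case (Some c)
  moreover assume "a \<in> insert None (Some ` tuple_alphabet k B)"
  ultimately have "decode_letter k a \<in> tuple_columns k B"
    using decode_letter_Some(1) by blast
  then show ?thesis by (simp add: tuple_columns_def)
qed

lemma decode_pair_inj: "inj_on (decode_pair k) (conv_alphabet (tuple_alphabet k B) 2)"
proof (rule inj_onI)
  fix l l' assume l: "l \<in> conv_alphabet (tuple_alphabet k B) 2" "l' \<in> conv_alphabet (tuple_alphabet k B) 2"
    and eq: "decode_pair k l = decode_pair k l'"
  obtain a b where ab: "l = [a, b]" using l(1) by (auto simp: conv_alphabet_def length_Suc_conv numeral_2_eq_2)
  obtain a' b' where ab': "l' = [a', b']"
    using l(2) by (auto simp: conv_alphabet_def length_Suc_conv numeral_2_eq_2)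
  have mem: "a \<in> insert None (Some ` tuple_alphabet k B)" "b \<in> insert None (Some ` tuple_alphabet k B)"
      "a' \<in> insert None (Some ` tuple_alphabet k B)" "b' \<in> insert None (Some ` tuple_alphabet k B)"
    using l ab ab' by (auto simp: conv_alphabet_def)
  have "decode_letter k a = decode_letter k a'" "decode_letter k b = decode_letter k b'"
    using eq decode_letter_length[OF mem(1)] decode_letter_length[OF mem(3)]
    by (auto simp: decode_pair_def ab ab')
  then show "l = l'"
    using inj_onD[OF decode_letter_inj[of k B]] mem ab ab' by blast
qed

lemma map_decode_convolution:
  assumes "us \<in> word_tuples k B" "ws \<in> word_tuples k B" "0 < k"
  shows "map (decode_pair k) (convolution [encode_tuple us, encode_tuple ws]) = convolution (us @ ws)"
proof (rule nth_equalityI)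
  have ne: "us \<noteq> []" "ws \<noteq> []" using assms by (auto simp: word_tuples_def)
  have "Max (length ` set (us @ ws)) = max (Max (length ` set us)) (Max (length ` set ws))"
    using ne by (simp add: image_Un Max_Un)
  then show len: "length (map (decode_pair k) (convolution [encode_tuple us, encode_tuple ws])) =
      length (convolution (us @ ws))"
    by (simp add: length_convolution encode_tuple_def)
  fix n assume "n < length (map (decode_pair k) (convolution [encode_tuple us, encode_tuple ws]))"
  then show "map (decode_pair k) (convolution [encode_tuple us, encode_tuple ws]) ! n = convolution (us @ ws) ! n"
    using len decode_letter_column[OF assms(1,3)] decode_letter_column[OF assms(2,3)]
    by (simp add: nth_convolution decode_pair_def)
qed

lemma convolution_pair_in_lists:
  assumes "us \<in> word_tuples k B" "ws \<in> word_tuples k B" "0 < k"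
  shows "convolution [encode_tuple us, encode_tuple ws] \<in> lists (conv_alphabet (tuple_alphabet k B) 2)"
proof -
  have "letter_at (encode_tuple vs) n \<in> insert None (Some ` tuple_alphabet k B)" if "vs \<in> word_tuples k B" for vs n
    using encode_tuple_in_lists[OF that assms(3)] by (auto simp: letter_at_def in_lists_conv_set)
  then have "column [encode_tuple us, encode_tuple ws] n \<in> conv_alphabet (tuple_alphabet k B) 2" for n
    using assms(1,2) by (simp add: conv_alphabet_def)
  then show ?thesis
    unfolding convolution_altdef in_lists_conv_set set_map by blast
qed

text \<open>A word over pairs of codes is the convolution of two codes exactly if its decoding, with
  columns of height \<open>k + k\<close>, is padded. So the automaton for pairs can work on the
  decoded columns.\<close>

lemma regular_rel_recognizable:
  assumes S: "recognizable (k + k) (\<lambda>ws. R (take k ws) (drop k ws))" and k: "0 < k"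
  shows "regular_rel (tuple_alphabet k B) 2
    {[encode_tuple us, encode_tuple ws] | us ws. us \<in> word_tuples k B \<and> ws \<in> word_tuples k B \<and> R us ws}"
    (is "regular_rel _ _ ?R")
proof -
  let ?\<Gamma> = "conv_alphabet (tuple_alphabet k B) 2"
  from S[unfolded recognizable_def] obtain f F where f: "right_congruence f"
    and *: "\<forall>ws. length ws = k + k \<longrightarrow> (R (take k ws) (drop k ws) \<longleftrightarrow> f (convolution ws) \<in> F)"
    by (elim exE conjE)
  have F: "R (take k ws) (drop k ws) \<longleftrightarrow> f (convolution ws) \<in> F" if "length ws = k + k" for ws
    using *[rule_format, OF that] .
  have "finite (insert None (Some ` tuple_alphabet k B))"
    by (simp add: finite_tuple_alphabet)
  then have fin: "finite ?\<Gamma>"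
    using finite_lists_length_eq[of _ 2] unfolding conv_alphabet_def by (subst conj_commute) blast
  have "convolution ` ?R = {w \<in> lists ?\<Gamma>. padded (k + k) (map (decode_pair k) w) \<and>
      f (map (decode_pair k) w) \<in> F}" (is "_ = ?L")
  proof (intro equalityI subsetI)
    fix w assume "w \<in> convolution ` ?R"
    then obtain us ws where uw: "us \<in> word_tuples k B" "ws \<in> word_tuples k B" "R us ws"
      and w: "w = convolution [encode_tuple us, encode_tuple ws]" by blast
    have len: "length us = k" "length ws = k" using uw by (auto simp: word_tuples_def)
    have "f (convolution (us @ ws)) \<in> F" using F[of "us @ ws"] uw(3) len by simp
    moreover have "padded (k + k) (convolution (us @ ws))"
      using padded_convolution[of "us @ ws"] len k by auto
    ultimately show "w \<in> ?L"
      using map_decode_convolution[OF uw(1,2) k] convolution_pair_in_lists[OF uw(1,2) k] w by simp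
  next
    fix w assume w: "w \<in> ?L"
    have "set l \<subseteq> insert None (Some ` {..<B})" if l: "l \<in> set (map (decode_pair k) w)" for l
    proof -
      obtain m where m: "m \<in> ?\<Gamma>" "l = decode_pair k m" using l w by auto
      then obtain a b where "m = [a, b]" by (auto simp: conv_alphabet_def length_Suc_conv numeral_2_eq_2)
      moreover have "set (decode_letter k a) \<subseteq> insert None (Some ` {..<B})"
        if "a \<in> insert None (Some ` tuple_alphabet k B)" for a
      proof (cases a)
        case (Some c)
        then have "decode_letter k a \<in> tuple_columns k B"
          using that decode_letter_Some(1) by blast
        then show ?thesis by (simp add: tuple_columns_def)
      qed (auto simp: decode_letter_None)
      ultimately show ?thesis using m by (auto simp: decode_pair_def conv_alphabet_def)
    qed
    then obtain vs where vs: "length vs = k + k" "convolution vs = map (decode_pair k) w" "set vs \<subseteq> lists {..<B}"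
      using padded_imp_convolution[of "k + k" "map (decode_pair k) w" "{..<B}"] w k by auto
    define us where "us = take k vs"
    define ws where "ws = drop k vs"
    have uw: "us \<in> word_tuples k B" "ws \<in> word_tuples k B"
      using vs set_take_subset[of k vs] set_drop_subset[of k vs] by (auto simp: word_tuples_def us_def ws_def)
    have R: "R us ws" using F[OF vs(1)] w vs(2) by (simp add: us_def ws_def)
    have "map (decode_pair k) (convolution [encode_tuple us, encode_tuple ws]) = map (decode_pair k) w"
      using map_decode_convolution[OF uw k] vs(2) by (simp add: us_def ws_def)
    moreover have "inj_on (decode_pair k) (set (convolution [encode_tuple us, encode_tuple ws]) \<union> set w)"
      by (rule inj_on_subset[OF decode_pair_inj[of k B]]) (use convolution_pair_in_lists[OF uw k] w in auto)
    ultimately have "convolution [encode_tuple us, encode_tuple ws] = w"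
      by (simp add: inj_on_map_eq_map)
    then show "w \<in> convolution ` ?R" using uw R by blast
  qed
  then show ?thesis
    unfolding regular_rel_def using regular_padded[OF fin f] by simp
qed

section \<open>A program that runs forever exactly on correct claims\<close>

fun instr_reg :: "instr \<Rightarrow> nat" where
  "instr_reg (Inc i l) = i"
| "instr_reg (Dec i l l') = i"

text \<open>The bound on jump targets keeps the letters of the histories within a finite
  alphabet.\<close>

fun instr_ok :: "nat \<Rightarrow> nat \<Rightarrow> instr \<Rightarrow> bool" where
  "instr_ok K n (Inc i l) \<longleftrightarrow> i < K \<and> l \<le> n"
| "instr_ok K n (Dec i l l') \<longleftrightarrow> i < K \<and> l \<le> n \<and> l' \<le> n"

text \<open>A program may halt at any position outside its list; cutting targets at \<open>n\<close>
  directs all these exits to the first instruction behind the relocated copy.\<close>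

fun relocate :: "nat \<Rightarrow> nat \<Rightarrow> instr \<Rightarrow> instr" where
  "relocate d n (Inc i l) = Inc i (d + min l n)"
| "relocate d n (Dec i l l') = Dec i (d + min l n) (d + min l' n)"

definition halts :: "instr list \<Rightarrow> config \<Rightarrow> bool" where
  "halts Q c \<longleftrightarrow> (\<exists>k. length Q \<le> fst ((machine_step Q ^^ k) c))"

lemma halts_machine_step: "halts Q (machine_step Q c) \<longleftrightarrow> halts Q c"
proof
  assume "halts Q (machine_step Q c)"
  then obtain k where "length Q \<le> fst ((machine_step Q ^^ k) (machine_step Q c))"
    by (auto simp: halts_def)
  then show "halts Q c"
    unfolding halts_def by (intro exI[of _ "Suc k"]) (simp add: funpow_swap1)
next
  assume "halts Q c"
  then obtain k where k: "length Q \<le> fst ((machine_step Q ^^ k) c)" by (auto simp: halts_def)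
  show "halts Q (machine_step Q c)"
  proof (cases k)
    case 0
    then have "machine_step Q c = c" using k by (cases c) simp
    then show ?thesis using \<open>halts Q c\<close> by simp
  next
    case (Suc j)
    then show ?thesis
      using k unfolding halts_def by (intro exI[of _ j]) (simp add: funpow_swap1)
  qed
qed

lemma halts_exec: "pc < length Q \<Longrightarrow> halts Q (pc, \<rho>) \<longleftrightarrow> halts Q (exec (Q ! pc) \<rho>)"
  using halts_machine_step[of Q "(pc, \<rho>)"] by simp

lemma halts_outside: "length Q \<le> pc \<Longrightarrow> halts Q (pc, \<rho>)"
  unfolding halts_def by (intro exI[of _ 0]) simp

text \<open>Registers \<open>0\<close> and \<open>1\<close> hold \<open>y\<close> and \<open>x\<close>, and registers \<open>K, \<dots>, K + 4\<close> hold \<open>x\<close>, \<open>y\<close>, \<open>m\<close>, \<open>m'\<close>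
  and \<open>t\<close>. The claim is that \<open>(y, m')\<close> lies lexicographically below \<open>(x, m)\<close>, where the first
  components are compared by \<open>P\<close>. A positive \<open>t\<close> makes the program halt after exactly \<open>t + 1\<close> steps.\<close>

definition claim_program :: "nat \<Rightarrow> instr list \<Rightarrow> instr list" where
  "claim_program K P = (let n = length P; accept = 9 + n; reject = 10 + n in
     [Dec (K + 4) 1 2,
      Dec (K + 4) 1 reject,
      Dec K 3 4,
      Dec (K + 1) 2 7,
      Dec (K + 1) 7 5,
      Dec (K + 2) 6 reject,
      Dec (K + 3) 5 accept]
     @ map (relocate 7 n) P
     @ [Dec 0 (8 + n) reject,
        Dec 0 reject accept,
        Inc 0 accept])"

lemma length_claim_program: "length (claim_program K P) = length P + 10"
  by (simp add: claim_program_def Let_def)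

lemma nth_claim_program:
  "claim_program K P ! 0 = Dec (K + 4) 1 2"
  "claim_program K P ! 1 = Dec (K + 4) 1 (10 + length P)"
  "claim_program K P ! 2 = Dec K 3 4"
  "claim_program K P ! 3 = Dec (K + 1) 2 7"
  "claim_program K P ! 4 = Dec (K + 1) 7 5"
  "claim_program K P ! 5 = Dec (K + 2) 6 (10 + length P)"
  "claim_program K P ! 6 = Dec (K + 3) 5 (9 + length P)"
  "claim_program K P ! (7 + length P) = Dec 0 (8 + length P) (10 + length P)"
  "claim_program K P ! (8 + length P) = Dec 0 (10 + length P) (9 + length P)"
  "claim_program K P ! (9 + length P) = Inc 0 (9 + length P)"
  by (simp_all add: claim_program_def Let_def nth_append)

lemma nth_claim_program_P: "pc < length P \<Longrightarrow> claim_program K P ! (7 + pc) = relocate 7 (length P) (P ! pc)"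
  by (simp add: claim_program_def Let_def nth_append)

lemma instr_ok_claim_program:
  assumes "2 \<le> K" "\<forall>a \<in> set P. instr_reg a < K" "a \<in> set (claim_program K P)"
  shows "instr_ok (K + 5) (length (claim_program K P)) a"
proof -
  have "instr_ok (K + 5) (length P + 10) (relocate 7 (length P) b)" if "b \<in> set P" for b
    using assms(2) that by (cases b) (auto simp: min_def)
  then show ?thesis
    using assms(1,3) unfolding length_claim_program claim_program_def Let_def
    by (auto simp: numeral_eq_Suc)
qed

context
  fixes K :: nat and P Q :: "instr list"
  assumes K: "2 \<le> K" and P: "\<forall>a \<in> set P. instr_reg a < K" and Q: "Q = claim_program K P"
begin

lemma length_Q: "length Q = length P + 10"
  by (simp add: Q length_claim_program)

text \<open>The accepting position is a loop that increments register 0 forever.\<close>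

lemma not_halts_accept: "\<not> halts Q (9 + length P, \<rho>)"
proof -
  have "fst ((machine_step Q ^^ k) (9 + length P, \<rho>)) = 9 + length P" for k
  proof (induction k)
    case (Suc k)
    obtain \<sigma> where "(machine_step Q ^^ k) (9 + length P, \<rho>) = (9 + length P, \<sigma>)"
      using Suc by (metis prod.collapse)
    then show ?case by (simp add: length_Q) (simp add: Q nth_claim_program)
  qed simp
  then show ?thesis by (auto simp: halts_def length_Q)
qed

lemma halts_reject: "halts Q (10 + length P, \<rho>)"
  by (rule halts_outside) (simp add: length_Q)

text \<open>Positions 5 and 6 count down \<open>m\<close> and \<open>m'\<close> in turn, beginning
  with \<open>m\<close>; hence a tie exhausts \<open>m\<close> first and rejects.\<close>

lemma halts_compare_m: "halts Q (5, \<rho>) \<longleftrightarrow> \<not> \<rho> (K + 3) < \<rho> (K + 2)"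
proof (induction "\<rho> (K + 2)" arbitrary: \<rho>)
  case 0
  then show ?case
    by (subst halts_exec) (simp_all add: length_Q, simp add: Q nth_claim_program halts_reject[unfolded Q])
next
  case (Suc m)
  let ?\<rho> = "\<rho>(K + 2 := m)"
  have m: "\<rho> (K + 2) = Suc m" using Suc(2) by simp
  have "halts Q (5, \<rho>) \<longleftrightarrow> halts Q (6, ?\<rho>)"
    using m by (subst halts_exec) (simp_all add: length_Q, simp add: Q nth_claim_program)
  also have "\<dots> \<longleftrightarrow> \<not> \<rho> (K + 3) < \<rho> (K + 2)"
  proof (cases "\<rho> (K + 3)")
    case 0
    then have "halts Q (6, ?\<rho>) \<longleftrightarrow> halts Q (9 + length P, ?\<rho>)"
      by (subst halts_exec) (simp_all add: length_Q, simp add: Q nth_claim_program)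
    then show ?thesis using not_halts_accept 0 Suc(2) by simp
  next
    case (Suc m')
    then have "halts Q (6, ?\<rho>) \<longleftrightarrow> halts Q (5, ?\<rho>(K + 3 := m'))"
      by (subst halts_exec) (simp_all add: length_Q, simp add: Q nth_claim_program)
    also have "\<dots> \<longleftrightarrow> \<not> m' < m"
      using Suc.hyps(1)[of "?\<rho>(K + 3 := m')"] by simp
    finally show ?thesis using Suc m by simp
  qed
  finally show ?case .
qed

text \<open>The copies of \<open>x\<close> and \<open>y\<close> in registers \<open>K\<close> and
  \<open>K + 1\<close> are consumed, so their final contents are left open in
  \<open>\<rho>'\<close>. The arguments of \<open>P\<close> in registers 0 and 1 survive the
  comparison.\<close>

lemma halts_compare_x:
  "\<exists>\<rho>'. (\<forall>i. i \<noteq> K \<and> i \<noteq> K + 1 \<longrightarrow> \<rho>' i = \<rho> i) \<and>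
    (halts Q (2, \<rho>) \<longleftrightarrow> halts Q (if \<rho> K = \<rho> (K + 1) then 5 else 7, \<rho>'))"
proof (induction "\<rho> K" arbitrary: \<rho>)
  case 0
  then have "halts Q (2, \<rho>) \<longleftrightarrow> halts Q (4, \<rho>)"
    by (subst halts_exec) (simp_all add: length_Q, simp add: Q nth_claim_program)
  also have "\<dots> \<longleftrightarrow> (if \<rho> (K + 1) = 0 then halts Q (5, \<rho>) else halts Q (7, \<rho>(K + 1 := \<rho> (K + 1) - 1)))"
    by (subst halts_exec) (simp_all add: length_Q, simp add: Q nth_claim_program)
  finally have *: "halts Q (2, \<rho>) \<longleftrightarrow>
      (if \<rho> (K + 1) = 0 then halts Q (5, \<rho>) else halts Q (7, \<rho>(K + 1 := \<rho> (K + 1) - 1)))" .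
  show ?case
  proof (cases "\<rho> (K + 1) = 0")
    case True
    then show ?thesis
      using * 0 by (intro exI[of _ \<rho>]) simp
  next
    case False
    then show ?thesis
      using * 0 by (intro exI[of _ "\<rho>(K + 1 := \<rho> (K + 1) - 1)"]) (simp add: fun_upd_def)
  qed
next
  case (Suc x)
  let ?\<rho> = "\<rho>(K := x)"
  have x: "\<rho> K = Suc x" using Suc(2) by simp
  have 1: "halts Q (2, \<rho>) \<longleftrightarrow> halts Q (3, ?\<rho>)"
    using x by (subst halts_exec) (simp_all add: length_Q, simp add: Q nth_claim_program)
  show ?case
  proof (cases "\<rho> (K + 1)")
    case 0
    have "halts Q (3, ?\<rho>) \<longleftrightarrow> halts Q (7, ?\<rho>)"
      using 0 by (subst halts_exec) (simp_all add: length_Q, simp add: Q nth_claim_program)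
    then show ?thesis
      using 0 1 x by (intro exI[of _ ?\<rho>]) (simp add: fun_upd_def)
  next
    case (Suc y)
    let ?\<rho>' = "?\<rho>(K + 1 := y)"
    have 2: "halts Q (3, ?\<rho>) \<longleftrightarrow> halts Q (2, ?\<rho>')"
      using Suc by (subst halts_exec) (simp_all add: length_Q, simp add: Q nth_claim_program)
    obtain \<rho>'' where "\<forall>i. i \<noteq> K \<and> i \<noteq> K + 1 \<longrightarrow> \<rho>'' i = ?\<rho>' i"
        "halts Q (2, ?\<rho>') \<longleftrightarrow> halts Q (if x = y then 5 else 7, \<rho>'')"
      using Suc.hyps(1)[of ?\<rho>'] by auto
    then show ?thesis
      using 1 2 Suc x by (intro exI[of _ \<rho>'']) simp
  qed
qed

text \<open>The fate of the large program is invariant under the steps of \<open>P\<close>, as long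
  as the registers below \<open>K\<close> agree. When \<open>P\<close> has halted,
  \<open>min\<close> holds the position at the common exit.\<close>

lemma halts_relocated:
  assumes "\<forall>i < K. \<rho> i = \<sigma> i"
  shows "\<exists>\<rho>'. (\<forall>i < K. \<rho>' i = snd ((machine_step P ^^ k) (0, \<sigma>)) i) \<and>
    (halts Q (7, \<rho>) \<longleftrightarrow> halts Q (7 + min (length P) (fst ((machine_step P ^^ k) (0, \<sigma>))), \<rho>'))"
proof (induction k)
  case (Suc k)
  obtain pc \<tau> where c: "(machine_step P ^^ k) (0, \<sigma>) = (pc, \<tau>)" by fastforce
  obtain \<rho>' where \<rho>': "\<forall>i < K. \<rho>' i = \<tau> i" "halts Q (7, \<rho>) \<longleftrightarrow> halts Q (7 + min (length P) pc, \<rho>')"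
    using Suc c by auto
  show ?case
  proof (cases "pc < length P")
    case True
    then have reg: "instr_reg (P ! pc) < K" using P by simp
    have "halts Q (7 + pc, \<rho>') \<longleftrightarrow> halts Q (exec (relocate 7 (length P) (P ! pc)) \<rho>')"
      using True nth_claim_program_P[OF True, of K] by (subst halts_exec) (simp_all add: length_Q, simp add: Q)
    moreover have "exec (relocate 7 (length P) (P ! pc)) \<rho>' =
        (7 + min (length P) (fst (exec (P ! pc) \<tau>)), snd (exec (relocate 7 (length P) (P ! pc)) \<rho>'))"
      using reg \<rho>'(1) by (cases "P ! pc") (auto simp: min.commute)
    moreover have "\<forall>i < K. snd (exec (relocate 7 (length P) (P ! pc)) \<rho>') i = snd (exec (P ! pc) \<tau>) i"
      using reg \<rho>'(1) by (cases "P ! pc") auto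
    ultimately show ?thesis
      using \<rho>'(2) True c by (intro exI[of _ "snd (exec (relocate 7 (length P) (P ! pc)) \<rho>')"]) auto
  next
    case False
    then show ?thesis using c \<rho>' by (intro exI[of _ \<rho>']) simp
  qed
qed (use assms in auto)

lemma halts_run_P:
  assumes "halts_with P \<sigma> out" "\<forall>i < K. \<rho> i = \<sigma> i"
  shows "halts Q (7, \<rho>) \<longleftrightarrow> out \<noteq> 1"
proof -
  obtain k pc \<tau> where c: "(machine_step P ^^ k) (0, \<sigma>) = (pc, \<tau>)" "length P \<le> pc" "\<tau> 0 = out"
    using assms(1) by (auto simp: halts_with_def)
  obtain \<rho>' where \<rho>': "\<forall>i < K. \<rho>' i = \<tau> i" "halts Q (7, \<rho>) \<longleftrightarrow> halts Q (7 + length P, \<rho>')"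
    using halts_relocated[OF assms(2), of k] c by auto
  have out: "\<rho>' 0 = out" using \<rho>'(1) c(3) K by auto
  have 1: "halts Q (7 + length P, \<rho>') \<longleftrightarrow>
      (if out = 0 then halts Q (10 + length P, \<rho>') else halts Q (8 + length P, \<rho>'(0 := out - 1)))"
    using out by (subst halts_exec) (simp_all add: length_Q, simp add: Q nth_claim_program)
  have 2: "halts Q (8 + length P, \<rho>'(0 := out - 1)) \<longleftrightarrow>
      (if out - 1 = 0 then halts Q (9 + length P, \<rho>'(0 := out - 1))
       else halts Q (10 + length P, \<rho>'(0 := out - 1 - 1)))"
    by (subst halts_exec) (simp_all add: length_Q, simp add: Q nth_claim_program)
  show ?thesis
    using \<rho>'(2) 1 2 halts_reject not_halts_accept by (cases "out = 0"; cases "out = 1") auto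
qed

context
  fixes r :: "nat rel" and x m y m' t :: nat and \<rho> :: "nat \<Rightarrow> nat"
  assumes dec: "\<And>a b. halts_with P ((\<lambda>_. 0)(0 := a, 1 := b)) (if (a, b) \<in> r then 1 else 0)"
    and \<rho>: "\<rho> 0 = y" "\<rho> 1 = x" "\<forall>i. 2 \<le> i \<and> i < K \<longrightarrow> \<rho> i = 0"
      "\<rho> K = x" "\<rho> (K + 1) = y" "\<rho> (K + 2) = m" "\<rho> (K + 3) = m'" "\<rho> (K + 4) = t"
begin

lemma halts_claim_program:
  assumes "t = 0"
  shows "halts Q (0, \<rho>) \<longleftrightarrow> \<not> (y = x \<and> m' < m \<or> y \<noteq> x \<and> (y, x) \<in> r)"
proof -
  have 1: "halts Q (0, \<rho>) \<longleftrightarrow> halts Q (2, \<rho>)"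
    using assms \<rho>(8) by (subst halts_exec) (simp_all add: length_Q, simp add: Q nth_claim_program)
  obtain \<rho>' where \<rho>': "\<forall>i. i \<noteq> K \<and> i \<noteq> K + 1 \<longrightarrow> \<rho>' i = \<rho> i"
      "halts Q (2, \<rho>) \<longleftrightarrow> halts Q (if x = y then 5 else 7, \<rho>')"
    using halts_compare_x[of \<rho>] \<rho> by auto
  show ?thesis
  proof (cases "x = y")
    case True
    then show ?thesis using 1 \<rho>' \<rho> halts_compare_m[of \<rho>'] by simp
  next
    case False
    have "\<rho>' i = ((\<lambda>_. 0)(0 := y, 1 := x)) i" if "i < K" for i
      using \<rho>'(1) \<rho> that by (cases "i < 2") (auto simp: less_2_cases_iff)
    then have "halts Q (7, \<rho>') \<longleftrightarrow> (if (y, x) \<in> r then 1 else 0) \<noteq> (1 :: nat)"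
      by (intro halts_run_P[OF dec]) simp
    then show ?thesis using 1 \<rho>' False by simp
  qed
qed

text \<open>One decrement happens at position 0, \<open>t - 1\<close> decrements and the final
  failing test at position 1. The claim is never inspected, so the duration \<open>t + 1\<close>
  depends on \<open>t\<close> alone.\<close>

lemma claim_program_bomb:
  assumes "0 < t"
  shows "(\<forall>j < i. fst ((machine_step Q ^^ j) (0, \<rho>)) < length Q) \<longleftrightarrow> i \<le> t + 1"
proof -
  have step0: "machine_step Q (0, \<rho>) = (1, \<rho>(K + 4 := t - 1))"
    using assms \<rho>(8) by (simp add: length_Q) (simp add: Q nth_claim_program)
  have step1: "machine_step Q (1, \<sigma>) =
      (if \<sigma> (K + 4) = 0 then (10 + length P, \<sigma>) else (1, \<sigma>(K + 4 := \<sigma> (K + 4) - 1)))" for \<sigma>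
    by (simp add: length_Q) (simp add: Q nth_claim_program[unfolded One_nat_def])
  have iter: "(machine_step Q ^^ Suc j) (0, \<rho>) = (1, \<rho>(K + 4 := t - 1 - j))" if "j < t" for j
    using that
  proof (induction j)
    case (Suc j)
    have "(machine_step Q ^^ Suc (Suc j)) (0, \<rho>) = machine_step Q ((machine_step Q ^^ Suc j) (0, \<rho>))"
      by simp
    also have "\<dots> = machine_step Q (1, \<rho>(K + 4 := t - 1 - j))"
      using Suc by (simp only: Suc_lessD)
    also have "\<dots> = (1, \<rho>(K + 4 := t - 1 - Suc j))"
      using Suc.prems by (simp only: step1) simp
    finally show ?case .
  qed (use step0 in \<open>simp only: funpow.simps o_apply id_apply diff_zero\<close>)
  have last: "(machine_step Q ^^ (t + 1)) (0, \<rho>) = (10 + length P, \<rho>(K + 4 := 0))"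
  proof -
    have "(machine_step Q ^^ Suc t) (0, \<rho>) = machine_step Q ((machine_step Q ^^ Suc (t - 1)) (0, \<rho>))"
      using assms by simp
    also have "\<dots> = machine_step Q (1, \<rho>(K + 4 := 0))"
      using iter[of "t - 1"] assms by simp
    also have "\<dots> = (10 + length P, \<rho>(K + 4 := 0))"
      by (simp only: step1) simp
    finally show ?thesis by simp
  qed
  have lt: "fst ((machine_step Q ^^ j) (0, \<rho>)) < length Q" if "j \<le> t" for j
  proof (cases j)
    case (Suc j')
    then show ?thesis using iter[of j'] that by (simp add: length_Q)
  qed (simp add: length_Q)
  show ?thesis
  proof
    assume *: "\<forall>j < i. fst ((machine_step Q ^^ j) (0, \<rho>)) < length Q"
    have "\<not> fst ((machine_step Q ^^ (t + 1)) (0, \<rho>)) < length Q"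
      by (simp only: last) (simp add: length_Q)
    with * show "i \<le> t + 1" by (meson not_le)
  qed (use lt in auto)
qed

text \<open>Two steps are also the length of the shortest run with \<open>t > 0\<close>. So no claim
  produces a chain shorter than those available through positive \<open>t\<close>.\<close>

lemma claim_program_two_steps:
  "\<forall>j < 2. fst ((machine_step Q ^^ j) (0, \<rho>)) < length Q"
proof -
  have "fst (machine_step Q (0, \<rho>)) < length Q"
    by (simp add: length_Q) (simp add: Q nth_claim_program)
  then show ?thesis by (auto simp: less_2_cases_iff length_Q)
qed

end

end

section \<open>The automatic structure\<close>

lemma eq_list_update2_iff:
  assumes "length us = n" "length ws = n" "i < n" "j < n" "i \<noteq> j"
  shows "ws = us[i := a, j := b] \<longleftrightarrow> ws ! i = a \<and> ws ! j = b \<and> (\<forall>k < n. k \<noteq> i \<and> k \<noteq> j \<longrightarrow> ws ! k = us ! k)"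
  using assms by (auto intro!: nth_equalityI simp: nth_list_update)

lemma eq_list_update_iff:
  assumes "length us = n" "length ws = n" "i < n"
  shows "ws = us[i := a] \<longleftrightarrow> ws ! i = a \<and> (\<forall>k < n. k \<noteq> i \<longrightarrow> ws ! k = us ! k)"
  using assms by (auto intro!: nth_equalityI simp: nth_list_update)

text \<open>An element is a tuple of words \<open>v, h, p\<^sub>0, \<dots>, p\<^bsub>R-1\<^esub>\<close>. Vertices of the tree have \<open>h\<close> and all \<open>p\<^sub>i\<close>
  empty. Otherwise the tuple is a configuration of \<open>Q\<close>: the value of register \<open>i\<close> is the number of
  trailing letters \<open>1\<close> of \<open>p\<^sub>i\<close>, and the history \<open>h\<close> lists codes \<open>2 * pc + b\<close>, where \<open>b = 1\<close> if \<open>pc\<close> was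
  reached by a successful decrement. The last entry of \<open>h\<close> gives the current position, and the history
  makes the step relation injective.

  Since the blocks of \<open>v\<close> start with \<open>0\<close>, the prefix of \<open>v\<close> that ends with a certain block is a register
  word with the number in that block as its value. This is how a configuration is initialised: register
  \<open>i\<close> gets the number in the block with index \<open>input_block i\<close>, counted from the end of \<open>v\<close> starting
  with \<open>1\<close>, where \<open>0\<close> stands for no input.\<close>

locale machine_structure =
  fixes Q :: "instr list" and R :: nat and input_block :: "nat \<Rightarrow> nat"
  assumes instr_ok: "\<And>a. a \<in> set Q \<Longrightarrow> instr_ok R (length Q) a"
begin

abbreviation tracks :: nat where
  "tracks \<equiv> R + 2"

text \<open>The largest letter, \<open>2 * length Q + 1\<close>, occurs in a history when a
  successful decrement jumps to the halting position \<open>length Q\<close>.\<close>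

definition elements :: "nat list list set" where
  "elements = word_tuples tracks (2 * length Q + 2)"

definition is_vertex :: "nat list list \<Rightarrow> bool" where
  "is_vertex ws \<longleftrightarrow> (\<forall>i < R + 1. ws ! (1 + i) = [])"

definition child :: "nat list list \<Rightarrow> nat list list \<Rightarrow> bool" where
  "child us ws \<longleftrightarrow> is_vertex us \<and> is_vertex ws \<and> blocks_prefix 4 (us ! 0) (ws ! 0)"

definition initial :: "nat list list \<Rightarrow> nat list list \<Rightarrow> bool" where
  "initial us ws \<longleftrightarrow> is_vertex us \<and> us ! 0 = ws ! 0 \<and> ws ! 1 = [0] \<and>
     (\<forall>i < R. if input_block i = 0 then ws ! (2 + i) = []
       else blocks_prefix (input_block i - 1) (ws ! (2 + i)) (ws ! 0))"

definition next_config :: "nat list list \<Rightarrow> nat list list option" where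
  "next_config ws =
     (if ws ! 1 = [] \<or> 2 * length Q \<le> last (ws ! 1) then None
      else case Q ! (last (ws ! 1) div 2) of
        Inc i l \<Rightarrow> Some (ws[1 := ws ! 1 @ [2 * l], 2 + i := ws ! (2 + i) @ [1]])
      | Dec i l l' \<Rightarrow>
          if ws ! (2 + i) \<noteq> [] \<and> last (ws ! (2 + i)) = 1
          then Some (ws[1 := ws ! 1 @ [2 * l + 1], 2 + i := butlast (ws ! (2 + i))])
          else Some (ws[1 := ws ! 1 @ [2 * l']]))"

definition step_rel :: "nat list list \<Rightarrow> nat list list \<Rightarrow> bool" where
  "step_rel us ws \<longleftrightarrow> next_config us = Some ws"

definition relation :: "nat \<Rightarrow> nat list list \<Rightarrow> nat list list \<Rightarrow> bool" where
  "relation s = (if s = 0 then child else if s = 1 then initial else step_rel)"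

definition tuple_struct :: "nat list list struct" where
  "tuple_struct = \<lparr>univ = elements, vocab = [2, 2, 2],
     rel = (\<lambda>s. {[us, ws] | us ws. us \<in> elements \<and> ws \<in> elements \<and> relation s us ws})\<rparr>"

text \<open>The same structure with one word per element, as an automatic presentation requires. The
  back-and-forth analysis takes place in \<open>tuple_struct\<close> and is transferred along
  \<open>encode_tuple\<close>.\<close>

definition word_struct :: "nat list struct" where
  "word_struct = \<lparr>univ = encode_tuple ` elements, vocab = [2, 2, 2],
     rel = (\<lambda>s. {[encode_tuple us, encode_tuple ws] | us ws. us \<in> elements \<and> ws \<in> elements \<and> relation s us ws})\<rparr>"

section \<open>Properties of the step relation\<close>

lemma elements_length: "ws \<in> elements \<Longrightarrow> length ws = tracks"
  by (simp add: elements_def word_tuples_def)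

text \<open>The effect of one instruction in terms of recognizable relations: the removal of a
  letter is written as an append in the opposite direction.\<close>

fun instr_rel :: "instr \<Rightarrow> nat list list \<Rightarrow> nat list list \<Rightarrow> bool" where
  "instr_rel (Inc i l) us ws \<longleftrightarrow> ws ! 1 = us ! 1 @ [2 * l] \<and> ws ! (2 + i) = us ! (2 + i) @ [1] \<and>
     (\<forall>j < tracks. j \<noteq> 1 \<and> j \<noteq> 2 + i \<longrightarrow> ws ! j = us ! j)"
| "instr_rel (Dec i l l') us ws \<longleftrightarrow>
     ws ! 1 = us ! 1 @ [2 * l + 1] \<and> us ! (2 + i) = ws ! (2 + i) @ [1] \<and>
       (\<forall>j < tracks. j \<noteq> 1 \<and> j \<noteq> 2 + i \<longrightarrow> ws ! j = us ! j)
     \<or> \<not> (us ! (2 + i) \<noteq> [] \<and> last (us ! (2 + i)) = 1) \<and> ws ! 1 = us ! 1 @ [2 * l'] \<and>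
       (\<forall>j < tracks. j \<noteq> 1 \<longrightarrow> ws ! j = us ! j)"

lemma step_rel_iff:
  assumes len: "length us = tracks" "length ws = tracks"
  shows "step_rel us ws \<longleftrightarrow> (\<exists>a < 2 * length Q. (us ! 1 \<noteq> [] \<and> last (us ! 1) = a) \<and> instr_rel (Q ! (a div 2)) us ws)"
proof (cases "us ! 1 = [] \<or> 2 * length Q \<le> last (us ! 1)")
  case True
  then show ?thesis by (auto simp: step_rel_def next_config_def)
next
  case False
  let ?a = "last (us ! 1)"
  have a: "?a div 2 < length Q" using False by auto
  have "step_rel us ws \<longleftrightarrow> instr_rel (Q ! (?a div 2)) us ws"
  proof (cases "Q ! (?a div 2)")
    case (Inc i l)
    have i: "i < R" using instr_ok[OF nth_mem[OF a]] Inc by simp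
    have "step_rel us ws \<longleftrightarrow> ws = us[1 := us ! 1 @ [2 * l], 2 + i := us ! (2 + i) @ [1]]"
      using False Inc by (auto simp: step_rel_def next_config_def)
    also have "\<dots> \<longleftrightarrow> instr_rel (Q ! (?a div 2)) us ws"
      unfolding Inc instr_rel.simps by (rule eq_list_update2_iff) (use len i in auto)
    finally show ?thesis .
  next
    case (Dec i l l')
    have i: "i < R" using instr_ok[OF nth_mem[OF a]] Dec by simp
    show ?thesis
    proof (cases "us ! (2 + i) \<noteq> [] \<and> last (us ! (2 + i)) = 1")
      case True
      have "step_rel us ws \<longleftrightarrow> ws = us[1 := us ! 1 @ [2 * l + 1], 2 + i := butlast (us ! (2 + i))]"
        using False Dec True by (auto simp: step_rel_def next_config_def)
      also have "\<dots> \<longleftrightarrow> ws ! 1 = us ! 1 @ [2 * l + 1] \<and> ws ! (2 + i) = butlast (us ! (2 + i)) \<and>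
          (\<forall>j < tracks. j \<noteq> 1 \<and> j \<noteq> 2 + i \<longrightarrow> ws ! j = us ! j)"
        by (rule eq_list_update2_iff) (use len i in auto)
      also have "\<dots> \<longleftrightarrow> instr_rel (Q ! (?a div 2)) us ws"
      proof -
        have "ws ! (2 + i) = butlast (us ! (2 + i)) \<longleftrightarrow> us ! (2 + i) = ws ! (2 + i) @ [1]"
          using True by (metis append_butlast_last_id butlast_snoc)
        then show ?thesis using True unfolding Dec instr_rel.simps by blast
      qed
      finally show ?thesis .
    next
      case no: False
      have "step_rel us ws \<longleftrightarrow> ws = us[1 := us ! 1 @ [2 * l']]"
        using False Dec no unfolding step_rel_def next_config_def by auto
      also have "\<dots> \<longleftrightarrow> ws ! 1 = us ! 1 @ [2 * l'] \<and> (\<forall>j < tracks. j \<noteq> 1 \<longrightarrow> ws ! j = us ! j)"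
        by (rule eq_list_update_iff) (use len in auto)
      also have "\<dots> \<longleftrightarrow> instr_rel (Q ! (?a div 2)) us ws"
      proof -
        have "us ! (2 + i) \<noteq> ws ! (2 + i) @ [1]" using no by (metis last_snoc snoc_eq_iff_butlast)
        then show ?thesis using no unfolding Dec instr_rel.simps by blast
      qed
      finally show ?thesis .
    qed
  qed
  then show ?thesis using False by auto
qed

lemma step_rel_length:
  assumes "step_rel us ws" "length us = tracks"
  shows "length ws = tracks" "us ! 1 \<noteq> []" "length (ws ! 1) = Suc (length (us ! 1))"
    "ws ! 0 = us ! 0"
proof -
  show *: "length ws = tracks"
    using assms by (auto simp: step_rel_def next_config_def split: if_splits instr.splits)
  obtain a where a: "us ! 1 \<noteq> []" "instr_rel (Q ! (a div 2)) us ws"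
    using assms(1) step_rel_iff[OF assms(2) *] by blast
  show "us ! 1 \<noteq> []" by (rule a(1))
  show "length (ws ! 1) = Suc (length (us ! 1))" "ws ! 0 = us ! 0"
    using a(2) by (cases "Q ! (a div 2)"; auto)+
qed

text \<open>Without its last entry the new history is the old one, which determines the executed
  instruction. The parity of the last entry tells whether a decrement succeeded, so the registers
  can be restored.\<close>

lemma step_rel_inject:
  assumes "step_rel us ws" "step_rel vs ws" "length us = tracks" "length vs = tracks"
  shows "us = vs"
proof -
  have len: "length ws = tracks" using step_rel_length assms by blast
  obtain a where a: "us ! 1 \<noteq> []" "last (us ! 1) = a" "instr_rel (Q ! (a div 2)) us ws" "a < 2 * length Q"
    using assms(1) step_rel_iff[OF assms(3) len] by blast
  obtain b where b: "vs ! 1 \<noteq> []" "last (vs ! 1) = b" "instr_rel (Q ! (b div 2)) vs ws"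
    using assms(2) step_rel_iff[OF assms(4) len] by blast
  have "butlast (ws ! 1) = us ! 1" using a(3) by (cases "Q ! (a div 2)") auto
  moreover have "butlast (ws ! 1) = vs ! 1" using b(3) by (cases "Q ! (b div 2)") auto
  ultimately have h: "us ! 1 = vs ! 1" by simp
  then have ab: "a = b" using a b by simp
  have "us ! j = vs ! j" if "j < tracks" for j
  proof (cases "Q ! (a div 2)")
    case (Inc i l)
    then show ?thesis using a(3) b(3) ab h that by (cases "j = 1"; cases "j = 2 + i") auto
  next
    case (Dec i l l')
    have par: "2 * x + 1 \<noteq> 2 * (y :: nat)" for x y by presburger
    consider "last (ws ! 1) = 2 * l + 1" | "last (ws ! 1) \<noteq> 2 * l + 1" by blast
    then show ?thesis
    proof cases
      case 1
      then have "us ! (2 + i) = ws ! (2 + i) @ [1] \<and> (\<forall>j < tracks. j \<noteq> 1 \<and> j \<noteq> 2 + i \<longrightarrow> ws ! j = us ! j)"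
        "vs ! (2 + i) = ws ! (2 + i) @ [1] \<and> (\<forall>j < tracks. j \<noteq> 1 \<and> j \<noteq> 2 + i \<longrightarrow> ws ! j = vs ! j)"
        using a(3) b(3) par unfolding ab[symmetric] Dec instr_rel.simps by (metis last_snoc)+
      then show ?thesis using h that by (metis (no_types))
    next
      case 2
      then have "\<forall>j < tracks. j \<noteq> 1 \<longrightarrow> ws ! j = us ! j" "\<forall>j < tracks. j \<noteq> 1 \<longrightarrow> ws ! j = vs ! j"
        using a(3) b(3) unfolding ab[symmetric] Dec instr_rel.simps by (metis last_snoc)+
      then show ?thesis using h that by (metis (no_types))
    qed
  qed
  then show ?thesis using assms by (intro nth_equalityI) auto
qed

lemma step_rel_elements:
  assumes "step_rel us ws" "us \<in> elements"
  shows "ws \<in> elements"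
proof -
  let ?B = "2 * length Q + 2"
  have sub: "set us \<subseteq> lists {..<?B}" and len: "length us = tracks"
    using assms(2) by (simp_all add: elements_def word_tuples_def)
  have us: "us ! i \<in> lists {..<?B}" if "i < tracks" for i
    by (rule subsetD[OF sub nth_mem]) (use that len in simp)
  have h: "us ! 1 \<noteq> []" "last (us ! 1) div 2 < length Q"
    using assms(1) by (auto simp: step_rel_def next_config_def split: if_splits)
  have ok: "instr_ok R (length Q) (Q ! (last (us ! 1) div 2))"
    using h(2) by (intro instr_ok nth_mem)
  have upd: "set (xs[i := a]) \<subseteq> lists {..<?B}" if "set xs \<subseteq> lists {..<?B}" "a \<in> lists {..<?B}"
    for xs i and a :: "nat list"
    using set_update_subset_insert[of xs i a] that by blast
  have snoc: "us ! i @ [c] \<in> lists {..<?B}" if "c < ?B" "i < tracks" for i c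
    using us[of i] that by simp
  have "set ws \<subseteq> lists {..<?B}"
  proof (cases "Q ! (last (us ! 1) div 2)")
    case (Inc i l)
    then have ws: "ws = us[1 := us ! 1 @ [2 * l], 2 + i := us ! (2 + i) @ [1]]"
      using assms(1) by (auto simp: step_rel_def next_config_def split: if_splits)
    show ?thesis
      unfolding ws by (intro upd sub snoc) (use ok Inc in auto)
  next
    case (Dec i l l')
    have "butlast (us ! (2 + i)) \<in> lists {..<?B}"
      using us[of "2 + i"] ok Dec by (auto simp: in_lists_conv_set dest: in_set_butlastD)
    moreover have "ws = us[1 := us ! 1 @ [2 * l + 1], 2 + i := butlast (us ! (2 + i))] \<or>
        ws = us[1 := us ! 1 @ [2 * l']]"
      using assms(1) Dec by (auto simp: step_rel_def next_config_def split: if_splits)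
    moreover have "us ! 1 @ [2 * l + 1] \<in> lists {..<?B}" "us ! 1 @ [2 * l'] \<in> lists {..<?B}"
      by (intro snoc; use ok Dec in simp)+
    ultimately show ?thesis
      using upd sub by metis
  qed
  moreover have "length ws = tracks" using step_rel_length(1)[OF assms(1) len] .
  ultimately show ?thesis by (simp add: elements_def word_tuples_def)
qed

lemma recognizable_relation:
  "recognizable (tracks + tracks) (\<lambda>ws. relation s (take tracks ws) (drop tracks ws))"
proof -
  let ?t = "tracks" let ?k = "tracks + tracks"
  have eq: "take ?t ws ! i = ws ! i" "drop ?t ws ! i = ws ! (?t + i)" if "length ws = ?k" "i < ?t" for ws :: "nat list list" and i
    using that by auto
  have child: "recognizable ?k (\<lambda>ws. child (take ?t ws) (drop ?t ws))"
  proof (rule recognizable_cong)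
    show "recognizable ?k (\<lambda>ws. (\<forall>i < R + 1. ws ! (1 + i) = []) \<and> (\<forall>i < R + 1. ws ! (?t + (1 + i)) = []) \<and>
        blocks_prefix 4 (ws ! 0) (ws ! (?t + 0)))"
      by (intro recognizable_conj recognizable_all_less recognizable_Nil recognizable_blocks_prefix) auto
  qed (auto simp: child_def is_vertex_def eq simp del: One_nat_def)
  have init: "recognizable ?k (\<lambda>ws. initial (take ?t ws) (drop ?t ws))"
  proof (rule recognizable_cong)
    \<comment> \<open>The history \<open>[0]\<close> of an initial configuration is expressed as an
      append to the empty history of the vertex.\<close>
    show "recognizable ?k (\<lambda>ws. (\<forall>i < R + 1. ws ! (1 + i) = []) \<and> ws ! 0 = ws ! (?t + 0) \<and>
        ws ! (?t + 1) = ws ! 1 @ [0] \<and> (\<forall>i < R. (input_block i = 0 \<longrightarrow> ws ! (?t + (2 + i)) = []) \<and>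
          (input_block i \<noteq> 0 \<longrightarrow> blocks_prefix (input_block i - 1) (ws ! (?t + (2 + i))) (ws ! (?t + 0)))))"
      by (intro recognizable_conj recognizable_all_less recognizable_Nil recognizable_blocks_prefix
          recognizable_eq recognizable_snoc recognizable_imp) auto
    fix ws :: "nat list list" assume ws: "length ws = ?k"
    have *: "(\<forall>i < R + 1. ws ! (1 + i) = []) \<Longrightarrow> ws ! 1 = []" by force
    show "initial (take ?t ws) (drop ?t ws) \<longleftrightarrow> (\<forall>i < R + 1. ws ! (1 + i) = []) \<and> ws ! 0 = ws ! (?t + 0) \<and>
        ws ! (?t + 1) = ws ! 1 @ [0] \<and> (\<forall>i < R. (input_block i = 0 \<longrightarrow> ws ! (?t + (2 + i)) = []) \<and>
          (input_block i \<noteq> 0 \<longrightarrow> blocks_prefix (input_block i - 1) (ws ! (?t + (2 + i))) (ws ! (?t + 0))))"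
      using * ws eq[OF ws] unfolding initial_def is_vertex_def by auto
  qed
  have instr: "recognizable ?k (\<lambda>ws. instr_rel a (take ?t ws) (drop ?t ws))" if a: "instr_ok R (length Q) a" for a
  proof (cases a)
    case (Inc i l)
    have i: "i < R" using a Inc by simp
    show ?thesis
    proof (rule recognizable_cong)
      show "recognizable ?k (\<lambda>ws. ws ! (?t + 1) = ws ! 1 @ [2 * l] \<and> ws ! (?t + (2 + i)) = ws ! (2 + i) @ [1] \<and>
          (\<forall>j < ?t. j \<noteq> 1 \<and> j \<noteq> 2 + i \<longrightarrow> ws ! (?t + j) = ws ! j))"
        by (intro recognizable_conj recognizable_all_less recognizable_imp recognizable_eq recognizable_snoc)
          (use i in auto)
    qed (use i in \<open>auto simp: Inc eq simp del: One_nat_def\<close>)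
  next
    case (Dec i l l')
    have i: "i < R" using a Dec by simp
    show ?thesis
    proof (rule recognizable_cong)
      show "recognizable ?k (\<lambda>ws.
          ws ! (?t + 1) = ws ! 1 @ [2 * l + 1] \<and> ws ! (2 + i) = ws ! (?t + (2 + i)) @ [1] \<and>
            (\<forall>j < ?t. j \<noteq> 1 \<and> j \<noteq> 2 + i \<longrightarrow> ws ! (?t + j) = ws ! j)
          \<or> \<not> (ws ! (2 + i) \<noteq> [] \<and> last (ws ! (2 + i)) = 1) \<and> ws ! (?t + 1) = ws ! 1 @ [2 * l'] \<and>
            (\<forall>j < ?t. j \<noteq> 1 \<longrightarrow> ws ! (?t + j) = ws ! j))"
        by (intro recognizable_disj recognizable_not recognizable_last recognizable_conj recognizable_all_less recognizable_imp recognizable_eq recognizable_snoc)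
          (use i in auto)
    qed (use i in \<open>auto simp: Dec eq simp del: One_nat_def\<close>)
  qed
  have step: "recognizable ?k (\<lambda>ws. step_rel (take ?t ws) (drop ?t ws))"
  proof (rule recognizable_cong)
    show "recognizable ?k (\<lambda>ws. \<exists>a < 2 * length Q. (ws ! 1 \<noteq> [] \<and> last (ws ! 1) = a) \<and>
        instr_rel (Q ! (a div 2)) (take ?t ws) (drop ?t ws))"
    proof (intro recognizable_ex_less recognizable_conj[where S = "\<lambda>ws. ws ! 1 \<noteq> [] \<and> last (ws ! 1) = a" for a] recognizable_last instr)
      fix a assume "a < 2 * length Q"
      then show "instr_ok R (length Q) (Q ! (a div 2))" by (intro instr_ok nth_mem) auto
    qed auto
  qed (subst step_rel_iff, auto simp: eq simp del: One_nat_def)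
  show ?thesis
    using child init step by (auto simp: relation_def)
qed

lemma vocab_cases: "s < length (vocab tuple_struct) \<Longrightarrow> vocab tuple_struct ! s = 2"
  by (auto simp: tuple_struct_def less_Suc_eq nth_Cons')

lemma is_structure_word_struct: "is_structure word_struct"
proof -
  have "replicate tracks [] \<in> elements"
    by (auto simp: elements_def word_tuples_def)
  then have "univ word_struct \<noteq> {}" by (auto simp: word_struct_def)
  moreover have "vocab word_struct ! i = 2" if "i < 3" for i
    using that by (auto simp: word_struct_def less_Suc_eq nth_Cons' numeral_3_eq_3)
  ultimately show ?thesis
    by (auto simp: is_structure_def word_struct_def tuples_def numeral_3_eq_3)
qed

lemma automatic_word_struct: "automatic word_struct"
proof -
  let ?\<Sigma> = "tuple_alphabet tracks (2 * length Q + 2)"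
  have "regular ?\<Sigma> (univ word_struct)"
    using regular_encode_tuples[of tracks] by (simp add: word_struct_def elements_def)
  moreover have "regular_rel ?\<Sigma> (vocab word_struct ! i) (rel word_struct i)" if "i < length (vocab word_struct)" for i
  proof -
    have "vocab word_struct ! i = 2"
      using that by (auto simp: word_struct_def less_Suc_eq nth_Cons')
    then show ?thesis
      using regular_rel_recognizable[OF recognizable_relation[of i], of "2 * length Q + 2"]
      by (simp add: word_struct_def elements_def)
  qed
  ultimately have "automatic_presentation ?\<Sigma> word_struct"
    unfolding automatic_presentation_def using finite_tuple_alphabet is_structure_word_struct by blast
  moreover have "is_iso id word_struct word_struct"
    by (auto simp: is_iso_def)
  ultimately show ?thesis
    unfolding automatic_def isomorphic_def using is_structure_word_struct by blast
qed

lemma is_iso_encode_tuple: "is_iso encode_tuple tuple_struct word_struct"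
  unfolding is_iso_def
proof (intro conjI allI ballI impI)
  have inj: "inj_on encode_tuple elements"
    by (rule inj_onI) (use encode_tuple_inject in \<open>auto simp: elements_def\<close>)
  then show "bij_betw encode_tuple (univ tuple_struct) (univ word_struct)"
    by (simp add: tuple_struct_def word_struct_def bij_betw_def)
  show "vocab tuple_struct = vocab word_struct"
    by (simp add: tuple_struct_def word_struct_def)
  fix s xs assume s: "s < length (vocab tuple_struct)" and xs: "xs \<in> tuples tuple_struct"
    "length xs = vocab tuple_struct ! s"
  then have "length xs = 2" using vocab_cases by simp
  then obtain a b where ab: "xs = [a, b]" by (auto simp: length_Suc_conv numeral_2_eq_2)
  then have "a \<in> elements" "b \<in> elements" using xs by (auto simp: tuples_def tuple_struct_def)
  then show "xs \<in> rel tuple_struct s \<longleftrightarrow> map encode_tuple xs \<in> rel word_struct s"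
    using inj ab by (auto simp: tuple_struct_def word_struct_def dest: inj_onD)
qed

end

section \<open>The tree of claims\<close>

definition tail_ones :: "nat list \<Rightarrow> nat" where
  "tail_ones w = length (takeWhile (\<lambda>a. a = 1) (rev w))"

lemma tail_ones_simps [simp]:
  "tail_ones [] = 0"
  "tail_ones (w @ [1]) = Suc (tail_ones w)"
  "tail_ones (w @ 0 # replicate m 1) = m"
proof -
  show "tail_ones [] = 0" "tail_ones (w @ [1]) = Suc (tail_ones w)"
    by (simp_all add: tail_ones_def)
  have "takeWhile (\<lambda>a. a = (1 :: nat)) (replicate m 1 @ 0 # v) = replicate m 1" for v
    by (induction m) auto
  then show "tail_ones (w @ 0 # replicate m 1) = m"
    by (simp add: tail_ones_def)
qed

lemma tail_ones_eq_0_iff: "tail_ones w = 0 \<longleftrightarrow> \<not> (w \<noteq> [] \<and> last w = 1)"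
  by (cases w rule: rev_cases) (auto simp: tail_ones_def)

lemma tail_ones_unary_blocks: "ns \<noteq> [] \<Longrightarrow> tail_ones (unary_blocks ns) = last ns"
  by (cases ns rule: rev_cases) (simp_all del: One_nat_def)

text \<open>The last block can be read off the end of a word through its trailing letters 1, so a
  known number of blocks splits off in only one way, whatever precedes them.\<close>

lemma unary_blocks_append_inject:
  assumes "u @ unary_blocks ms = v @ unary_blocks ns" "length ms = length ns"
  shows "u = v \<and> ms = ns"
  using assms
proof (induction ms arbitrary: ns rule: rev_induct)
  case (snoc m ms)
  obtain n ns' where ns: "ns = ns' @ [n]" using snoc.prems(2) by (cases ns rule: rev_cases) auto
  have eq: "(u @ unary_blocks ms) @ 0 # replicate m 1 = (v @ unary_blocks ns') @ 0 # replicate n 1"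
    using snoc.prems(1) ns by simp
  then have "m = n" by (metis tail_ones_simps(3))
  with eq snoc.IH[of ns'] snoc.prems(2) ns show ?case by simp
qed simp

lemma count_unary_blocks: "length (filter (\<lambda>a. a = 0) (unary_blocks ns)) = length ns"
  by (induction ns) auto

lemma unary_blocks_inject: "unary_blocks ms = unary_blocks ns \<Longrightarrow> ms = ns"
  using unary_blocks_append_inject[of "[]" ms "[]" ns] by (metis append_Nil count_unary_blocks)

lemma set_unary_blocks: "set (unary_blocks ns) \<subseteq> {0, 1}"
  by (induction ns) auto

type_synonym level = "nat \<times> nat \<times> nat \<times> nat"

fun level_numbers :: "level \<Rightarrow> nat list" where
  "level_numbers (x, m, t, n) = [x, m, t, n]"

definition numbers :: "level list \<Rightarrow> nat list" where
  "numbers L = concat (map level_numbers L)"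

lemma length_level_numbers [simp]: "length (level_numbers a) = 4"
  by (cases a) simp

lemma level_numbers_surj: "length ns = 4 \<Longrightarrow> \<exists>a. ns = level_numbers a"
proof -
  assume "length ns = 4"
  then obtain x m t n where "ns = [x, m, t, n]" by (auto simp: length_Suc_conv numeral_eq_Suc)
  then show ?thesis by (intro exI[of _ "(x, m, t, n)"]) simp
qed

lemma level_numbers_inject [simp]: "level_numbers a = level_numbers b \<longleftrightarrow> a = b"
  by (cases a; cases b) simp

lemma numbers_simps [simp]:
  "numbers [] = []" "numbers (a # L) = level_numbers a @ numbers L" "numbers (L @ M) = numbers L @ numbers M"
  by (simp_all add: numbers_def)

lemma length_numbers [simp]: "length (numbers L) = 4 * length L"
  by (induction L) auto

lemma numbers_inject: "numbers L = numbers M \<Longrightarrow> L = M"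
proof (induction L arbitrary: M)
  case Nil
  then have "4 * length M = 0" by (metis length_numbers list.size(3) numbers_simps(1))
  then show ?case by simp
next
  case (Cons a L)
  then obtain b M' where "M = b # M'"
    by (cases M) (auto dest: arg_cong[of _ _ length])
  with Cons show ?case by simp
qed

text \<open>If the last two levels are \<open>(x, m, t0, n0)\<close> and
  \<open>(y, m', t, n)\<close>, then, counted from the end, block 8 is \<open>x\<close>, 7 is
  \<open>m\<close>, 4 is \<open>y\<close>, 3 is \<open>m'\<close> and 2 is \<open>t\<close>. Both
  \<open>x\<close> and \<open>y\<close> are loaded twice, as arguments of \<open>P\<close> and for
  the comparison.\<close>

definition claim_input :: "nat \<Rightarrow> nat \<Rightarrow> nat" where
  "claim_input K i = (if i = 0 then 4 else if i = 1 then 8 else if i = K then 8 else if i = K + 1 then 4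
     else if i = K + 2 then 7 else if i = K + 3 then 3 else if i = K + 4 then 2 else 0)"

text \<open>The nodes of the tree are the nonempty lists of levels \<open>(x, m, t, n)\<close>. The chain of configurations that
  is attached to a node with at least two levels is infinite if and only if \<open>(x, m)\<close> lies below the
  corresponding pair of the parent and \<open>t = 0\<close>. Levels with \<open>t > 0\<close> provide children with every possible
  finite chain length, and \<open>n\<close> only serves to repeat each child infinitely often. The rank of a node is
  \<open>(rk x, m)\<close>.\<close>

locale claim_tree =
  fixes K :: nat and P :: "instr list" and r :: "nat rel" and rk :: "nat \<Rightarrow> countable_ordinal"
  assumes K: "2 \<le> K" and P_regs: "\<forall>a \<in> set P. instr_reg a < K"
    and decides: "\<And>a b. halts_with P ((\<lambda>_. 0)(0 := a, 1 := b)) (if (a, b) \<in> r then 1 else 0)"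
    and rk: "\<And>x. {rk y | y. (y, x) \<in> r \<and> y \<noteq> x} = {\<gamma>. \<gamma> < rk x}"
begin

abbreviation "Q \<equiv> claim_program K P"

sublocale machine_structure Q "K + 5" "claim_input K"
  by unfold_locales (rule instr_ok_claim_program[OF K P_regs])

lemma unary_blocks_in_lists: "unary_blocks ns \<in> lists {..<2 * length Q + 2}"
  using set_unary_blocks[of ns] by (fastforce simp: in_lists_conv_set)

section \<open>Vertices and their chains\<close>

definition vertex :: "level list \<Rightarrow> nat list list" where
  "vertex L = unary_blocks (numbers L) # [] # replicate (K + 5) []"

lemma vertex_nth: "vertex L ! 0 = unary_blocks (numbers L)" "is_vertex (vertex L)" "vertex L ! 1 = []"
  by (auto simp: vertex_def is_vertex_def nth_Cons')

lemma vertex_elements: "vertex L \<in> elements"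
  using unary_blocks_in_lists by (auto simp: vertex_def elements_def word_tuples_def)

lemma vertex_eqI:
  assumes "ws \<in> elements" "is_vertex ws" "ws ! 0 = unary_blocks (numbers L)"
  shows "ws = vertex L"
proof (rule nth_equalityI)
  show len: "length ws = length (vertex L)"
    using elements_length[OF assms(1)] elements_length[OF vertex_elements] by simp
  fix j assume "j < length ws"
  then have j: "j < K + 5 + 2" using elements_length[OF assms(1)] by simp
  show "ws ! j = vertex L ! j"
  proof (cases j)
    case 0
    then show ?thesis using assms(3) by (simp add: vertex_nth)
  next
    case (Suc i)
    then have "ws ! j = []" "vertex L ! j = []"
      using assms(2) vertex_nth(2)[of L] j by (auto simp: is_vertex_def)
    then show ?thesis by simp
  qed
qed

lemma vertex_inject: "vertex L = vertex M \<Longrightarrow> L = M"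
  using numbers_inject unary_blocks_inject by (auto simp: vertex_def)

lemma child_vertexD:
  assumes "child (vertex L) ws" "ws \<in> elements"
  shows "\<exists>a. ws = vertex (L @ [a])"
proof -
  obtain ns where ns: "length ns = 4" "ws ! 0 = unary_blocks (numbers L) @ unary_blocks ns"
    using assms(1) by (auto simp: child_def blocks_prefix_def vertex_nth)
  obtain a where "ns = level_numbers a" using level_numbers_surj[OF ns(1)] by blast
  then have "ws = vertex (L @ [a])"
    using ns assms by (intro vertex_eqI) (auto simp: child_def)
  then show ?thesis by blast
qed

lemma child_vertexI: "child (vertex L) (vertex (L @ [a]))"
  unfolding child_def blocks_prefix_def vertex_nth
  by (intro conjI exI[of _ "level_numbers a"]) (simp_all add: vertex_nth)

text \<open>Guarantees that no element outside the tree is the parent of a node.\<close>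

lemma child_vertex_rightD:
  assumes "child us (vertex L)" "us \<in> elements"
  shows "\<exists>M a. L = M @ [a] \<and> us = vertex M"
proof -
  obtain ns where ns: "length ns = 4" "unary_blocks (numbers L) = us ! 0 @ unary_blocks ns"
    using assms(1) by (auto simp: child_def blocks_prefix_def vertex_nth)
  have "L \<noteq> []"
  proof
    assume "L = []"
    then have "unary_blocks ns = []" using ns(2) by simp
    then show False using ns(1) count_unary_blocks[of ns] by simp
  qed
  then obtain M a where L: "L = M @ [a]" by (cases L rule: rev_cases) auto
  have "us ! 0 = unary_blocks (numbers M)"
    using unary_blocks_append_inject[of "us ! 0" ns "unary_blocks (numbers M)" "level_numbers a"] ns L by simp
  then have "us = vertex M"
    using assms by (intro vertex_eqI) (auto simp: child_def)
  with L show ?thesis by blast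
qed

text \<open>Input block \<open>d\<close> is loaded as the prefix of the vertex word that ends with
  it, that is, without the last \<open>d - 1\<close> numbers.\<close>

definition start_config :: "level list \<Rightarrow> nat list list" where
  "start_config L = unary_blocks (numbers L) # [0] # map (\<lambda>i. if claim_input K i = 0 then []
     else unary_blocks (take (4 * length L + 1 - claim_input K i) (numbers L))) [0..<K + 5]"

text \<open>The halted configuration still belongs to the chain; \<open>None\<close> begins one step
  later. With fewer than two levels there is no parent to compare with and no chain.\<close>

primrec chain :: "level list \<Rightarrow> nat \<Rightarrow> nat list list option" where
  "chain L 0 = (if length L < 2 then None else Some (start_config L))"
| "chain L (Suc i) = Option.bind (chain L i) next_config"

lemma start_config_elements: "start_config L \<in> elements"
  using unary_blocks_in_lists by (auto simp: start_config_def elements_def word_tuples_def)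

lemma start_config_nth:
  "start_config L ! 0 = unary_blocks (numbers L)" "start_config L ! 1 = [0]"
  "i < K + 5 \<Longrightarrow> start_config L ! (2 + i) = (if claim_input K i = 0 then []
     else unary_blocks (take (4 * length L + 1 - claim_input K i) (numbers L)))"
  by (auto simp: start_config_def nth_Cons' simp del: upt_Suc)

lemma initial_iff:
  assumes "ws \<in> elements"
  shows "initial (vertex L) ws \<longleftrightarrow> chain L 0 = Some ws"
proof
  assume init: "initial (vertex L) ws"
  have ws0: "ws ! 0 = unary_blocks (numbers L)" using init by (simp add: initial_def vertex_nth)
  have pre: "if claim_input K i = 0 then ws ! (2 + i) = []
      else blocks_prefix (claim_input K i - 1) (ws ! (2 + i)) (ws ! 0)" if "i < K + 5" for i
    using init that unfolding initial_def by blast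
  \<comment> \<open>Register 1 asks for block 8, so at least 7 numbers are present; since they come
    in groups of 4, there are two levels.\<close>
  have "blocks_prefix 7 (ws ! (2 + 1)) (unary_blocks (numbers L))"
    using pre[of 1] ws0 by (simp add: claim_input_def)
  then obtain ns where ns: "length ns = 7" "unary_blocks (numbers L) = ws ! (2 + 1) @ unary_blocks ns"
    by (auto simp: blocks_prefix_def)
  have "7 \<le> 4 * length L"
    using count_unary_blocks[of "numbers L"] count_unary_blocks[of ns] ns by simp
  then have L: "2 \<le> length L" by linarith
  have "ws = start_config L"
  proof (rule nth_equalityI)
    show "length ws = length (start_config L)"
      using elements_length[OF assms] elements_length[OF start_config_elements] by simp
    fix j assume "j < length ws"
    then have j: "j < K + 5 + 2" using elements_length[OF assms] by simp
    consider "j = 0" | "j = 1" | i where "j = 2 + i" "i < K + 5"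
      using j by (metis One_nat_def add_2_eq_Suc' add.commute add_less_cancel_right not0_implies_Suc)
    then show "ws ! j = start_config L ! j"
    proof cases
      case 3
      show ?thesis
      proof (cases "claim_input K i = 0")
        case True
        then show ?thesis using pre[OF 3(2)] start_config_nth(3)[OF 3(2)] 3(1) by simp
      next
        case False
        let ?d = "claim_input K i - 1" let ?j = "4 * length L + 1 - claim_input K i"
        have d: "claim_input K i \<le> 8" by (simp add: claim_input_def)
        obtain ms where ms: "length ms = ?d" "unary_blocks (numbers L) = ws ! (2 + i) @ unary_blocks ms"
          using pre[OF 3(2)] False ws0 by (auto simp: blocks_prefix_def)
        have "ws ! (2 + i) @ unary_blocks ms = unary_blocks (take ?j (numbers L)) @ unary_blocks (drop ?j (numbers L))"
          using ms(2) by (metis append_take_drop_id unary_blocks_simps(3))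
        moreover have "length ms = length (drop ?j (numbers L))"
          using ms(1) d L False by simp
        ultimately have "ws ! (2 + i) = unary_blocks (take ?j (numbers L))"
          using unary_blocks_append_inject by blast
        then show ?thesis using start_config_nth(3)[OF 3(2)] 3(1) False by simp
      qed
    qed (use init ws0 in \<open>auto simp: start_config_nth initial_def simp del: One_nat_def\<close>)
  qed
  then show "chain L 0 = Some ws" using L by simp
next
  assume "chain L 0 = Some ws"
  then have L: "2 \<le> length L" and ws: "ws = start_config L" by (auto split: if_splits)
  have "blocks_prefix (claim_input K i - 1) (unary_blocks (take (4 * length L + 1 - claim_input K i) (numbers L)))
      (unary_blocks (numbers L))" if "claim_input K i \<noteq> 0" for i
    unfolding blocks_prefix_def
  proof (intro exI conjI)
    let ?j = "4 * length L + 1 - claim_input K i"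
    show "unary_blocks (numbers L) = unary_blocks (take ?j (numbers L)) @ unary_blocks (drop ?j (numbers L))"
      by (metis append_take_drop_id unary_blocks_simps(3))
    have "claim_input K i \<le> 8" by (simp add: claim_input_def)
    then show "length (drop ?j (numbers L)) = claim_input K i - 1"
      using L that by simp
  qed
  then show "initial (vertex L) ws"
    unfolding initial_def ws using vertex_nth start_config_nth by simp
qed

text \<open>These invariants keep all chains disjoint: the first track names the node, and the
  length of the history gives the position in the chain.\<close>

lemma chain_Some:
  "chain L i = Some c \<Longrightarrow> c \<in> elements \<and> c ! 0 = unary_blocks (numbers L) \<and> length (c ! 1) = Suc i"
proof (induction i arbitrary: c)
  case 0
  then show ?case
    using start_config_elements[of L] start_config_nth[where L = L] by (auto split: if_splits)
next
  case (Suc i)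
  then obtain c' where c': "chain L i = Some c'" "step_rel c' c"
    by (auto simp: step_rel_def bind_eq_Some_conv)
  then show ?case
    using Suc.IH[OF c'(1)] step_rel_elements[OF c'(2)] step_rel_length[OF c'(2)] elements_length by auto
qed

lemma chain_inject: "chain L i = Some c \<Longrightarrow> chain M j = Some c \<Longrightarrow> L = M \<and> i = j"
  using chain_Some[of L i c] chain_Some[of M j c] by (auto dest: unary_blocks_inject numbers_inject)

lemma vertex_neq_chain: "chain L i = Some c \<Longrightarrow> c \<noteq> vertex M"
  using chain_Some[of L i c] vertex_nth(3)[of M] by auto

lemma chain_not_vertex: "chain L i = Some c \<Longrightarrow> \<not> is_vertex c"
  using chain_Some[of L i c] by (force simp: is_vertex_def)

text \<open>Only what the next step depends on is compared: the last entry of the history and the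
  trailing letters 1. The remainder of a register word is a leftover of the vertex word.\<close>

definition simulates :: "nat list list \<Rightarrow> config \<Rightarrow> bool" where
  "simulates ws c \<longleftrightarrow> length ws = K + 5 + 2 \<and> ws ! 1 \<noteq> [] \<and> last (ws ! 1) div 2 = fst c \<and>
     (\<forall>i < K + 5. tail_ones (ws ! (2 + i)) = snd c i)"

lemma simulates_step:
  assumes sim: "simulates ws (pc, \<rho>)" and pc: "pc < length Q"
  shows "\<exists>ws'. next_config ws = Some ws' \<and> simulates ws' (machine_step Q (pc, \<rho>))"
proof -
  have ok: "instr_ok (K + 5) (length Q) (Q ! pc)" by (rule instr_ok) (use pc in simp)
  have a: "\<not> (ws ! 1 = [] \<or> 2 * length Q \<le> last (ws ! 1))" "last (ws ! 1) div 2 = pc" "length ws = K + 5 + 2"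
    and reg: "\<And>i. i < K + 5 \<Longrightarrow> tail_ones (ws ! (2 + i)) = \<rho> i"
    using sim pc by (auto simp: simulates_def)
  show ?thesis
  proof (cases "Q ! pc")
    case (Inc i l)
    have i: "i < K + 5" using ok Inc by simp
    have "next_config ws = Some (ws[1 := ws ! 1 @ [2 * l], 2 + i := ws ! (2 + i) @ [1]])"
      using a Inc by (simp add: next_config_def)
    moreover have "simulates (ws[1 := ws ! 1 @ [2 * l], 2 + i := ws ! (2 + i) @ [1]]) (l, \<rho>(i := Suc (\<rho> i)))"
      using a i reg by (auto simp: simulates_def nth_list_update simp del: One_nat_def)
    ultimately show ?thesis using pc Inc by simp
  next
    case (Dec i l l')
    have i: "i < K + 5" using ok Dec by simp
    show ?thesis
    proof (cases "\<rho> i = 0")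
      case True
      then have "\<not> (ws ! (2 + i) \<noteq> [] \<and> last (ws ! (2 + i)) = 1)"
        using reg[OF i] tail_ones_eq_0_iff by simp
      then have "next_config ws = Some (ws[1 := ws ! 1 @ [2 * l']])"
        using a Dec unfolding next_config_def by auto
      moreover have "simulates (ws[1 := ws ! 1 @ [2 * l']]) (l', \<rho>)"
        using a reg by (auto simp: simulates_def nth_list_update simp del: One_nat_def)
      ultimately show ?thesis using pc Dec True by simp
    next
      case False
      then have "ws ! (2 + i) \<noteq> [] \<and> last (ws ! (2 + i)) = 1"
        using reg[OF i] tail_ones_eq_0_iff[of "ws ! (2 + i)"] by auto
      then obtain w where w: "ws ! (2 + i) = w @ [1]" by (metis append_butlast_last_id)
      then have "next_config ws = Some (ws[1 := ws ! 1 @ [2 * l + 1], 2 + i := w])"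
        using a Dec by (simp add: next_config_def)
      moreover have "simulates (ws[1 := ws ! 1 @ [2 * l + 1], 2 + i := w]) (l, \<rho>(i := \<rho> i - 1))"
        using a i reg reg[OF i] unfolding w tail_ones_simps
        by (auto simp: simulates_def nth_list_update simp del: One_nat_def)
      ultimately show ?thesis using pc Dec False by simp
    qed
  qed
qed

lemma simulates_halted: "simulates ws c \<Longrightarrow> length Q \<le> fst c \<Longrightarrow> next_config ws = None"
  by (auto simp: simulates_def next_config_def)

definition input_regs :: "level list \<Rightarrow> nat \<Rightarrow> nat" where
  "input_regs L i = (if claim_input K i = 0 then 0 else numbers L ! (4 * length L - claim_input K i))"

lemma simulates_start:
  assumes "2 \<le> length L"
  shows "simulates (start_config L) (0, input_regs L)"
proof -
  have "tail_ones (unary_blocks (take (4 * length L + 1 - claim_input K i) (numbers L))) =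
      numbers L ! (4 * length L - claim_input K i)" if "claim_input K i \<noteq> 0" for i
  proof -
    have "claim_input K i \<le> 8" by (simp add: claim_input_def)
    then have "4 * length L + 1 - claim_input K i = Suc (4 * length L - claim_input K i)"
      "4 * length L - claim_input K i < length (numbers L)"
      using assms that by auto
    then have "take (4 * length L + 1 - claim_input K i) (numbers L) =
        take (4 * length L - claim_input K i) (numbers L) @ [numbers L ! (4 * length L - claim_input K i)]"
      by (metis take_Suc_conv_app_nth)
    then show ?thesis by (subst tail_ones_unary_blocks) simp_all
  qed
  then show ?thesis
    using elements_length[OF start_config_elements[of L]] start_config_nth[where L = L]
    by (auto simp: simulates_def input_regs_def)
qed

lemma chain_iff:
  assumes "2 \<le> length L"
  shows "chain L i \<noteq> None \<longleftrightarrow> (\<forall>j < i. fst ((machine_step Q ^^ j) (0, input_regs L)) < length Q)"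
proof -
  let ?c = "\<lambda>j. (machine_step Q ^^ j) (0, input_regs L)"
  have 1: "\<exists>c. chain L i = Some c \<and> simulates c (?c i)" if "\<forall>j < i. fst (?c j) < length Q" for i
    using that
  proof (induction i)
    case 0
    then show ?case using assms simulates_start by simp
  next
    case (Suc i)
    then obtain c where c: "chain L i = Some c" "simulates c (?c i)" by auto
    obtain pc \<rho> where "?c i = (pc, \<rho>)" by fastforce
    then show ?case
      using c simulates_step[of c pc \<rho>] Suc.prems by fastforce
  qed
  have 2: "\<forall>j < i. fst (?c j) < length Q" if "chain L i \<noteq> None" for i
    using that
  proof (induction i)
    case (Suc i)
    then have "chain L i \<noteq> None" by (cases "chain L i") auto
    then have alive: "\<forall>j < i. fst (?c j) < length Q" by (rule Suc.IH)
    then obtain c where c: "chain L i = Some c" "simulates c (?c i)" using 1 by blast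
    then have "fst (?c i) < length Q"
      using Suc.prems simulates_halted[OF c(2)] by (cases "fst (?c i) < length Q") auto
    then show ?case using alive less_Suc_eq by auto
  qed simp
  show ?thesis using 1[of i] 2[of i] by blast
qed

lemma input_regs_simps:
  fixes L :: "level list" and x m t0 n0 y m' t n :: nat
  defines "M \<equiv> L @ [(x, m, t0, n0), (y, m', t, n)]"
  shows "input_regs M 0 = y" "input_regs M 1 = x" "\<forall>i. 2 \<le> i \<and> i < K \<longrightarrow> input_regs M i = 0"
    "input_regs M K = x" "input_regs M (K + 1) = y" "input_regs M (K + 2) = m" "input_regs M (K + 3) = m'"
    "input_regs M (K + 4) = t"
  using K unfolding M_def by (auto simp: input_regs_def claim_input_def nth_append)

context
  fixes L :: "level list" and x m t0 n0 y m' t n :: nat and M :: "level list"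
  assumes L: "L \<noteq> []" "last L = (x, m, t0, n0)" and M: "M = L @ [(y, m', t, n)]"
begin

lemma extended_list: "M = butlast L @ [(x, m, t0, n0), (y, m', t, n)]"
  using L M append_butlast_last_id[OF L(1)] by simp

lemmas regs = input_regs_simps[of "butlast L" x m t0 n0 y m' t n, folded extended_list]

lemma length_extended: "2 \<le> length M"
  by (simp add: extended_list)

lemma chain_bomb_iff: "0 < t \<Longrightarrow> chain M i \<noteq> None \<longleftrightarrow> i \<le> t + 1"
  using claim_program_bomb[OF K P_regs refl decides regs] chain_iff[OF length_extended] by blast

lemma chain_2: "chain M 2 \<noteq> None"
  using claim_program_two_steps[OF K P_regs refl decides regs] chain_iff[OF length_extended] by blast

lemma chain_infinite_iff:
  "(\<forall>i. chain M i \<noteq> None) \<longleftrightarrow> t = 0 \<and> (y = x \<and> m' < m \<or> y \<noteq> x \<and> (y, x) \<in> r)"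
proof -
  have inf: "(\<forall>i. chain M i \<noteq> None) \<longleftrightarrow> \<not> halts Q (0, input_regs M)"
    unfolding chain_iff[OF length_extended] halts_def by (meson lessI not_le)
  show ?thesis
  proof (cases "t = 0")
    case True
    then show ?thesis
      using inf halts_claim_program[OF K P_regs refl decides regs] by simp
  next
    case False
    then have "chain M (t + 2) = None" using chain_bomb_iff[of "t + 2"] by simp
    then show ?thesis using False by blast
  qed
qed

end

end

section \<open>Back and forth in the tree of claims\<close>

context claim_tree
begin

definition node_rank :: "level list \<Rightarrow> countable_ordinal \<times> nat" where
  "node_rank L = (case last L of (x, m, t, n) \<Rightarrow> (rk x, m))"

lemma node_rank_snoc: "node_rank (L @ [(x, m, t, n)]) = (rk x, m)"
  by (simp add: node_rank_def)

lemma infinite_child_rank_less: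
  assumes "L \<noteq> []" "\<forall>i. chain (L @ [a]) i \<noteq> None"
  shows "node_rank (L @ [a]) < node_rank L"
proof -
  obtain x m t0 n0 where l: "last L = (x, m, t0, n0)" by (cases "last L") auto
  obtain y m' t n where a: "a = (y, m', t, n)" by (cases a) auto
  have "y = x \<and> m' < m \<or> y \<noteq> x \<and> (y, x) \<in> r"
    using chain_infinite_iff[OF assms(1) l, of "L @ [a]" y m' t n] assms(2) a by blast
  moreover have "rk y < rk x" if "y \<noteq> x" "(y, x) \<in> r"
    using rk[of x] that by blast
  ultimately show ?thesis
    using l a by (auto simp: node_rank_def less_prod_def)
qed

text \<open>If only the second component drops, \<open>y = x\<close> is a correct claim; otherwise
  \<open>rk\<close> supplies a predecessor of \<open>x\<close>. The last number stays free, so there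
  are infinitely many such children.\<close>

lemma infinite_child_exists:
  assumes "L \<noteq> []" "\<sigma> < node_rank L"
  shows "\<exists>y m'. \<sigma> = (rk y, m') \<and> (\<forall>n i. chain (L @ [(y, m', 0, n)]) i \<noteq> None)"
proof -
  obtain x m t0 n0 where l: "last L = (x, m, t0, n0)" by (cases "last L") auto
  obtain \<gamma> m' where \<sigma>: "\<sigma> = (\<gamma>, m')" by (cases \<sigma>) auto
  have lt: "\<gamma> < rk x \<or> \<gamma> = rk x \<and> m' < m"
    using assms(2) l \<sigma> by (auto simp: node_rank_def less_prod_def)
  have "\<exists>y. \<gamma> = rk y \<and> (y = x \<and> m' < m \<or> y \<noteq> x \<and> (y, x) \<in> r)"
  proof (cases "\<gamma> < rk x")
    case True
    then show ?thesis using rk[of x] by blast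
  qed (use lt in auto)
  then obtain y where y: "\<gamma> = rk y" "y = x \<and> m' < m \<or> y \<noteq> x \<and> (y, x) \<in> r" by blast
  have "\<forall>i. chain (L @ [(y, m', 0, n)]) i \<noteq> None" for n
    using chain_infinite_iff[OF assms(1) l refl, of y m' 0 n] y(2) by blast
  then show ?thesis using \<sigma> y(1) by blast
qed

lemma chain_None_mono:
  assumes "chain L i = None" "i \<le> j"
  shows "chain L j = None"
  using assms(2) by (induction j rule: dec_induct) (use assms(1) in auto)

text \<open>A finite chain carries no information beyond its length, and a positive \<open>t\<close>
  reproduces this length under any other nonempty node.\<close>

lemma finite_chain_bomb:
  assumes "L \<noteq> []" "M \<noteq> []" "\<not> (\<forall>i. chain (L @ [a]) i \<noteq> None)"
  shows "\<exists>t. \<forall>y m' n i. chain (L @ [a]) i = None \<longleftrightarrow> chain (M @ [(y, m', t, n)]) i = None"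
proof -
  obtain x m t0 n0 where l: "last L = (x, m, t0, n0)" by (cases "last L") auto
  obtain x1 m1 t1 n1 where l1: "last M = (x1, m1, t1, n1)" by (cases "last M") auto
  obtain y m' t n where a: "a = (y, m', t, n)" by (cases a) auto
  define k where "k = (LEAST i. chain (L @ [a]) i = None)"
  obtain j where j: "chain (L @ [a]) j = None" using assms(3) by blast
  have k: "chain (L @ [a]) k = None"
    unfolding k_def by (rule LeastI[where P = "\<lambda>i. chain (L @ [a]) i = None", OF j])
  have iff: "chain (L @ [a]) i = None \<longleftrightarrow> k \<le> i" for i
    using chain_None_mono[OF k, of i] Least_le[of "\<lambda>i. chain (L @ [a]) i = None" i] by (auto simp: k_def)
  \<comment> \<open>The first missing index \<open>k\<close> is therefore at least 3, and
    \<open>t = k - 2\<close> is positive; the chain for this \<open>t\<close> has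
    \<open>t + 1 = k - 1\<close> as its last index.\<close>
  have "chain (L @ [a]) 2 \<noteq> None"
    using chain_2[OF assms(1) l refl] a by blast
  then have "\<not> k \<le> 2" using iff[of 2] by simp
  then have "0 < k - 2" "k - 2 + 2 = k" by auto
  moreover have "chain (M @ [(y, m', k - 2, n)]) i \<noteq> None \<longleftrightarrow> i \<le> k - 2 + 1" for y m' n i
    using chain_bomb_iff[OF assms(2) l1 refl] calculation(1) by blast
  ultimately have "chain (M @ [(y, m', k - 2, n)]) i = None \<longleftrightarrow> k \<le> i" for y m' n i
    by (metis Suc_eq_plus1 add_2_eq_Suc' not_less_eq_eq)
  then have "chain (L @ [a]) i = None \<longleftrightarrow> chain (M @ [(y, m', k - 2, n)]) i = None" for y m' n i
    using iff[of i] by simp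
  then show ?thesis by (intro exI[of _ "k - 2"] allI)
qed

section \<open>Partial isomorphisms of the tree\<close>

definition similar :: "countable_ordinal \<times> nat \<Rightarrow> level list \<Rightarrow> level list \<Rightarrow> bool" where
  "similar \<theta> L M \<longleftrightarrow> length L = length M \<and> (\<forall>i. chain L i = None \<longleftrightarrow> chain M i = None) \<and>
     (L \<noteq> [] \<longrightarrow> min (node_rank L) \<theta> = min (node_rank M) \<theta>)"

lemma similar_chain: "similar \<theta> L M \<Longrightarrow> chain L i = None \<longleftrightarrow> chain M i = None"
  by (simp add: similar_def)

text \<open>Ranks only matter below the threshold \<open>\<theta>\<close>, which decreases by one with every node that is added.\<close>

definition partial_iso :: "countable_ordinal \<times> nat \<Rightarrow> (level list \<times> level list) set \<Rightarrow> bool" where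
  "partial_iso \<theta> p \<longleftrightarrow> finite p \<and> ([], []) \<in> p \<and>
     (\<forall>L M. (L, M) \<in> p \<longrightarrow> similar \<theta> L M \<and> (L \<noteq> [] \<longrightarrow> (butlast L, butlast M) \<in> p)) \<and>
     (\<forall>L M L' M'. (L, M) \<in> p \<longrightarrow> (L', M') \<in> p \<longrightarrow> (L = L' \<longleftrightarrow> M = M'))"

lemma partial_isoD:
  assumes "partial_iso \<theta> p"
  shows "finite p" "([], []) \<in> p"
    "\<And>L M. (L, M) \<in> p \<Longrightarrow> similar \<theta> L M"
    "\<And>L M. (L, M) \<in> p \<Longrightarrow> L \<noteq> [] \<Longrightarrow> (butlast L, butlast M) \<in> p"
    "\<And>L M L' M'. (L, M) \<in> p \<Longrightarrow> (L', M') \<in> p \<Longrightarrow> L = L' \<longleftrightarrow> M = M'"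
  using assms unfolding partial_iso_def by blast+

lemma similar_sym: "similar \<theta> L M \<Longrightarrow> similar \<theta> M L"
  by (auto simp: similar_def)

lemma partial_iso_converse:
  assumes "partial_iso \<theta> p"
  shows "partial_iso \<theta> (p\<inverse>)"
  unfolding partial_iso_def
proof (intro conjI allI impI)
  fix L M assume LM: "(L, M) \<in> p\<inverse>"
  then have sim: "similar \<theta> M L" using partial_isoD(3)[OF assms] by simp
  then show "similar \<theta> L M" by (rule similar_sym)
  assume "L \<noteq> []"
  then have "M \<noteq> []" using sim by (auto simp: similar_def)
  then show "(butlast L, butlast M) \<in> p\<inverse>" using partial_isoD(4)[OF assms] LM by simp
qed (use partial_isoD[OF assms] in auto)

lemma partial_iso_mono:
  assumes "partial_iso \<theta> p" "\<theta>' \<le> \<theta>"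
  shows "partial_iso \<theta>' p"
proof -
  have "similar \<theta>' L M" if "similar \<theta> L M" for L M
  proof -
    have "min (node_rank L) \<theta>' = min (node_rank M) \<theta>'" if "L \<noteq> []"
    proof -
      have "min (min (node_rank L) \<theta>) \<theta>' = min (min (node_rank M) \<theta>) \<theta>'"
        using \<open>similar \<theta> L M\<close> that by (simp add: similar_def)
      then show ?thesis using assms(2) by (simp add: min.assoc min.absorb2)
    qed
    then show ?thesis using that by (simp add: similar_def)
  qed
  then show ?thesis using assms(1) unfolding partial_iso_def by blast
qed

text \<open>A correct child of rank \<sigma> is answered by a correct child of rank
  \<open>min \<sigma> (\<gamma>, n)\<close>, an incorrect one by a child whose \<open>t\<close>
  gives the same chain length. The last number \<open>c\<close> remains free for
  injectivity.\<close>

lemma similar_child_exists: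
  assumes sim: "similar (\<gamma>, Suc n) L M"
  shows "\<exists>y m' t. \<forall>c. similar (\<gamma>, n) (L @ [a]) (M @ [(y, m', t, c)])"
proof -
  obtain x m t c where a: "a = (x, m, t, c)" by (cases a) auto
  have len: "length L = length M" using sim by (simp add: similar_def)
  show ?thesis
  proof (cases "L = []")
    case True
    \<comment> \<open>Nodes with one level have no chain, so below the root the level can be
      copied.\<close>
    have "chain [b] i = None" for b i
      using chain_None_mono[of "[b]" 0 i] by simp
    then have "similar (\<gamma>, n) (L @ [a]) (M @ [(x, m, t, c')])" for c'
      using True len by (simp add: similar_def a node_rank_def)
    then show ?thesis by blast
  next
    case L: False
    then have M: "M \<noteq> []" using len by auto
    show ?thesis
    proof (cases "\<forall>i. chain (L @ [a]) i \<noteq> None")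
      case True
      let ?\<sigma> = "node_rank (L @ [a])"
      define \<tau> where "\<tau> = min ?\<sigma> (\<gamma>, n)"
      have lt: "?\<sigma> < node_rank L" using infinite_child_rank_less[OF L True] .
      have eq: "min (node_rank L) (\<gamma>, Suc n) = min (node_rank M) (\<gamma>, Suc n)"
        using sim L by (simp add: similar_def)
      \<comment> \<open>Otherwise \<open>M\<close> would have a rank below the old threshold, hence
        the same rank as \<open>L\<close>, and this rank would be at most that of the child of
        \<open>L\<close>.\<close>
      have "\<tau> < node_rank M"
      proof (rule ccontr)
        assume "\<not> \<tau> < node_rank M"
        then have le: "node_rank M \<le> \<tau>" by simp
        have "\<tau> < (\<gamma>, Suc n)"
          unfolding \<tau>_def by (rule le_less_trans[OF min.cobounded2]) (simp add: less_prod_def)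
        with le have "node_rank M < (\<gamma>, Suc n)" by (rule le_less_trans)
        then have "min (node_rank L) (\<gamma>, Suc n) = node_rank M"
          using eq by (simp add: min.absorb1 less_imp_le)
        then have "node_rank L = node_rank M"
          using \<open>node_rank M < (\<gamma>, Suc n)\<close> by (metis min_def order_less_irrefl)
        then have "node_rank L \<le> ?\<sigma>" using le by (simp add: \<tau>_def)
        then show False using lt by simp
      qed
      then obtain y m' where y: "\<tau> = (rk y, m')" "\<forall>c i. chain (M @ [(y, m', 0, c)]) i \<noteq> None"
        using infinite_child_exists[OF M] by blast
      have "similar (\<gamma>, n) (L @ [a]) (M @ [(y, m', 0, c)])" for c
      proof -
        have "chain (L @ [a]) i = None \<longleftrightarrow> chain (M @ [(y, m', 0, c)]) i = None" for i
          using True[rule_format, of i] y(2)[rule_format, of c i] by blast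
        moreover have "node_rank (M @ [(y, m', 0, c)]) = \<tau>" using y(1) by (simp add: node_rank_snoc)
        ultimately show ?thesis using len by (simp add: similar_def \<tau>_def)
      qed
      then show ?thesis by blast
    next
      case False
      then obtain t' where "\<forall>y m' n i. chain (L @ [a]) i = None \<longleftrightarrow> chain (M @ [(y, m', t', n)]) i = None"
        using finite_chain_bomb[OF L M] by blast
      then have "similar (\<gamma>, n) (L @ [a]) (M @ [(x, m, t', c)])" for c
        using len by (simp add: similar_def a node_rank_snoc)
      then show ?thesis by blast
    qed
  qed
qed

lemma partial_iso_extend_child:
  assumes p: "partial_iso (\<gamma>, Suc n) p" and LM: "(L, M) \<in> p"
  shows "\<exists>p' M'. p \<subseteq> p' \<and> partial_iso (\<gamma>, n) p' \<and> (L @ [a], M') \<in> p'"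
proof -
  have p': "partial_iso (\<gamma>, n) p"
    using partial_iso_mono[OF p, of "(\<gamma>, n)"] by (simp add: less_eq_prod_def)
  show ?thesis
  proof (cases "\<exists>M'. (L @ [a], M') \<in> p")
    case True
    then show ?thesis using p' by blast
  next
    case False
    obtain y m' t where sim: "\<And>c. similar (\<gamma>, n) (L @ [a]) (M @ [(y, m', t, c)])"
      using similar_child_exists[OF partial_isoD(3)[OF p LM]] by blast
    \<comment> \<open>Infinitely many answers differ only in \<open>c\<close>; one of them is not in
      use yet, which keeps the map injective.\<close>
    have "finite (Range p)" using partial_isoD(1)[OF p] by (rule finite_Range)
    moreover have "inj (\<lambda>c. M @ [(y, m', t, c)])" by (auto simp: inj_def)
    then have "infinite (range (\<lambda>c. M @ [(y, m', t, c)]))" by (rule range_inj_infinite)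
    ultimately have "\<not> range (\<lambda>c. M @ [(y, m', t, c)]) \<subseteq> Range p"
      using finite_subset by blast
    then obtain c where c: "M @ [(y, m', t, c)] \<notin> Range p" by blast
    let ?M = "M @ [(y, m', t, c)]"
    let ?p = "insert (L @ [a], ?M) p"
    have "partial_iso (\<gamma>, n) ?p"
      unfolding partial_iso_def
    proof (intro conjI allI impI)
      show "finite ?p" "([], []) \<in> ?p" using partial_isoD[OF p'] by auto
      fix L1 M1 assume 1: "(L1, M1) \<in> ?p"
      show "similar (\<gamma>, n) L1 M1" using 1 sim partial_isoD(3)[OF p'] by auto
      show "(butlast L1, butlast M1) \<in> ?p" if "L1 \<noteq> []"
        using 1 LM partial_isoD(4)[OF p' _ that] by auto
      fix L2 M2 assume 2: "(L2, M2) \<in> ?p"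
      show "L1 = L2 \<longleftrightarrow> M1 = M2"
        using 1 2 False c partial_isoD(5)[OF p', of L1 M1 L2 M2] by auto
    qed
    then show ?thesis by blast
  qed
qed

lemma partial_iso_extend_list:
  assumes "partial_iso (\<gamma>, n + length L) p"
  shows "\<exists>p' M. p \<subseteq> p' \<and> partial_iso (\<gamma>, n) p' \<and> (L, M) \<in> p'"
  using assms
proof (induction L arbitrary: n rule: rev_induct)
  case Nil
  then have "partial_iso (\<gamma>, n) p" by simp
  then show ?case using partial_isoD(2) by blast
next
  case (snoc a L)
  then have "partial_iso (\<gamma>, Suc n + length L) p" by simp
  from snoc.IH[OF this] obtain p' M where p': "p \<subseteq> p'" "partial_iso (\<gamma>, Suc n) p'" "(L, M) \<in> p'"
    by blast
  from partial_iso_extend_child[OF p'(2,3), of a] obtain p'' M' where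
    "p' \<subseteq> p''" "partial_iso (\<gamma>, n) p''" "(L @ [a], M') \<in> p''" by blast
  with p'(1) show ?case by blast
qed

section \<open>Lifting partial isomorphisms to all elements\<close>

definition legitimate :: "nat list list \<Rightarrow> bool" where
  "legitimate c \<longleftrightarrow> (\<exists>L. c = vertex L) \<or> (\<exists>L i. chain L i = Some c)"

text \<open>Junk may be fixed pointwise because no relation joins a legitimate element with an
  illegitimate one. Besides detached configurations it contains vertices whose word does not encode
  levels.\<close>

inductive lifted :: "(level list \<times> level list) set \<Rightarrow> nat list list \<Rightarrow> nat list list \<Rightarrow> bool" for p where
  vertex: "(L, M) \<in> p \<Longrightarrow> lifted p (vertex L) (vertex M)"
| chain: "(L, M) \<in> p \<Longrightarrow> chain L i = Some c \<Longrightarrow> chain M i = Some d \<Longrightarrow> lifted p c d"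
| junk: "c \<in> elements \<Longrightarrow> \<not> legitimate c \<Longrightarrow> lifted p c c"

lemma lifted_elements: "lifted p c d \<Longrightarrow> c \<in> elements \<and> d \<in> elements"
  by (induction rule: lifted.induct) (use vertex_elements chain_Some in auto)

lemma lifted_mono: "lifted p c d \<Longrightarrow> p \<subseteq> p' \<Longrightarrow> lifted p' c d"
  by (induction rule: lifted.induct) (auto intro: lifted.intros)

lemma lifted_converse: "lifted (p\<inverse>) d c \<longleftrightarrow> lifted p c d"
proof -
  have "lifted (q\<inverse>) d c" if "lifted q c d" for q c d
    using that by (induction rule: lifted.induct) (auto intro: lifted.intros)
  from this[of p c d] this[of "p\<inverse>" d c] show ?thesis by auto
qed

lemma lifted_vertexD: "lifted p (vertex L) d \<Longrightarrow> \<exists>M. (L, M) \<in> p \<and> d = vertex M"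
  by (erule lifted.cases) (auto dest: vertex_inject vertex_neq_chain simp: legitimate_def)

lemma lifted_chainD:
  assumes "lifted p c d" "chain L i = Some c"
  shows "\<exists>M. (L, M) \<in> p \<and> chain M i = Some d"
  using assms(1)
proof cases
  case (vertex L' M)
  then show ?thesis using vertex_neq_chain[OF assms(2)] by blast
next
  case (chain L' M j)
  then show ?thesis using chain_inject[OF assms(2) chain(2)] by blast
next
  case junk
  then show ?thesis using assms(2) by (auto simp: legitimate_def)
qed

lemma lifted_junkD: "lifted p c d \<Longrightarrow> \<not> legitimate c \<Longrightarrow> d = c"
  by (erule lifted.cases) (auto simp: legitimate_def)

lemma legitimate_cases:
  obtains (vertex) L where "c = vertex L" | (chain) L i where "chain L i = Some c" | (junk) "\<not> legitimate c"
  unfolding legitimate_def by blast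

context
  fixes \<theta> p
  assumes p: "partial_iso \<theta> p"
begin

lemma lifted_eq:
  assumes "lifted p a a'" "lifted p a b'"
  shows "a' = b'"
proof (cases a rule: legitimate_cases)
  case (vertex L)
  then show ?thesis
    using lifted_vertexD assms partial_isoD(5)[OF p] by metis
next
  case (chain L i)
  then show ?thesis
    using lifted_chainD[OF assms(1) chain] lifted_chainD[OF assms(2) chain] partial_isoD(5)[OF p]
    by (metis option.inject)
next
  case junk
  then show ?thesis using lifted_junkD assms by metis
qed

lemma lifted_child:
  assumes a: "lifted p a a'" and b: "lifted p b b'" and ab: "child a b"
  shows "child a' b'"
proof (cases a rule: legitimate_cases)
  case (vertex L)
  obtain x where x: "b = vertex (L @ [x])"
    using child_vertexD ab vertex lifted_elements[OF b] by blast
  obtain M where M: "(L, M) \<in> p" "a' = vertex M" using lifted_vertexD a vertex by blast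
  obtain N where N: "(L @ [x], N) \<in> p" "b' = vertex N" using lifted_vertexD b x by blast
  have "(L, butlast N) \<in> p" using partial_isoD(4)[OF p N(1)] by simp
  then have "butlast N = M" using partial_isoD(5)[OF p M(1)] by blast
  moreover have "N \<noteq> []" using partial_isoD(3)[OF p N(1)] by (auto simp: similar_def)
  ultimately have "N = M @ [last N]" by (metis append_butlast_last_id)
  then show ?thesis using child_vertexI M(2) N(2) by metis
next
  case (chain L i)
  then show ?thesis using ab chain_not_vertex by (auto simp: child_def)
next
  case junk
  have "\<not> legitimate b"
  proof
    assume "legitimate b"
    then consider L where "b = vertex L" | L i where "chain L i = Some b" by (auto simp: legitimate_def)
    then show False
    proof cases
      case 1
      then show False
        using child_vertex_rightD ab lifted_elements[OF a] junk by (auto simp: legitimate_def)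
    next
      case 2
      then show False using ab chain_not_vertex by (auto simp: child_def)
    qed
  qed
  then show ?thesis using junk lifted_junkD a b ab by blast
qed

lemma lifted_initial:
  assumes a: "lifted p a a'" and b: "lifted p b b'" and ab: "initial a b"
  shows "initial a' b'"
proof (cases a rule: legitimate_cases)
  case (vertex L)
  have c: "chain L 0 = Some b"
    using initial_iff ab vertex lifted_elements[OF b] by blast
  obtain M where M: "(L, M) \<in> p" "a' = vertex M" using lifted_vertexD a vertex by blast
  obtain N where N: "(L, N) \<in> p" "chain N 0 = Some b'" using lifted_chainD[OF b c] by blast
  have "N = M" using partial_isoD(5)[OF p M(1) N(1)] by blast
  then show ?thesis using initial_iff lifted_elements[OF b] M(2) N(2) by blast
next
  case (chain L i)
  then show ?thesis using ab chain_not_vertex by (auto simp: initial_def)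
next
  case junk
  have "\<not> legitimate b"
  proof
    assume "legitimate b"
    then consider L where "b = vertex L" | L i where "chain L i = Some b" by (auto simp: legitimate_def)
    then show False
    proof cases
      case 1
      then show False using ab vertex_nth(3) by (auto simp: initial_def)
    next
      case 2
      then have "a ! 0 = unary_blocks (numbers L)" "is_vertex a"
        using ab chain_Some[OF 2] by (auto simp: initial_def)
      then have "a = vertex L" using vertex_eqI lifted_elements[OF a] by blast
      then show False using junk by (auto simp: legitimate_def)
    qed
  qed
  then show ?thesis using junk lifted_junkD a b ab by blast
qed

lemma lifted_step_rel:
  assumes a: "lifted p a a'" and b: "lifted p b b'" and ab: "step_rel a b"
  shows "step_rel a' b'"
proof (cases a rule: legitimate_cases)
  case (vertex L)
  then show ?thesis using ab vertex_nth(3)[of L] by (simp add: step_rel_def next_config_def)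
next
  case (chain L i)
  have c: "chain L (Suc i) = Some b" using chain ab by (simp add: step_rel_def)
  obtain M where M: "(L, M) \<in> p" "chain M i = Some a'" using lifted_chainD[OF a chain] by blast
  obtain N where N: "(L, N) \<in> p" "chain N (Suc i) = Some b'" using lifted_chainD[OF b c] by blast
  have "N = M" using partial_isoD(5)[OF p M(1) N(1)] by blast
  then show ?thesis using M(2) N(2) by (simp add: step_rel_def)
next
  case junk
  have len: "length a = K + 5 + 2" using elements_length lifted_elements[OF a] by blast
  have "\<not> legitimate b"
  proof
    assume "legitimate b"
    then consider L where "b = vertex L" | L i where "chain L i = Some b" by (auto simp: legitimate_def)
    then show False
    proof cases
      case 1
      then show False using step_rel_length[OF ab len] vertex_nth(3)[of L] by simp
    next
      case 2
      \<comment> \<open>The first link has a history of length 1 and hence no predecessor; a later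
        link has the preceding link as its only predecessor.\<close>
      show False
      proof (cases i)
        case 0
        then show False using step_rel_length[OF ab len] chain_Some[OF 2] by simp
      next
        case (Suc j)
        then obtain c where c: "chain L j = Some c" "step_rel c b"
          using 2 by (auto simp: step_rel_def bind_eq_Some_conv)
        then have "c = a"
          using step_rel_inject[OF c(2) ab _ len] chain_Some[OF c(1)] elements_length by blast
        then show False using junk c(1) by (auto simp: legitimate_def)
      qed
    qed
  qed
  then show ?thesis using junk lifted_junkD a b ab by blast
qed

lemma lifted_relation: "lifted p a a' \<Longrightarrow> lifted p b b' \<Longrightarrow> relation s a b \<Longrightarrow> relation s a' b'"
  using lifted_child lifted_initial lifted_step_rel by (simp add: relation_def split: if_splits)

end

section \<open>Scott equivalence from partial isomorphisms\<close>

lemma lifted_same_qf: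
  assumes p: "partial_iso \<theta> p" and xy: "list_all2 (lifted p) xs ys"
  shows "same_qf tuple_struct xs ys"
  unfolding same_qf_def
proof (intro allI impI)
  fix \<phi> assume "wf_qf (vocab tuple_struct) (length xs) \<phi>"
  then show "sat tuple_struct xs \<phi> \<longleftrightarrow> sat tuple_struct ys \<phi>"
  proof (induction \<phi>)
    case (Equal i j)
    then have ij: "lifted p (xs ! i) (ys ! i)" "lifted p (xs ! j) (ys ! j)"
      using xy by (auto simp: list_all2_conv_all_nth)
    then have ij': "lifted (p\<inverse>) (ys ! i) (xs ! i)" "lifted (p\<inverse>) (ys ! j) (xs ! j)"
      using lifted_converse by blast+
    have "xs ! i = xs ! j \<Longrightarrow> ys ! i = ys ! j" using lifted_eq[OF p] ij by metis
    moreover have "ys ! i = ys ! j \<Longrightarrow> xs ! i = xs ! j"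
      using lifted_eq[OF partial_iso_converse[OF p]] ij' by metis
    ultimately show ?case by auto
  next
    case (Atom s "is")
    then have "length is = 2" using vocab_cases by simp
    then obtain i j where "is": "is = [i, j]" by (auto simp: length_Suc_conv numeral_2_eq_2)
    then have ij: "lifted p (xs ! i) (ys ! i)" "lifted p (xs ! j) (ys ! j)"
      using xy Atom by (auto simp: list_all2_conv_all_nth)
    then have ij': "lifted (p\<inverse>) (ys ! i) (xs ! i)" "lifted (p\<inverse>) (ys ! j) (xs ! j)"
      using lifted_converse by blast+
    have "relation s (xs ! i) (xs ! j) \<longleftrightarrow> relation s (ys ! i) (ys ! j)"
      using lifted_relation[OF p ij] lifted_relation[OF partial_iso_converse[OF p] ij'] by blast
    then show ?case
      using lifted_elements[OF ij(1)] lifted_elements[OF ij(2)] by (simp add: tuple_struct_def "is")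
  qed auto
qed

text \<open>The allowance \<open>m\<close> depends on \<open>cs\<close> alone, so a threshold can be
  chosen to match the move. A configuration is reached through its node, and similarity provides the
  same link of the chain on the other side.\<close>

lemma lifted_extend:
  assumes "cs \<in> tuples tuple_struct"
  shows "\<exists>m. \<forall>n p. partial_iso (\<gamma>, n + m) p \<longrightarrow>
    (\<exists>p' ds. p \<subseteq> p' \<and> partial_iso (\<gamma>, n) p' \<and> list_all2 (lifted p') cs ds)"
  using assms
proof (induction cs)
  case Nil
  show ?case by (intro exI[of _ 0] allI impI exI[of _ "[]"]) auto
next
  case (Cons c cs)
  then obtain m where m: "\<And>n p. partial_iso (\<gamma>, n + m) p \<Longrightarrow>
      \<exists>p' ds. p \<subseteq> p' \<and> partial_iso (\<gamma>, n) p' \<and> list_all2 (lifted p') cs ds"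
    by (auto simp: tuples_def)
  have c: "c \<in> elements" using Cons.prems by (auto simp: tuples_def tuple_struct_def)
  have "\<exists>k. \<forall>n p. partial_iso (\<gamma>, n + k) p \<longrightarrow> (\<exists>p' d. p \<subseteq> p' \<and> partial_iso (\<gamma>, n) p' \<and> lifted p' c d)"
  proof (cases c rule: legitimate_cases)
    case (vertex L)
    have "\<exists>p' d. p \<subseteq> p' \<and> partial_iso (\<gamma>, n) p' \<and> lifted p' c d" if p: "partial_iso (\<gamma>, n + length L) p" for n p
    proof -
      obtain p' M where "p \<subseteq> p'" "partial_iso (\<gamma>, n) p'" "(L, M) \<in> p'"
        using partial_iso_extend_list[OF p] by blast
      then show ?thesis using lifted.vertex vertex by blast
    qed
    then show ?thesis by blast
  next
    case (chain L i)
    have "\<exists>p' d. p \<subseteq> p' \<and> partial_iso (\<gamma>, n) p' \<and> lifted p' c d" if p: "partial_iso (\<gamma>, n + length L) p" for n p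
    proof -
      obtain p' M where p': "p \<subseteq> p'" "partial_iso (\<gamma>, n) p'" "(L, M) \<in> p'"
        using partial_iso_extend_list[OF p] by blast
      then have "chain L i = None \<longleftrightarrow> chain M i = None"
        by (intro similar_chain[of "(\<gamma>, n)"] partial_isoD(3)[of "(\<gamma>, n)" p'])
      then obtain d where "chain M i = Some d" using chain by auto
      then show ?thesis using lifted.chain[OF p'(3) chain] p' by blast
    qed
    then show ?thesis by blast
  next
    case junk
    then show ?thesis using lifted.junk[OF c junk] by (intro exI[of _ 0]) auto
  qed
  then obtain k where k: "\<And>n p. partial_iso (\<gamma>, n + k) p \<Longrightarrow>
      \<exists>p' d. p \<subseteq> p' \<and> partial_iso (\<gamma>, n) p' \<and> lifted p' c d" by blast
  show ?case
  proof (intro exI[of _ "m + k"] allI impI)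
    fix n p assume "partial_iso (\<gamma>, n + (m + k)) p"
    then have "partial_iso (\<gamma>, (n + m) + k) p" by (simp add: add.assoc)
    from k[OF this] obtain p1 d where 1: "p \<subseteq> p1" "partial_iso (\<gamma>, n + m) p1" "lifted p1 c d" by blast
    from m[OF 1(2)] obtain p2 ds where 2: "p1 \<subseteq> p2" "partial_iso (\<gamma>, n) p2" "list_all2 (lifted p2) cs ds"
      by blast
    show "\<exists>p' ds. p \<subseteq> p' \<and> partial_iso (\<gamma>, n) p' \<and> list_all2 (lifted p') (c # cs) ds"
      using 1 2 lifted_mono[OF 1(3) 2(1)] by (intro exI[of _ p2] exI[of _ "d # ds"]) auto
  qed
qed

lemma lifted_tuples: "list_all2 (lifted p) cs ds \<Longrightarrow> ds \<in> tuples tuple_struct"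
  by (induction rule: list_all2_induct) (auto simp: tuples_def tuple_struct_def dest: lifted_elements)

lemma partial_iso_scott_equiv:
  "partial_iso (\<beta>, 0) p \<Longrightarrow> list_all2 (lifted p) xs ys \<Longrightarrow> scott_equiv tuple_struct \<beta> xs ys"
proof (induction \<beta> arbitrary: p xs ys rule: less_induct)
  case (less \<beta>)
  show ?case
  proof (cases "\<beta> = 0")
    case True
    then show ?thesis using less.prems lifted_same_qf by (simp add: scott_equiv_0)
  next
    case False
    have ext: "\<exists>p' ds. p \<subseteq> p' \<and> partial_iso (\<gamma>, 0) p' \<and> list_all2 (lifted p') cs ds"
      if \<gamma>: "\<gamma> < \<beta>" and cs: "cs \<in> tuples tuple_struct" and p: "partial_iso (\<beta>, 0) p" for \<gamma> cs p
    proof -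
      obtain m where m: "\<And>n p. partial_iso (\<gamma>, n + m) p \<Longrightarrow>
          \<exists>p' ds. p \<subseteq> p' \<and> partial_iso (\<gamma>, n) p' \<and> list_all2 (lifted p') cs ds"
        using lifted_extend[OF cs] by blast
      \<comment> \<open>As \<gamma> < \<beta>, the pair \<open>(\<gamma>, m)\<close> lies below
        \<open>(\<beta>, 0)\<close> for every \<open>m\<close>: here the second component pays for
        the move.\<close>
      have "partial_iso (\<gamma>, 0 + m) p"
        using partial_iso_mono[OF p] \<gamma> by (simp add: less_eq_prod_def)
      then show ?thesis by (rule m)
    qed
    show ?thesis
      unfolding scott_equiv.simps[of tuple_struct \<beta>] if_not_P[OF False]
    proof (intro allI impI conjI ballI)
      fix \<gamma> cs assume \<gamma>: "\<gamma> < \<beta>" and cs: "cs \<in> tuples tuple_struct"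
      obtain p' ds where p': "p \<subseteq> p'" "partial_iso (\<gamma>, 0) p'" "list_all2 (lifted p') cs ds"
        using ext[OF \<gamma> cs less.prems(1)] by blast
      have "list_all2 (lifted p') xs ys"
        using less.prems(2) lifted_mono[OF _ p'(1)] by (rule list_all2_mono)
      then have "scott_equiv tuple_struct \<gamma> (xs @ cs) (ys @ ds)"
        using p'(3) by (intro less.IH[OF \<gamma> p'(2)] list_all2_appendI)
      then show "\<exists>ds \<in> tuples tuple_struct. length ds = length cs \<and> scott_equiv tuple_struct \<gamma> (xs @ cs) (ys @ ds)"
        using lifted_tuples[OF p'(3)] list_all2_lengthD[OF p'(3)] by auto
    next
      \<comment> \<open>The other direction is the same argument for the inverse map.\<close>
      fix \<gamma> ds assume \<gamma>: "\<gamma> < \<beta>" and ds: "ds \<in> tuples tuple_struct"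
      obtain p' cs where p': "p\<inverse> \<subseteq> p'" "partial_iso (\<gamma>, 0) p'" "list_all2 (lifted p') ds cs"
        using ext[OF \<gamma> ds partial_iso_converse[OF less.prems(1)]] by blast
      have conv: "list_all2 (lifted (p'\<inverse>)) cs ds"
        using p'(3) lifted_converse[of p'] by (simp add: list_all2_conv_all_nth)
      have "p \<subseteq> p'\<inverse>" using p'(1) by auto
      then have "list_all2 (lifted (p'\<inverse>)) xs ys"
        using less.prems(2) lifted_mono by (auto elim!: list_all2_mono)
      then have "scott_equiv tuple_struct \<gamma> (xs @ cs) (ys @ ds)"
        using conv by (intro less.IH[OF \<gamma> partial_iso_converse[OF p'(2)]] list_all2_appendI)
      then show "\<exists>cs \<in> tuples tuple_struct. length cs = length ds \<and> scott_equiv tuple_struct \<gamma> (xs @ cs) (ys @ ds)"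
        using lifted_tuples[OF p'(3)] list_all2_lengthD[OF p'(3)] by auto
    qed
  qed
qed

section \<open>Automorphisms preserve ranks\<close>

context
  fixes f
  assumes f: "is_iso f tuple_struct tuple_struct"
begin

lemma automorphism_elements: "a \<in> elements \<Longrightarrow> f a \<in> elements"
  using f by (auto simp: is_iso_def bij_betw_def tuple_struct_def)

lemma automorphism_relation:
  assumes "a \<in> elements" "b \<in> elements" "s < 3"
  shows "relation s (f a) (f b) \<longleftrightarrow> relation s a b"
proof -
  have s: "s < length (vocab tuple_struct)" using assms(3) by (simp add: tuple_struct_def)
  have "[a, b] \<in> tuples tuple_struct" using assms by (simp add: tuples_def tuple_struct_def)
  moreover have "length [a, b] = vocab tuple_struct ! s" using vocab_cases[OF s] by simp
  ultimately have "[a, b] \<in> rel tuple_struct s \<longleftrightarrow> map f [a, b] \<in> rel tuple_struct s"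
    using f s unfolding is_iso_def by blast
  then show ?thesis
    using assms automorphism_elements by (simp add: tuple_struct_def)
qed

text \<open>A chain is determined by its node through the relations: its first link is the only
  element that \<open>initial\<close> relates to the node, and each further link is the only
  successor.\<close>

lemma automorphism_chain:
  assumes "f (vertex L) = vertex M"
  shows "chain L i = Some c \<Longrightarrow> chain M i = Some (f c)"
proof (induction i arbitrary: c)
  case 0
  have c: "c \<in> elements" using chain_Some[OF 0] by blast
  then have "initial (vertex L) c" using initial_iff 0 by blast
  then have "initial (vertex M) (f c)"
    using automorphism_relation[OF vertex_elements c, of 1 L] assms by (simp add: relation_def)
  then show ?case using initial_iff automorphism_elements[OF c] by blast
next
  case (Suc i)
  then obtain c' where c': "chain L i = Some c'" "step_rel c' c"
    by (auto simp: step_rel_def bind_eq_Some_conv)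
  have "c' \<in> elements" "c \<in> elements" using chain_Some[OF c'(1)] chain_Some[OF Suc.prems] by auto
  then have "step_rel (f c') (f c)"
    using automorphism_relation[of c' c 2] c'(2) by (simp add: relation_def)
  then show ?case using Suc.IH[OF c'(1)] by (simp add: step_rel_def)
qed

text \<open>If \<open>M\<close> had smaller rank, \<open>L\<close> would have a child with an
  infinite chain and exactly the rank of \<open>M\<close>. Its image is a child of \<open>M\<close>
  with an infinite chain, hence of rank below \<open>M\<close>, but by induction of rank at least
  that of \<open>M\<close>.\<close>

lemma automorphism_rank:
  "f (vertex L) = vertex M \<Longrightarrow> L \<noteq> [] \<Longrightarrow> M \<noteq> [] \<Longrightarrow> node_rank L \<le> node_rank M"
proof (induction "node_rank L" arbitrary: L M rule: less_induct)
  case less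
  show ?case
  proof (rule ccontr)
    assume "\<not> node_rank L \<le> node_rank M"
    then have lt: "node_rank M < node_rank L" by simp
    obtain y m' where y: "node_rank M = (rk y, m')" "\<forall>i. chain (L @ [(y, m', 0, 0)]) i \<noteq> None"
      using infinite_child_exists[OF less.prems(2) lt] by blast
    let ?L = "L @ [(y, m', 0, 0)]"
    have rank: "node_rank ?L = node_rank M" using y(1) by (simp add: node_rank_snoc)
    have "child (vertex M) (f (vertex ?L))"
      using automorphism_relation[OF vertex_elements vertex_elements, of 0 L ?L] child_vertexI less.prems(1)
      by (simp add: relation_def)
    then obtain a where a: "f (vertex ?L) = vertex (M @ [a])"
      using child_vertexD automorphism_elements[OF vertex_elements] by blast
    have "\<forall>i. chain (M @ [a]) i \<noteq> None"
      using automorphism_chain[OF a] y(2) by (metis not_None_eq)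
    then have "node_rank (M @ [a]) < node_rank M"
      by (rule infinite_child_rank_less[OF less.prems(3)])
    moreover have "node_rank ?L \<le> node_rank (M @ [a])"
      using less.hyps[of ?L "M @ [a]"] a lt rank by simp
    ultimately show False using rank by simp
  qed
qed

end

lemma scott_rank_ge:
  assumes surj: "\<And>\<beta>. \<beta> < \<alpha> \<Longrightarrow> \<exists>x. rk x = \<beta>"
  shows "\<alpha> \<le> scott_rank word_struct"
proof (rule le_scott_rankI)
  fix \<beta> assume \<beta>: "\<beta> < \<alpha>"
  then obtain x where x: "rk x = \<beta>" using surj by blast
  let ?e = "\<lambda>x. [vertex [(x, 0, 0, 0)]]"
  have tup: "?e x \<in> tuples tuple_struct" for x
    using vertex_elements by (simp add: tuples_def tuple_struct_def)
  have node: "node_rank [(x, 0, 0, 0)] = (rk x, 0)" for x by (simp add: node_rank_def)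
  show "\<exists>xs \<in> tuples word_struct. \<forall>\<gamma> < \<beta>. \<exists>ys \<in> tuples word_struct. length ys = length xs \<and>
      scott_equiv word_struct \<gamma> xs ys \<and> \<not> isomorphic_with word_struct xs word_struct ys"
  proof (rule bexI[of _ "map encode_tuple (?e x)"], intro allI impI)
    show "map encode_tuple (?e x) \<in> tuples word_struct"
      by (rule is_iso_tuples[OF is_iso_encode_tuple tup])
    fix \<gamma> assume \<gamma>: "\<gamma> < \<beta>"
    then obtain y where y: "rk y = \<gamma>" using surj \<beta> by (meson less_trans)
    \<comment> \<open>The two nodes have ranks \<open>(\<beta>, 0)\<close> and
      \<open>(\<gamma>, 0)\<close>, which coincide when cut at \<open>(\<gamma>, 0)\<close>.\<close>
    define p :: "(level list \<times> level list) set" where "p = {([], []), ([(x, 0, 0, 0)], [(y, 0, 0, 0)])}"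
    have "chain L i = None" if "length L < 2" for L i
      using chain_None_mono[of L 0 i] that by simp
    then have "partial_iso (\<gamma>, 0) p"
      using \<gamma> x y by (auto simp: partial_iso_def p_def similar_def node min_def less_eq_prod_def)
    moreover have "list_all2 (lifted p) (?e x) (?e y)"
      by (auto simp: p_def intro: lifted.vertex)
    ultimately have "scott_equiv tuple_struct \<gamma> (?e x) (?e y)"
      by (rule partial_iso_scott_equiv)
    then have "scott_equiv word_struct \<gamma> (map encode_tuple (?e x)) (map encode_tuple (?e y))"
      by (intro scott_equiv_iso[OF is_iso_encode_tuple] tup) simp_all
    moreover have "\<not> isomorphic_with tuple_struct (?e x) tuple_struct (?e y)"
    proof
      assume "isomorphic_with tuple_struct (?e x) tuple_struct (?e y)"
      then obtain f where "is_iso f tuple_struct tuple_struct" "f (vertex [(x, 0, 0, 0)]) = vertex [(y, 0, 0, 0)]"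
        by (auto simp: isomorphic_with_def)
      then have "node_rank [(x, 0, 0, 0)] \<le> node_rank [(y, 0, 0, 0)]"
        by (rule automorphism_rank) simp_all
      then show False using node x y \<gamma> by (auto simp: less_eq_prod_def)
    qed
    then have "\<not> isomorphic_with word_struct (map encode_tuple (?e x)) word_struct (map encode_tuple (?e y))"
      using isomorphic_with_iso[OF is_iso_encode_tuple tup tup] by blast
    ultimately show "\<exists>ys \<in> tuples word_struct. length ys = length (map encode_tuple (?e x)) \<and>
        scott_equiv word_struct \<gamma> (map encode_tuple (?e x)) ys \<and>
        \<not> isomorphic_with word_struct (map encode_tuple (?e x)) word_struct ys"
      by (intro bexI[of _ "map encode_tuple (?e y)"] conjI is_iso_tuples[OF is_iso_encode_tuple tup]) simp_all
  qed
qed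

end

theorem theorem3:
  fixes \<alpha> :: countable_ordinal
  assumes "computable_ordinal \<alpha>"
  shows "\<exists>A :: nat list struct. automatic A \<and> \<alpha> \<le> scott_rank A"
proof -
  obtain r where r: "Well_order r" "computable_rel r" "order_type r = \<alpha>"
    using assms by (auto simp: computable_ordinal_def)
  then obtain P where P: "\<And>m n. halts_with P ((\<lambda>_. 0)(0 := m, 1 := n)) (if (m, n) \<in> r then 1 else 0)"
    by (auto simp: computable_rel_def)
  interpret wo: wo_rel r by standard (rule r(1))
  have "wf (r - Id)" "trans (r - Id)"
    using wo.WF wo.TRANS wo.ANTISYM by (auto intro: trans_diff_Id)
  then obtain rk :: "nat \<Rightarrow> countable_ordinal" where rk: "\<And>x. {rk y | y. (y, x) \<in> r - Id} = {\<gamma>. \<gamma> < rk x}"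
    using transitive_wf_rank_exists by blast
  \<comment> \<open>The sum of all register indices bounds each of them; the 2 keeps the argument
    registers 0 and 1 below \<open>K\<close> and makes the bound strict.\<close>
  define K where "K = 2 + sum_list (map instr_reg P)"
  interpret claim_tree K P r rk
  proof
    show "\<forall>a \<in> set P. instr_reg a < K"
      using member_le_sum_list[of _ "map instr_reg P"] by (fastforce simp: K_def)
  qed (use P rk in \<open>auto simp: K_def\<close>)
  \<comment> \<open>The values of \<open>rk\<close> are closed downwards, so this inequality
    suffices for every \<beta> < \<alpha> to be a rank.\<close>
  have ge: "a \<in> Field r \<Longrightarrow> segment_type r a \<le> rk a" for a
    using \<open>wf (r - Id)\<close>
  proof (induction a rule: wf_induct_rule)
    case (less a)
    show ?case
    proof (rule ccontr)
      assume "\<not> segment_type r a \<le> rk a"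
      then have "rk a < segment_type r a" by simp
      then obtain b where b: "(b, a) \<in> r" "b \<noteq> a" "rk a = segment_type r b"
        using less_segment_type[OF r(1) less.prems] by blast
      have "segment_type r b \<le> rk b"
        using less.IH[of b] b FieldI1[OF b(1)] by simp
      moreover have "rk b < rk a" using rk[of a] b by blast
      ultimately show False using b(3) by simp
    qed
  qed
  have "\<exists>x. rk x = \<beta>" if \<beta>: "\<beta> < \<alpha>" for \<beta>
  proof -
    obtain a where a: "a \<in> Field r" "\<beta> = segment_type r a"
      using less_order_type_iff[OF r(1)] \<beta> r(3) by blast
    show ?thesis
    proof (cases "\<beta> = rk a")
      case False
      then have "\<beta> \<in> {\<gamma>. \<gamma> < rk a}" using ge[OF a(1)] a(2) by simp
      then show ?thesis unfolding rk[symmetric] by auto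
    qed auto
  qed
  then have "\<alpha> \<le> scott_rank word_struct" by (rule scott_rank_ge)
  then show ?thesis using automatic_word_struct by blast
qed

end
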